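(* Let $A>0$, $M>0$ be given, and let $k\ge 1$. Suppose that $\alpha_n>-1$, $a_n\in]0,A]$ and $(\alpha_n,a_n)\to(\alpha,a)\in]-1,M[\times]0,A]$ as $n\to\infty$. Then $\mu_k^{+}(\alpha_n,a_n)\to\mu_k^{+}(\alpha,a)$ and $\mu_k^{-}(\alpha_n,a_n)\to\mu_k^{-}(\alpha,a)$.
   Context: Fix an integer $N\ge 1$ and $A>0$. For $\alpha>-1$, $0<a\le A$ and a function $g=g(r)$, $r>0$, set $\mathcal{M}_{a,A}(r,g',g'')=\Gamma_1 g''+\Gamma_2\frac{N-1}{r}g'$, where $\Gamma_1=A$ if $g''>0$, $\Gamma_1=a$ if $g''<0$, $\Gamma_2=A$ if $g'>0$, $\Gamma_2=a$ if $g'<0$, and $\tilde F_{\alpha,a}(r,g',g'')=|g'|^\alpha\mathcal{M}_{a,A}(r,g',g'')$ (the radial form on $\mathbb{R}^N$ of $|\nabla u|^\alpha\mathcal{M}_{a,A}(D^2u)$ with $\mathcal{M}_{a,A}$ the Pucci operator $A\,\mathrm{tr}(M^+)-a\,\mathrm{tr}(M^-)$). For functions that are not $\mathcal{C}^2$ it is understood as $\Gamma_1\frac{d}{dr}\big(\frac{|g'|^\alpha g'}{1+\alpha}\big)+\Gamma_2\frac{N-1}{r}|g'|^\alpha g'$, the derivative being taken in the distributional sense (and $\Gamma_1$ being determined by the sign of that derivative). Let $w^+$ (respectively $w^-$) be the unique $\mathcal{C}^1$ solution on $[0,\infty[$ of $\tilde F_{\alpha,a}(r,w',w'')=-|w|^\alpha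 w$ in $\mathbb{R}^+$, $w'(0)=0$, with $w(0)=1$ (respectively $w(0)=-1$). These functions have infinitely many zeros; let $\beta_k^{\pm}$ be the $k$-th positive zero of $w^{\pm}$. Then $\mu_k^{\pm}(\alpha,a)=(\beta_k^{\pm})^{\alpha+2}$; these are the radial eigenvalues of $\tilde F_{\alpha,a}$ in the unit ball $B(0,1)\subset\mathbb{R}^N$ with zero boundary condition. *)

theory Defs
  imports "HOL-Analysis.Analysis"
begin

text \<open>
  The map \<open>x \<mapsto> \<bar>x\<bar>\<^sup>\<alpha> x\<close>.  As \<^term>\<open>0 powr \<alpha> = 0\<close>, it vanishes at \<open>0\<close> for every \<open>\<alpha>\<close>, which for
  \<open>\<alpha> > -1\<close> is its continuous extension (also when \<open>-1 < \<alpha> < 0\<close>).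
\<close>

definition signed_power :: "real \<Rightarrow> real \<Rightarrow> real" where
  "signed_power \<alpha> x = \<bar>x\<bar> powr \<alpha> * x"

text \<open>
  The coefficients \<open>\<Gamma>\<^sub>1\<close> and \<open>\<Gamma>\<^sub>2\<close> as functions of the quantity whose sign determines them.  The value
  at \<open>0\<close> is immaterial: the coefficient always multiplies a quantity that has the sign of \<open>t\<close>.
\<close>

definition Pucci_coeff :: "real \<Rightarrow> real \<Rightarrow> real \<Rightarrow> real" where
  "Pucci_coeff a A t = (if t > 0 then A else a)"

definition test_function :: "(real \<Rightarrow> real) \<Rightarrow> bool" where
  "test_function \<eta> \<longleftrightarrow>
     (\<forall>n x. (deriv ^^ n) \<eta> differentiable (at x)) \<and>
     compact (closure {x. \<eta> x \<noteq> 0}) \<and> closure {x. \<eta> x \<noteq> 0} \<subseteq> {0<..}"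

text \<open>The distributional derivative of \<open>f\<close> on \<open>]0,\<infinity>[\<close> is the locally integrable function \<open>\<psi>\<close>.\<close>

definition has_distributional_derivative :: "(real \<Rightarrow> real) \<Rightarrow> (real \<Rightarrow> real) \<Rightarrow> bool" where
  "has_distributional_derivative f \<psi> \<longleftrightarrow>
     (\<forall>K. compact K \<and> K \<subseteq> {0<..} \<longrightarrow> \<psi> absolutely_integrable_on K) \<and>
     (\<forall>\<eta>. test_function \<eta> \<longrightarrow>
        (LINT r:{0<..}|lebesgue. f r * deriv \<eta> r) = - (LINT r:{0<..}|lebesgue. \<psi> r * \<eta> r))"

text \<open>
  \<open>w\<close> is a \<open>C\<^sup>1\<close> function on \<open>[0,\<infinity>[\<close> with \<open>w'(0) = 0\<close> and \<open>w(0) = s\<close> such that, on \<open>]0,\<infinity>[\<close>,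
  \<open>\<Gamma>\<^sub>1 d/dr (\<bar>w'\<bar>\<^sup>\<alpha> w' / (1 + \<alpha>)) + \<Gamma>\<^sub>2 (N - 1)/r \<bar>w'\<bar>\<^sup>\<alpha> w' = - \<bar>w\<bar>\<^sup>\<alpha> w\<close>.
  Since \<open>\<Gamma>\<^sub>1\<close> depends on the sign of the distributional derivative, that derivative is required to be
  a locally integrable function, and the equation an identity between such functions, that is,
  almost everywhere.
\<close>

definition radial_solution ::
    "nat \<Rightarrow> real \<Rightarrow> real \<Rightarrow> real \<Rightarrow> real \<Rightarrow> (real \<Rightarrow> real) \<Rightarrow> bool" where
  "radial_solution N A \<alpha> a s w \<longleftrightarrow>
     (\<exists>w' \<psi>.
        (\<forall>r\<ge>0. (w has_real_derivative w' r) (at r within {0..})) \<and>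
        continuous_on {0..} w' \<and> w' 0 = 0 \<and> w 0 = s \<and>
        has_distributional_derivative (\<lambda>r. signed_power \<alpha> (w' r) / (1 + \<alpha>)) \<psi> \<and>
        (AE r in lebesgue. r > 0 \<longrightarrow>
           Pucci_coeff a A (\<psi> r) * \<psi> r +
           Pucci_coeff a A (w' r) * ((real N - 1) / r) * signed_power \<alpha> (w' r)
           = - signed_power \<alpha> (w r)))"

text \<open>
  The unique solution; it lives on \<open>[0,\<infinity>[\<close>, so it is taken extensional there to be unique as a total
  function.
\<close>

definition the_radial_solution :: "nat \<Rightarrow> real \<Rightarrow> real \<Rightarrow> real \<Rightarrow> real \<Rightarrow> real \<Rightarrow> real" where
  "the_radial_solution N A \<alpha> a s =
     (THE w. w \<in> extensional {0..} \<and> radial_solution N A \<alpha> a s w)"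

definition w_plus :: "nat \<Rightarrow> real \<Rightarrow> real \<Rightarrow> real \<Rightarrow> real \<Rightarrow> real" where
  "w_plus N A \<alpha> a = the_radial_solution N A \<alpha> a 1"

definition w_minus :: "nat \<Rightarrow> real \<Rightarrow> real \<Rightarrow> real \<Rightarrow> real \<Rightarrow> real" where
  "w_minus N A \<alpha> a = the_radial_solution N A \<alpha> a (-1)"

text \<open>
  The \<open>k\<close>-th positive zero, \<open>k \<ge> 1\<close>: the zero \<open>b\<close> for which \<open>]0,b]\<close> contains exactly \<open>k\<close> zeros
  (finitely many, because infinite sets have cardinality \<open>0\<close>).
\<close>

definition kth_positive_zero :: "(real \<Rightarrow> real) \<Rightarrow> nat \<Rightarrow> real" where
  "kth_positive_zero w k = (THE b. b > 0 \<and> w b = 0 \<and> card {r. 0 < r \<and> r \<le> b \<and> w r = 0} = k)"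

definition mu_plus :: "nat \<Rightarrow> real \<Rightarrow> nat \<Rightarrow> real \<Rightarrow> real \<Rightarrow> real" where
  "mu_plus N A k \<alpha> a = kth_positive_zero (w_plus N A \<alpha> a) k powr (\<alpha> + 2)"

definition mu_minus :: "nat \<Rightarrow> real \<Rightarrow> nat \<Rightarrow> real \<Rightarrow> real \<Rightarrow> real" where
  "mu_minus N A k \<alpha> a = kth_positive_zero (w_minus N A \<alpha> a) k powr (\<alpha> + 2)"

end

theory Submission
  imports Defs "HOL-Complex_Analysis.Great_Picard"
begin

text \<open>
  Put \<open>\<beta> = 1 + \<alpha>\<close>, \<open>d = N - 1\<close> and \<open>y = \<bar>w'\<bar>\<^sup>\<alpha> w'\<close>. Since \<open>t \<mapsto> \<Gamma>\<^sub>1 t\<close> is a piecewise linear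
  homeomorphism, the equation says that \<open>y\<close> has a continuous distributional derivative. By the lemma of du
  Bois-Reymond \<open>(w, y)\<close> is a classical solution of a first-order system, singular at \<open>r = 0\<close>
  (\<open>radial_solution_imp_radial_system\<close>). The theorem follows from compactness and uniqueness for this
  system.

  Bounds that are uniform for parameters in compact sets, together with the theorem of Arzela and Ascoli, show
  that a sequence of solutions with convergent parameters has a subsequence that converges uniformly on
  \<open>[0,R]\<close>, along with the functions \<open>y\<close>, to a solution for the limit parameters
  (\<open>solutions_subsequence_converges\<close>). The same method gives existence
  (\<open>radial_system_exists\<close>).

  Uniqueness (\<open>radial_system_unique\<close>) is the delicate point, because the system is not Lipschitz where \<open>w = 0\<close>
  or \<open>y = 0\<close>. But it is positively homogeneous, so that the quotient \<open>\<bar>w'/w\<bar>\<^sup>\<alpha> w'/w\<close>, where \<open>w\<close> does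
  not vanish, and the quotient \<open>w/w'\<close>, where \<open>w'\<close> does not vanish, each satisfy a scalar equation, and
  these have locally a one-sided Lipschitz right-hand side. The singular term of the first equation has
  the favourable sign, and so uniqueness holds from \<open>r = 0\<close> on. Moreover \<open>w\<close> and \<open>w'\<close> never vanish
  together (\<open>radial_system_nonzero\<close>): all zeros are simple.

  By the first scalar equation, of Riccati type, the solution oscillates
  (\<open>global_solution_zeros_unbounded\<close>), so the zeros form an increasing sequence. As they are simple,
  the number of zeros in \<open>]0,r]\<close> is stable under uniform convergence of \<open>w\<close> and \<open>y\<close>
  (\<open>zero_count_converges\<close>), and hence so is the \<open>k\<close>-th zero.
\<close>


section \<open>Signed powers and piecewise linear maps\<close>

text \<open>
  The signed power \<open>\<bar>x\<bar>\<^sup>\<beta> sgn x\<close>. In terms of the exponent \<open>\<beta> = 1 + \<alpha> > 0\<close> the inverse of a signed power is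
  again one, with exponent \<open>1/\<beta>\<close>.
\<close>

definition spow :: "real \<Rightarrow> real \<Rightarrow> real" where
  "spow \<beta> x = sgn x * \<bar>x\<bar> powr \<beta>"

lemma signed_power_eq_spow: "signed_power \<alpha> x = spow (1 + \<alpha>) x"
  by (cases "x = 0") (auto simp: signed_power_def spow_def powr_add sgn_real_def)

lemma spow_0 [simp]: "spow \<beta> 0 = 0"
  by (simp add: spow_def)

lemma spow_minus: "spow \<beta> (- x) = - spow \<beta> x"
  by (simp add: spow_def sgn_minus)

lemma abs_spow: "\<bar>spow \<beta> x\<bar> = \<bar>x\<bar> powr \<beta>"
  by (simp add: spow_def abs_mult abs_sgn_eq)

lemma sgn_spow [simp]: "sgn (spow \<beta> x) = sgn x"
  by (auto simp: spow_def sgn_mult sgn_real_def)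

lemma spow_eq_0_iff [simp]: "spow \<beta> x = 0 \<longleftrightarrow> x = 0"
  by (simp add: spow_def sgn_0_0)

lemma spow_pos_iff [simp]: "spow \<beta> x > 0 \<longleftrightarrow> x > 0"
  by (metis sgn_1_pos sgn_spow)

lemma spow_neg_iff [simp]: "spow \<beta> x < 0 \<longleftrightarrow> x < 0"
  by (metis sgn_1_neg sgn_spow)

lemma spow_of_pos: "x > 0 \<Longrightarrow> spow \<beta> x = x powr \<beta>"
  by (simp add: spow_def)

lemma spow_mult: "spow \<beta> (x * y) = spow \<beta> x * spow \<beta> y"
  by (simp add: spow_def sgn_mult abs_mult powr_mult)

lemma spow_divide: "spow \<beta> (x / y) = spow \<beta> x / spow \<beta> y"
  unfolding spow_def sgn_divide abs_divide by (subst powr_divide) (auto simp: sgn_if)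

lemma spow_spow: "spow \<gamma> (spow \<beta> x) = spow (\<beta> * \<gamma>) x"
  by (simp add: spow_def [of \<gamma>] abs_spow powr_powr) (simp add: spow_def)

lemma spow_1 [simp]: "spow 1 x = x"
  by (simp add: spow_def sgn_mult_abs)

lemma spow_inverse [simp]:
  assumes "\<beta> > 0" shows "spow (1/\<beta>) (spow \<beta> x) = x" "spow \<beta> (spow (1/\<beta>) x) = x"
  using assms by (auto simp: spow_spow)

lemma mult_spow: "x * spow \<beta> x = \<bar>x\<bar> powr (1 + \<beta>)"
  by (cases "x = 0") (auto simp: spow_def powr_add sgn_real_def)

text \<open>
  Joint continuity in the base and the exponent. At the base \<open>0\<close>, where \<open>sgn\<close> jumps, it follows from the
  convergence of the absolute values.
\<close>

lemma tendsto_spow: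
  assumes x: "(f \<longlongrightarrow> x) F" and b: "(g \<longlongrightarrow> \<beta>) F" and "\<beta> > 0"
  shows "((\<lambda>t. spow (g t) (f t)) \<longlongrightarrow> spow \<beta> x) F"
proof -
  have abs: "((\<lambda>t. \<bar>f t\<bar> powr g t) \<longlongrightarrow> \<bar>x\<bar> powr \<beta>) F"
    by (rule tendsto_powr'[OF tendsto_rabs[OF x] b]) (use \<open>\<beta> > 0\<close> in auto)
  show ?thesis
  proof (cases "x = 0")
    case True
    then have "((\<lambda>t. \<bar>spow (g t) (f t)\<bar>) \<longlongrightarrow> 0) F" using abs by (simp add: abs_spow)
    then show ?thesis using True by (simp add: tendsto_rabs_zero_iff)
  next
    case False
    show ?thesis unfolding spow_def by (intro tendsto_intros x abs False)
  qed
qed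

lemma continuous_on_spow [continuous_intros]:
  assumes "\<beta> > 0" "continuous_on S f" shows "continuous_on S (\<lambda>t. spow \<beta> (f t))"
  using assms unfolding continuous_on_def by (auto intro!: tendsto_spow)

lemma DERIV_spow:
  assumes "x \<noteq> 0"
  shows "(spow \<beta> has_real_derivative \<beta> * \<bar>x\<bar> powr (\<beta> - 1)) (at x)"
proof (cases "x > 0")
  case True
  have "((\<lambda>x. x powr \<beta>) has_real_derivative \<beta> * x powr (\<beta> - 1)) (at x)"
    using True by (rule has_real_derivative_powr)
  moreover have "\<forall>\<^sub>F t in nhds x. t powr \<beta> = spow \<beta> t"
    using eventually_nhds_in_open[of "{0<..}" x] True
    by (auto elim!: eventually_mono simp: spow_of_pos)
  ultimately have "(spow \<beta> has_real_derivative \<beta> * x powr (\<beta> - 1)) (at x)"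
    by (simp cong: DERIV_cong_ev)
  then show ?thesis using True by simp
next
  case False
  then have x: "x < 0" using assms by simp
  have "((\<lambda>x. - ((- x) powr \<beta>)) has_real_derivative \<beta> * (- x) powr (\<beta> - 1)) (at x)"
    using x by (auto intro!: derivative_eq_intros)
  moreover have "\<forall>\<^sub>F t in nhds x. - ((-t) powr \<beta>) = spow \<beta> t"
    using eventually_nhds_in_open[of "{..<0}" x] x
    by (auto elim!: eventually_mono simp: spow_def)
  ultimately have "(spow \<beta> has_real_derivative \<beta> * (- x) powr (\<beta> - 1)) (at x)"
    by (simp cong: DERIV_cong_ev)
  then show ?thesis using x by simp
qed

text \<open>
  For an exponent above \<open>1\<close> the power \<open>\<bar>x\<bar>\<^sup>p\<close> is differentiable at \<open>0\<close> too. This is what makes the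
  Riccati equations below Lipschitz although the signed powers of the system are not.
\<close>

lemma DERIV_abs_powr:
  assumes "\<beta> > 0"
  shows "((\<lambda>x. \<bar>x\<bar> powr (1 + \<beta>)) has_real_derivative (1 + \<beta>) * spow \<beta> x) (at x)"
proof (cases "x = 0")
  case False
  have "((\<lambda>x. x * spow \<beta> x) has_real_derivative 1 * spow \<beta> x + (\<beta> * \<bar>x\<bar> powr (\<beta> - 1)) * x) (at x)"
    by (intro DERIV_mult DERIV_ident DERIV_spow False)
  moreover have "\<bar>x\<bar> powr (\<beta> - 1) * x = spow \<beta> x"
    using False by (auto simp: spow_def powr_diff sgn_real_def)
  ultimately show ?thesis by (simp add: mult_spow algebra_simps)
next
  case True
  have "((\<lambda>y. spow \<beta> y) \<longlongrightarrow> spow \<beta> 0) (at 0)"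
    by (rule tendsto_spow[OF tendsto_ident_at tendsto_const assms])
  then have "(spow \<beta> \<longlongrightarrow> 0) (at 0)" by simp
  moreover have "\<bar>y\<bar> powr (1 + \<beta>) / y = spow \<beta> y" if "y \<noteq> 0" for y
    using that unfolding mult_spow[symmetric] by simp
  then have "\<forall>\<^sub>F y in at 0. spow \<beta> y = \<bar>y\<bar> powr (1 + \<beta>) / y"
    by (simp add: eventually_at_filter)
  ultimately have "((\<lambda>y. \<bar>y\<bar> powr (1 + \<beta>) / y) \<longlongrightarrow> 0) (at 0)"
    by (rule Lim_transform_eventually)
  then show ?thesis using True by (simp add: has_field_derivative_iff)
qed

lemma abs_powr_Lipschitz:
  fixes \<beta> K x y :: real
  assumes "\<beta> > 0" "\<bar>x\<bar> \<le> K" "\<bar>y\<bar> \<le> K"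
  shows "\<bar>\<bar>x\<bar> powr (1 + \<beta>) - \<bar>y\<bar> powr (1 + \<beta>)\<bar> \<le> (1 + \<beta>) * K powr \<beta> * \<bar>x - y\<bar>"
proof -
  have "norm (\<bar>x\<bar> powr (1 + \<beta>) - \<bar>y\<bar> powr (1 + \<beta>)) \<le> (1 + \<beta>) * K powr \<beta> * norm (x - y)"
  proof (rule field_differentiable_bound[where S="{-K..K}"])
    show "((\<lambda>x. \<bar>x\<bar> powr (1 + \<beta>)) has_real_derivative (1 + \<beta>) * spow \<beta> z) (at z within {-K..K})" for z
      using DERIV_abs_powr[OF assms(1)] by (rule has_field_derivative_at_within)
    show "norm ((1 + \<beta>) * spow \<beta> z) \<le> (1 + \<beta>) * K powr \<beta>" if "z \<in> {-K..K}" for z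
      using that assms by (auto simp: abs_mult abs_spow intro!: mult_left_mono powr_mono2)
  qed (use assms in auto)
  then show ?thesis by simp
qed

text \<open>
  The map \<open>t \<mapsto> \<Gamma> t\<close>, where the coefficient \<open>\<Gamma>\<close> is \<open>b\<close> or \<open>c\<close> according to the sign of \<open>t\<close>; its
  inverse is the map with the inverse slopes.
\<close>

definition pl :: "real \<Rightarrow> real \<Rightarrow> real \<Rightarrow> real" where
  "pl b c t = b * max t 0 + c * min t 0"

lemma Pucci_coeff_mult: "Pucci_coeff a A t * t = pl A a t"
  by (auto simp: Pucci_coeff_def pl_def max_def min_def)

lemma pl_nonneg_eq: "t \<ge> 0 \<Longrightarrow> pl b c t = b * t"
  by (simp add: pl_def)

lemma pl_nonpos_eq: "t \<le> 0 \<Longrightarrow> pl b c t = c * t"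
  by (simp add: pl_def)

lemma pl_minus: "pl b c (- t) = - pl c b t"
  by (simp add: pl_def max_def min_def)

lemma pl_mult:
  assumes "s \<ge> 0" shows "pl b c (s * t) = s * pl b c t"
proof (cases "t \<ge> 0")
  case True
  then show ?thesis using assms by (simp add: pl_nonneg_eq)
next
  case False
  then have "s * t \<le> 0" using assms by (intro mult_nonneg_nonpos) auto
  then show ?thesis using False by (simp add: pl_nonpos_eq)
qed

lemma pl_divide: "s \<ge> 0 \<Longrightarrow> pl b c (t / s) = pl b c t / s"
  using pl_mult[of "inverse s" b c t] by (simp only: divide_inverse mult.commute inverse_nonnegative_iff_nonnegative)

lemma pl_mono: "b \<ge> 0 \<Longrightarrow> c \<ge> 0 \<Longrightarrow> s \<le> t \<Longrightarrow> pl b c s \<le> pl b c t"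
  unfolding pl_def by (intro add_mono mult_left_mono) auto

lemma pl_Lipschitz:
  assumes "0 \<le> b" "b \<le> L" "0 \<le> c" "c \<le> L"
  shows "\<bar>pl b c s - pl b c t\<bar> \<le> L * \<bar>s - t\<bar>"
proof -
  have *: "\<bar>pl b c s - pl b c t\<bar> \<le> L * \<bar>s - t\<bar>" if "t \<le> s" for s t
  proof -
    have "pl b c s - pl b c t = b * (max s 0 - max t 0) + c * (min s 0 - min t 0)"
      unfolding pl_def right_diff_distrib by linarith
    also have "\<dots> \<le> L * (max s 0 - max t 0) + L * (min s 0 - min t 0)"
      using assms that by (intro add_mono mult_right_mono) auto
    also have "\<dots> = L * (s - t)" by (cases "s \<ge> 0"; cases "t \<ge> 0"; simp add: algebra_simps)
    finally have "pl b c s - pl b c t \<le> L * (s - t)" .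
    moreover have "pl b c t \<le> pl b c s" using assms that by (intro pl_mono) auto
    ultimately show ?thesis using that by simp
  qed
  show ?thesis
  proof (cases "t \<le> s")
    case False
    then have "\<bar>pl b c t - pl b c s\<bar> \<le> L * \<bar>t - s\<bar>" by (intro *) simp
    then show ?thesis by (subst (1 2) abs_minus_commute)
  qed (rule *)
qed

lemma pl_0 [simp]: "pl b c 0 = 0"
  by (simp add: pl_def)

lemma abs_pl_le: "0 \<le> b \<Longrightarrow> b \<le> L \<Longrightarrow> 0 \<le> c \<Longrightarrow> c \<le> L \<Longrightarrow> \<bar>pl b c t\<bar> \<le> L * \<bar>t\<bar>"
  using pl_Lipschitz[of b L c t 0] by simp

lemma pl_inverse:
  assumes "b > 0" "c > 0"
  shows "pl (1/b) (1/c) (pl b c t) = t" "pl b c (pl (1/b) (1/c) t) = t"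
proof -
  have *: "pl (1/b) (1/c) (pl b c t) = t" if "b > 0" "c > 0" for b c
  proof (cases "t \<ge> 0")
    case True
    then show ?thesis using that by (simp add: pl_nonneg_eq)
  next
    case False
    then have "c * t \<le> 0" using that by (intro mult_nonneg_nonpos) auto
    then show ?thesis using that False by (simp add: pl_nonpos_eq)
  qed
  show "pl (1/b) (1/c) (pl b c t) = t" by (rule *[OF assms])
  have "pl (1/(1/b)) (1/(1/c)) (pl (1/b) (1/c) t) = t" by (rule *) (use assms in auto)
  then show "pl b c (pl (1/b) (1/c) t) = t" unfolding divide_divide_eq_right by simp
qed

lemma pl_eq_iff: "b > 0 \<Longrightarrow> c > 0 \<Longrightarrow> pl b c s = t \<longleftrightarrow> s = pl (1/b) (1/c) t"
  by (auto simp: pl_inverse)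

lemma tendsto_pl [tendsto_intros]:
  "(f \<longlongrightarrow> b) F \<Longrightarrow> (g \<longlongrightarrow> c) F \<Longrightarrow> (h \<longlongrightarrow> t) F \<Longrightarrow> ((\<lambda>x. pl (f x) (g x) (h x)) \<longlongrightarrow> pl b c t) F"
  unfolding pl_def by (intro tendsto_intros)

lemma continuous_on_pl [continuous_intros]:
  "continuous_on S f \<Longrightarrow> continuous_on S (\<lambda>x. pl b c (f x))"
  unfolding pl_def by (intro continuous_intros)

section \<open>Smooth bumps and distributional derivatives\<close>

lemma DERIV_transform_eventually:
  fixes f :: "real \<Rightarrow> real"
  assumes "(f has_real_derivative D) (at x)" "\<forall>\<^sub>F t in nhds x. f t = g t"
  shows "(g has_real_derivative D) (at x)"
  using assms DERIV_cong_ev[OF refl assms(2) refl] by blast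

definition smooth :: "(real \<Rightarrow> real) \<Rightarrow> bool" where
  "smooth f \<longleftrightarrow> (\<forall>n x. (deriv ^^ n) f differentiable (at x))"

text \<open>
  Smoothness by coinduction: it suffices to exhibit a class of differentiable functions that is closed
  under differentiation.
\<close>

lemma smooth_coinduct:
  assumes "f \<in> S" and S: "\<And>g. g \<in> S \<Longrightarrow> (\<forall>x. g differentiable (at x)) \<and> deriv g \<in> S"
  shows "smooth f"
proof -
  have "(deriv ^^ n) f \<in> S" for n
    by (induction n) (use assms in auto)
  then show ?thesis using S by (auto simp: smooth_def)
qed

lemma smooth_differentiable: "smooth f \<Longrightarrow> f differentiable (at x)"
  unfolding smooth_def by (metis funpow_0)

lemma smooth_deriv: "smooth f \<Longrightarrow> smooth (deriv f)"
  unfolding smooth_def by (metis funpow_simps_right(2) o_apply)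

lemma smooth_if_deriv_smooth:
  assumes "\<And>x. (f has_real_derivative g x) (at x)" "smooth g"
  shows "smooth f"
proof -
  have "deriv f = g" using assms(1) by (auto intro: DERIV_imp_deriv)
  then have "(deriv ^^ n) f differentiable (at x)" for n x
    using assms
    by (cases n) (auto simp: smooth_def funpow_swap1 real_differentiable_def simp del: funpow.simps
        simp: funpow_simps_right)
  then show ?thesis by (simp add: smooth_def)
qed

text \<open>
  The class used for the coinduction: a generating set that is visibly closed under differentiation, by the
  rules for sums, products and affine substitutions.
\<close>

inductive_set smooth_closure :: "(real \<Rightarrow> real) set" where
  base: "smooth f \<Longrightarrow> f \<in> smooth_closure"
| const: "(\<lambda>x. k) \<in> smooth_closure"
| add: "f \<in> smooth_closure \<Longrightarrow> g \<in> smooth_closure \<Longrightarrow> (\<lambda>x. f x + g x) \<in> smooth_closure"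
| mult: "f \<in> smooth_closure \<Longrightarrow> g \<in> smooth_closure \<Longrightarrow> (\<lambda>x. f x * g x) \<in> smooth_closure"
| affine: "f \<in> smooth_closure \<Longrightarrow> (\<lambda>x. f (s * x + t)) \<in> smooth_closure"

lemma smooth_closure_smooth:
  assumes "f \<in> smooth_closure" shows "smooth f"
proof (rule smooth_coinduct[OF assms])
  fix g :: "real \<Rightarrow> real" assume "g \<in> smooth_closure"
  then show "(\<forall>x. g differentiable (at x)) \<and> deriv g \<in> smooth_closure"
  proof induction
    case (base f)
    then show ?case by (auto simp: smooth_differentiable intro: smooth_closure.base smooth_deriv)
  next
    case (const k)
    have "deriv (\<lambda>x::real. k) = (\<lambda>x. 0)" by (auto intro!: DERIV_imp_deriv)
    then show ?case using smooth_closure.const[of 0] by simp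
  next
    case (add f g)
    then have "((\<lambda>x. f x + g x) has_real_derivative deriv f x + deriv g x) (at x)" for x
      by (intro DERIV_add) (auto simp: DERIV_deriv_iff_real_differentiable)
    then have "deriv (\<lambda>x. f x + g x) = (\<lambda>x. deriv f x + deriv g x)"
      by (auto intro: DERIV_imp_deriv)
    then show ?case using add by (auto intro: smooth_closure.add)
  next
    case (mult f g)
    then have "((\<lambda>x. f x * g x) has_real_derivative deriv f x * g x + deriv g x * f x) (at x)" for x
      by (intro DERIV_mult) (auto simp: DERIV_deriv_iff_real_differentiable)
    then have "deriv (\<lambda>x. f x * g x) = (\<lambda>x. deriv f x * g x + deriv g x * f x)"
      by (auto intro: DERIV_imp_deriv)
    then show ?case using mult by (auto intro!: smooth_closure.add smooth_closure.mult)
  next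
    case (affine f s t)
    have *: "((\<lambda>x. f (s * x + t)) has_real_derivative deriv f (s * x + t) * s) (at x)" for x
    proof (rule DERIV_chain2[of f _ "\<lambda>x. s * x + t"])
      show "(f has_real_derivative deriv f (s * x + t)) (at (s * x + t))"
        using affine by (auto simp: DERIV_deriv_iff_real_differentiable)
      show "((\<lambda>x. s * x + t) has_real_derivative s) (at x)"
        by (auto intro!: derivative_eq_intros)
    qed
    then have "deriv (\<lambda>x. f (s * x + t)) = (\<lambda>x. deriv f (s * x + t) * s)"
      by (auto intro: DERIV_imp_deriv)
    moreover have "(\<lambda>x. deriv f (s * x + t) * s) \<in> smooth_closure"
      using affine.IH smooth_closure.affine[of "deriv f" s t] smooth_closure.const
        smooth_closure.mult by blast
    ultimately show ?case using * by (auto simp: real_differentiable_def)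
  qed
qed

lemma poly_times_exp_minus_tendsto_0: "((\<lambda>t::real. poly p t * exp (- t)) \<longlongrightarrow> 0) at_top"
proof -
  have "((\<lambda>t. \<Sum>i\<le>degree p. coeff p i * (t ^ i / exp t)) \<longlongrightarrow> (\<Sum>i\<le>degree p. coeff p i * 0)) at_top"
    by (intro tendsto_intros tendsto_power_div_exp_0)
  then show ?thesis
    by (simp add: poly_altdef sum_distrib_right exp_minus divide_inverse mult.assoc)
qed

text \<open>
  For \<open>p = 1\<close> this is Cauchy's flat function \<open>exp (- 1 / x)\<close>. The polynomial factor makes the class closed
  under differentiation.
\<close>

definition flat_exp :: "real poly \<Rightarrow> real \<Rightarrow> real" where
  "flat_exp p x = (if x > 0 then poly p (1/x) * exp (- (1/x)) else 0)"

lemma DERIV_flat_exp: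
  "(flat_exp p has_real_derivative flat_exp ([:0, 0, 1:] * (p - pderiv p)) x) (at x)"
proof -
  consider "x > 0" | "x < 0" | "x = 0" by linarith
  then show ?thesis
  proof cases
    case 1
    have "((\<lambda>x. poly p (1/x) * exp (- (1/x))) has_real_derivative
        flat_exp ([:0, 0, 1:] * (p - pderiv p)) x) (at x)"
      using 1 by (auto intro!: derivative_eq_intros DERIV_chain2[OF poly_DERIV]
          simp: flat_exp_def field_simps power2_eq_square)
    moreover have "\<forall>\<^sub>F t in nhds x. poly p (1/t) * exp (- (1/t)) = flat_exp p t"
      using eventually_nhds_in_open[of "{0<..}" x] 1
      by (auto elim!: eventually_mono simp: flat_exp_def)
    ultimately show ?thesis by (rule DERIV_transform_eventually)
  next
    case 2
    have "((\<lambda>x. 0::real) has_real_derivative 0) (at x)" by simp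
    moreover have "\<forall>\<^sub>F t in nhds x. 0 = flat_exp p t"
      using eventually_nhds_in_open[of "{..<0}" x] 2
      by (auto elim!: eventually_mono simp: flat_exp_def)
    ultimately have "(flat_exp p has_real_derivative 0) (at x)" by (rule DERIV_transform_eventually)
    then show ?thesis using 2 by (simp add: flat_exp_def)
  next
    case 3
    have "((\<lambda>h. poly (pCons 0 p) (inverse h) * exp (- (inverse h))) \<longlongrightarrow> 0) (at_right 0)"
      by (rule filterlim_compose[OF poly_times_exp_minus_tendsto_0 filterlim_inverse_at_top_right])
    moreover have "\<forall>\<^sub>F h in at_right 0. poly (pCons 0 p) (inverse h) * exp (- (inverse h)) = flat_exp p h / h"
      by (auto simp: eventually_at_filter flat_exp_def field_simps)
    ultimately have R: "((\<lambda>h. flat_exp p h / h) \<longlongrightarrow> 0) (at_right 0)"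
      by (rule Lim_transform_eventually)
    have "\<forall>\<^sub>F h in at_left 0. 0 = flat_exp p h / h"
      by (auto simp: eventually_at_filter flat_exp_def)
    then have L: "((\<lambda>h. flat_exp p h / h) \<longlongrightarrow> 0) (at_left 0)"
      by (rule Lim_transform_eventually[OF tendsto_const])
    have "(flat_exp p has_real_derivative 0) (at 0)"
      using L R by (simp add: has_field_derivative_iff filterlim_at_split flat_exp_def)
    then show ?thesis using 3 by (simp add: flat_exp_def)
  qed
qed

lemma smooth_flat_exp: "smooth (flat_exp p)"
proof (rule smooth_coinduct)
  show "flat_exp p \<in> range flat_exp" by simp
  fix g assume "g \<in> range flat_exp"
  then obtain q where g: "g = flat_exp q" by auto
  have "deriv g = flat_exp ([:0, 0, 1:] * (q - pderiv q))"
    using DERIV_flat_exp[of q] by (auto simp: g intro: DERIV_imp_deriv)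
  then show "(\<forall>x. g differentiable (at x)) \<and> deriv g \<in> range flat_exp"
    using DERIV_flat_exp[of q] by (auto simp: g real_differentiable_def)
qed

definition bump :: "real \<Rightarrow> real \<Rightarrow> real" where
  "bump e x = flat_exp 1 (x + e) * flat_exp 1 (e - x)"

lemma bump_pos: "\<bar>x\<bar> < e \<Longrightarrow> bump e x > 0"
  by (auto simp: bump_def flat_exp_def)

lemma bump_nonneg: "bump e x \<ge> 0"
  by (auto simp: bump_def flat_exp_def)

lemma bump_eq_0: "\<bar>x\<bar> \<ge> e \<Longrightarrow> bump e x = 0"
  by (auto simp: bump_def flat_exp_def)

lemma bump_in_smooth_closure: "bump e \<in> smooth_closure"
proof -
  have "(\<lambda>x. flat_exp 1 (1 * x + e) * flat_exp 1 ((-1) * x + e)) \<in> smooth_closure"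
    by (intro smooth_closure.mult smooth_closure.affine smooth_closure.base smooth_flat_exp)
  moreover have "bump e = (\<lambda>x. flat_exp 1 (1 * x + e) * flat_exp 1 ((-1) * x + e))"
    by (rule ext) (simp add: bump_def)
  ultimately show ?thesis by simp
qed

lemma smooth_continuous_on: "smooth f \<Longrightarrow> continuous_on S f"
  by (meson continuous_at_imp_continuous_on differentiable_imp_continuous_within smooth_differentiable)

text \<open>
  A test function whose derivative is a bump at \<open>c\<close> minus the same bump at \<open>d\<close>; its support is
  compact because both bumps have the same integral.
\<close>

lemma test_function_with_bump_derivative:
  assumes "0 < e" "e < c" "e < d"
  obtains \<eta> where "test_function \<eta>" "deriv \<eta> = (\<lambda>x. bump e (x - c) - bump e (x - d))"
proof -
  have sm: "smooth (bump e)" by (rule smooth_closure_smooth[OF bump_in_smooth_closure])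
  have "\<exists>Q. \<forall>x::real. -\<infinity> < ereal x \<longrightarrow> ereal x < \<infinity> \<longrightarrow> (Q has_vector_derivative bump e x) (at x)"
    by (rule einterval_antiderivative)
      (use sm in \<open>auto intro!: differentiable_imp_continuous_within smooth_differentiable\<close>)
  then obtain Q where Q: "\<And>x. (Q has_real_derivative bump e x) (at x)"
    by (auto simp: has_real_derivative_iff_has_vector_derivative)
  have "\<exists>k. \<forall>x\<in>{..-e}. Q x = k"
  proof (rule has_field_derivative_zero_constant)
    show "(Q has_real_derivative 0) (at x within {..-e})" if "x \<in> {..-e}" for x
      using Q[of x] that by (auto simp: bump_eq_0 intro: has_field_derivative_at_within)
  qed simp
  then obtain k1 where k1: "\<And>x. x \<le> -e \<Longrightarrow> Q x = k1" by auto
  have "\<exists>k. \<forall>x\<in>{e..}. Q x = k"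
  proof (rule has_field_derivative_zero_constant)
    show "(Q has_real_derivative 0) (at x within {e..})" if "x \<in> {e..}" for x
      using Q[of x] that by (auto simp: bump_eq_0 intro: has_field_derivative_at_within)
  qed simp
  then obtain k2 where k2: "\<And>x. x \<ge> e \<Longrightarrow> Q x = k2" by auto
  define \<eta> where "\<eta> = (\<lambda>x. Q (x - c) - Q (x - d))"
  have D: "(\<eta> has_real_derivative bump e (x - c) - bump e (x - d)) (at x)" for x
    unfolding \<eta>_def
    by (intro DERIV_diff DERIV_chain2[OF Q, THEN DERIV_cong]) (auto intro!: derivative_eq_intros)
  have "(\<lambda>x. bump e (1 * x + (- c)) + (-1) * bump e (1 * x + (- d))) \<in> smooth_closure"
    by (intro smooth_closure.intros(2-) bump_in_smooth_closure)
  then have "smooth (\<lambda>x. bump e (x - c) - bump e (x - d))"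
    by (auto dest: smooth_closure_smooth)
  then have sm_eta: "smooth \<eta>"
    by (rule smooth_if_deriv_smooth[OF D])
  let ?K = "{min c d - e .. max c d + e}"
  have "{x. \<eta> x \<noteq> 0} \<subseteq> ?K"
  proof clarify
    fix x assume ne: "\<eta> x \<noteq> 0"
    show "x \<in> ?K"
    proof (rule ccontr)
      assume "x \<notin> ?K"
      then have "x - c \<le> -e \<and> x - d \<le> -e \<or> x - c \<ge> e \<and> x - d \<ge> e" by auto
      then show False using ne k1 k2 by (auto simp: \<eta>_def)
    qed
  qed
  then have "closure {x. \<eta> x \<noteq> 0} \<subseteq> ?K" by (intro closure_minimal) auto
  moreover have "?K \<subseteq> {0<..}" using assms by auto
  moreover have "compact (closure {x. \<eta> x \<noteq> 0})"
    unfolding compact_closure by (rule bounded_subset[OF bounded_closed_interval \<open>{x. \<eta> x \<noteq> 0} \<subseteq> ?K\<close>])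
  ultimately have "test_function \<eta>" using sm_eta by (auto simp: test_function_def smooth_def)
  moreover have "deriv \<eta> = (\<lambda>x. bump e (x - c) - bump e (x - d))"
    using D by (auto intro: DERIV_imp_deriv)
  ultimately show ?thesis by (rule that)
qed

text \<open>
  The interval is chosen slightly larger than the support, so that boundary terms vanish in integrations by
  parts.
\<close>

lemma test_function_support:
  assumes "test_function \<eta>"
  obtains u v where "0 < u" "u < v" "\<And>x. x \<notin> {u<..<v} \<Longrightarrow> \<eta> x = 0 \<and> deriv \<eta> x = 0"
proof -
  let ?C = "closure {x. \<eta> x \<noteq> 0}"
  have C: "compact ?C" "?C \<subseteq> {0<..}" using assms by (auto simp: test_function_def)
  have out: "\<eta> x = 0" if "x \<notin> ?C" for x
    using that closure_subset[of "{x. \<eta> x \<noteq> 0}"] by blast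
  have zero: "\<eta> x = 0 \<and> deriv \<eta> x = 0" if "x \<notin> ?C" for x
  proof -
    have "\<forall>\<^sub>F t in nhds x. t \<in> - ?C"
      by (rule eventually_nhds_in_open) (use that in \<open>simp_all only: open_Compl closed_closure Compl_iff not_False_eq_True\<close>)
    then have "\<forall>\<^sub>F t in nhds x. 0 = \<eta> t"
      by (rule eventually_mono) (simp only: Compl_iff out not_False_eq_True)
    then have "(\<eta> has_real_derivative 0) (at x)"
      by (rule DERIV_transform_eventually[OF DERIV_const])
    from out[OF that] DERIV_imp_deriv[OF this] show ?thesis by (rule conjI)
  qed
  define C where "C = ?C"
  note C = C[folded C_def] and zero = zero[folded C_def]
  show ?thesis
  proof (cases "C = {}")
    case True
    have "\<eta> x = 0 \<and> deriv \<eta> x = 0" for x by (rule zero) (simp add: True)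
    then show ?thesis by (intro that[of 1 2]) auto
  next
    case False
    obtain l where l: "l \<in> C" "\<And>x. x \<in> C \<Longrightarrow> l \<le> x"
      using compact_attains_inf[OF C(1) False] by auto
    obtain h where h: "h \<in> C" "\<And>x. x \<in> C \<Longrightarrow> x \<le> h"
      using compact_attains_sup[OF C(1) False] by auto
    have "l > 0" using l C by auto
    show ?thesis
    proof (rule that[of "l/2" "h+1"])
      show "\<eta> x = 0 \<and> deriv \<eta> x = 0" if "x \<notin> {l/2<..<h+1}" for x
      proof (rule zero)
        show "x \<notin> C"
        proof
          assume "x \<in> C"
          then show False using l(2)[of x] h(2)[of x] \<open>l > 0\<close> that by auto
        qed
      qed
    qed (use \<open>l > 0\<close> l(2)[OF h(1)] in auto)
  qed
qed

lemma test_function_DERIV: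
  assumes "test_function \<eta>"
  shows "(\<eta> has_real_derivative deriv \<eta> x) (at x)" "continuous_on S \<eta>" "continuous_on S (deriv \<eta>)"
proof -
  have sm: "smooth \<eta>" using assms by (auto simp: test_function_def smooth_def)
  show "(\<eta> has_real_derivative deriv \<eta> x) (at x)"
    using sm by (auto simp: DERIV_deriv_iff_real_differentiable smooth_differentiable)
  show "continuous_on S \<eta>" "continuous_on S (deriv \<eta>)"
    using sm by (auto intro: smooth_continuous_on smooth_deriv)
qed

lemma LINT_compact_support:
  fixes F :: "real \<Rightarrow> real"
  assumes "0 < u" "continuous_on {u..v} F" "\<And>x. x \<notin> {u..v} \<Longrightarrow> F x = 0"
  shows "(LINT r:{0<..}|lebesgue. F r) = integral {u..v} F"
proof -
  have "F absolutely_integrable_on {u..v}"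
    by (rule absolutely_integrable_continuous_real[OF assms(2)])
  moreover have "(LINT r:{0<..}|lebesgue. F r) = (LINT r:{u..v}|lebesgue. F r)"
    unfolding set_lebesgue_integral_def
    by (rule Bochner_Integration.integral_cong) (use assms in \<open>auto simp: indicator_def\<close>)
  ultimately show ?thesis by (simp add: set_lebesgue_integral_eq_integral(2))
qed

lemma LINT_parts:
  assumes \<eta>: "test_function \<eta>"
    and D: "\<And>r. r > 0 \<Longrightarrow> (f has_real_derivative \<phi> r) (at r)" and cont: "continuous_on {0<..} \<phi>"
  shows "(LINT r:{0<..}|lebesgue. f r * deriv \<eta> r) = - (LINT r:{0<..}|lebesgue. \<phi> r * \<eta> r)"
proof -
  obtain u v where uv: "0 < u" "u < v" "\<And>x. x \<notin> {u<..<v} \<Longrightarrow> \<eta> x = 0 \<and> deriv \<eta> x = 0"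
    using test_function_support[OF \<eta>] by blast
  have sub: "{u..v} \<subseteq> {0<..}" using uv by auto
  have contf: "continuous_on {u..v} f"
    by (rule DERIV_continuous_on[where D=\<phi>]) (use D uv in \<open>auto intro: has_field_derivative_at_within\<close>)
  have c1: "continuous_on {u..v} (\<lambda>r. f r * deriv \<eta> r)"
    by (intro continuous_intros contf test_function_DERIV[OF \<eta>])
  have c2: "continuous_on {u..v} (\<lambda>r. \<phi> r * \<eta> r)"
    by (intro continuous_intros test_function_DERIV[OF \<eta>] continuous_on_subset[OF cont sub])
  have "((\<lambda>r. f r * deriv \<eta> r + \<phi> r * \<eta> r) has_integral (f v * \<eta> v - f u * \<eta> u)) {u..v}"
  proof (rule fundamental_theorem_of_calculus)
    fix r assume r: "r \<in> {u..v}"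
    have "((\<lambda>r. f r * \<eta> r) has_real_derivative f r * deriv \<eta> r + \<phi> r * \<eta> r) (at r)"
      using DERIV_mult[OF D test_function_DERIV(1)[OF \<eta>], of r] r uv by (simp add: algebra_simps)
    then show "((\<lambda>r. f r * \<eta> r) has_vector_derivative f r * deriv \<eta> r + \<phi> r * \<eta> r) (at r within {u..v})"
      by (simp add: has_real_derivative_iff_has_vector_derivative has_vector_derivative_at_within)
  qed (use uv in auto)
  moreover have "f v * \<eta> v - f u * \<eta> u = 0" using uv by auto
  ultimately have "integral {u..v} (\<lambda>r. f r * deriv \<eta> r + \<phi> r * \<eta> r) = 0"
    by (simp add: integral_unique)
  then have "integral {u..v} (\<lambda>r. f r * deriv \<eta> r) = - integral {u..v} (\<lambda>r. \<phi> r * \<eta> r)"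
    using c1 c2 by (simp add: Henstock_Kurzweil_Integration.integral_add integrable_continuous_real)
  moreover have "(LINT r:{0<..}|lebesgue. f r * deriv \<eta> r) = integral {u..v} (\<lambda>r. f r * deriv \<eta> r)"
    by (rule LINT_compact_support) (use uv c1 in auto)
  moreover have "(LINT r:{0<..}|lebesgue. \<phi> r * \<eta> r) = integral {u..v} (\<lambda>r. \<phi> r * \<eta> r)"
    by (rule LINT_compact_support) (use uv c2 in auto)
  ultimately show ?thesis by simp
qed

lemma has_distributional_derivative_classical:
  assumes D: "\<And>r. r > 0 \<Longrightarrow> (f has_real_derivative \<phi> r) (at r)" and cont: "continuous_on {0<..} \<phi>"
  shows "has_distributional_derivative f \<phi>"
  unfolding has_distributional_derivative_def
proof (intro conjI allI impI)
  fix K :: "real set" assume K: "compact K \<and> K \<subseteq> {0<..}"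
  show "\<phi> absolutely_integrable_on K"
  proof (cases "K = {}")
    case False
    obtain l where l: "l \<in> K" "\<And>x. x \<in> K \<Longrightarrow> l \<le> x"
      using compact_attains_inf[OF _ False] K by auto
    obtain h where h: "h \<in> K" "\<And>x. x \<in> K \<Longrightarrow> x \<le> h"
      using compact_attains_sup[OF _ False] K by auto
    have "\<phi> absolutely_integrable_on {l..h}"
      by (intro absolutely_integrable_continuous_real continuous_on_subset[OF cont]) (use l K in auto)
    then show ?thesis
      by (rule set_integrable_subset) (use K l h in \<open>auto simp: compact_imp_closed\<close>)
  qed simp
qed (rule LINT_parts[OF _ D cont])

text \<open>
  The lemma of du Bois-Reymond: after subtracting an antiderivative of \<open>\<phi>\<close>, a continuous function
  \<open>h\<close> with zero distributional derivative remains. If \<open>h c < m < h d\<close>, testing \<open>h - m\<close> against a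
  function whose derivative is a bump at \<open>c\<close> minus a bump at \<open>d\<close> gives a negative number.
\<close>

lemma du_Bois_Reymond:
  assumes contf: "continuous_on {0<..} f" and cont: "continuous_on {0<..} \<phi>"
    and test: "\<And>\<eta>. test_function \<eta> \<Longrightarrow>
        (LINT r:{0<..}|lebesgue. f r * deriv \<eta> r) = - (LINT r:{0<..}|lebesgue. \<phi> r * \<eta> r)"
    and "r > 0"
  shows "(f has_real_derivative \<phi> r) (at r)"
proof -
  have "\<exists>Y. \<forall>x::real. 0 < ereal x \<longrightarrow> ereal x < \<infinity> \<longrightarrow> (Y has_vector_derivative \<phi> x) (at x)"
    by (rule einterval_antiderivative)
      (use cont in \<open>auto simp: continuous_on_eq_continuous_at\<close>)
  then obtain Y where Y: "\<And>x. x > 0 \<Longrightarrow> (Y has_real_derivative \<phi> x) (at x)"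
    by (auto simp: has_real_derivative_iff_has_vector_derivative)
  have contY: "continuous_on {0<..} Y"
    by (rule DERIV_continuous_on[where D=\<phi>]) (use Y in \<open>auto intro: has_field_derivative_at_within\<close>)
  define h where "h = (\<lambda>x. f x - Y x)"
  have conth: "continuous_on {0<..} h" unfolding h_def by (intro continuous_intros contf contY)
  have no_less: "\<not> h c < h d" if "c > 0" "d > 0" for c d
  proof
    assume less: "h c < h d"
    define m where "m = (h c + h d) / 2"
    have m: "h c < m" "m < h d" using less by (auto simp: m_def)
    have "open ({0<..} \<inter> h -` {..<m})" "open ({0<..} \<inter> h -` {m<..})"
      using conth by (auto intro!: continuous_open_preimage)
    moreover have "c \<in> {0<..} \<inter> h -` {..<m}" "d \<in> {0<..} \<inter> h -` {m<..}" using m that by auto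
    ultimately obtain e1 e2 where e12: "e1 > 0" "ball c e1 \<subseteq> {0<..} \<inter> h -` {..<m}"
        "e2 > 0" "ball d e2 \<subseteq> {0<..} \<inter> h -` {m<..}"
      by (meson openE)
    define e where "e = Min {e1, e2, c/2, d/2}"
    have e: "0 < e" "e < c" "e < d" "e \<le> e1" "e \<le> e2"
      using e12 that by (auto simp: e_def min_def)
    have hc: "h x < m" if "\<bar>x - c\<bar> < e" for x
      using e12(2) e that by (auto simp: dist_real_def abs_minus_commute subset_iff)
    have hd: "h x > m" if "\<bar>x - d\<bar> < e" for x
      using e12(4) e that by (auto simp: dist_real_def abs_minus_commute subset_iff)
    obtain \<eta> where \<eta>: "test_function \<eta>" "deriv \<eta> = (\<lambda>x. bump e (x - c) - bump e (x - d))"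
      using test_function_with_bump_derivative e by blast
    obtain u v where uv: "0 < u" "u < v" "\<And>x. x \<notin> {u<..<v} \<Longrightarrow> \<eta> x = 0 \<and> deriv \<eta> x = 0"
      using test_function_support[OF \<eta>(1)] by blast
    have sub: "{u..v} \<subseteq> {0<..}" using uv by auto
    note conts = continuous_on_subset[OF contf sub] continuous_on_subset[OF contY sub]
      continuous_on_subset[OF conth sub] test_function_DERIV(2,3)[OF \<eta>(1)]
    have L: "(LINT r:{0<..}|lebesgue. g r * deriv \<eta> r) = integral {u..v} (\<lambda>r. g r * deriv \<eta> r)"
      if "continuous_on {u..v} g" for g
      by (rule LINT_compact_support) (use uv that conts in \<open>auto intro!: continuous_intros\<close>)
    \<comment> \<open>Both \<open>h\<close> and the constant \<open>m\<close> are orthogonal to \<open>deriv \<eta>\<close>, hence so is \<open>m - h\<close>.\<close>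
    have "integral {u..v} (\<lambda>r. f r * deriv \<eta> r) = integral {u..v} (\<lambda>r. Y r * deriv \<eta> r)"
      using test[OF \<eta>(1)] LINT_parts[OF \<eta>(1) Y cont] L[of f] L[of Y] conts by simp
    moreover have "((\<lambda>r. deriv \<eta> r) has_integral \<eta> v - \<eta> u) {u..v}"
      by (rule fundamental_theorem_of_calculus)
        (use uv test_function_DERIV(1)[OF \<eta>(1)] in \<open>auto simp: has_real_derivative_iff_has_vector_derivative
          intro: has_vector_derivative_at_within\<close>)
    then have "integral {u..v} (\<lambda>r. m * deriv \<eta> r) = 0" using uv by (simp add: integral_unique)
    moreover have "integral {u..v} (\<lambda>r. (m - h r) * deriv \<eta> r)
        = integral {u..v} (\<lambda>r. m * deriv \<eta> r) - (integral {u..v} (\<lambda>r. f r * deriv \<eta> r)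
          - integral {u..v} (\<lambda>r. Y r * deriv \<eta> r))"
      unfolding h_def left_diff_distrib
      by (subst Henstock_Kurzweil_Integration.integral_diff,
          (auto intro!: integrable_continuous_real continuous_intros conts)[2])+ simp
    ultimately have "integral {u..v} (\<lambda>r. (m - h r) * deriv \<eta> r) = 0" by simp
    moreover have "(m - h x) * deriv \<eta> x \<ge> 0" for x
    proof -
      have "(m - h x) * bump e (x - c) \<ge> 0"
        using hc[of x] bump_nonneg[of e "x - c"] bump_eq_0[of e "x - c"] by (cases "\<bar>x - c\<bar> < e") auto
      moreover have "(m - h x) * bump e (x - d) \<le> 0"
        using hd[of x] bump_nonneg[of e "x - d"] bump_eq_0[of e "x - d"]
        by (cases "\<bar>x - d\<bar> < e") (auto intro: mult_nonpos_nonneg)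
      ultimately show ?thesis by (simp add: \<eta>(2) right_diff_distrib)
    qed
    moreover have "continuous_on {u..v} (\<lambda>r. (m - h r) * deriv \<eta> r)"
      by (intro continuous_intros conts)
    ultimately have zero: "(m - h x) * deriv \<eta> x = 0" if "x \<in> {u..v}" for x
      using integral_eq_0_iff[of u v "\<lambda>r. (m - h r) * deriv \<eta> r"] uv(2) that by blast
    \<comment> \<open>The two bumps do not overlap, so at \<open>c\<close> only the first one contributes.\<close>
    have "\<not> \<bar>c - d\<bar> < e" using hd[of c] m by auto
    then have "deriv \<eta> c = bump e 0" by (simp add: \<eta>(2) bump_eq_0)
    then have pos: "deriv \<eta> c > 0" using bump_pos[of 0 e] e by simp
    then have "c \<in> {u<..<v}" using uv(3)[of c] by (metis less_irrefl)
    then have "(m - h c) * deriv \<eta> c = 0" by (intro zero) auto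
    then show False using pos m by simp
  qed
  have h_const: "h x = h r" if "x > 0" for x
    using no_less[of x r] no_less[of r x] that \<open>r > 0\<close> by auto
  have "((\<lambda>x. Y x + h r) has_real_derivative \<phi> r) (at r)"
    using Y[OF \<open>r > 0\<close>] by (auto intro!: derivative_eq_intros)
  moreover have "\<forall>\<^sub>F x in nhds r. Y x + h r = f x"
  proof (rule eventually_mono)
    show "\<forall>\<^sub>F x in nhds r. x \<in> {0<..}" by (rule eventually_nhds_in_open) (use \<open>r > 0\<close> in auto)
    show "Y x + h r = f x" if "x \<in> {0<..}" for x
      using h_const[of x] that by (simp add: h_def)
  qed
  ultimately show ?thesis by (rule DERIV_transform_eventually)
qed

section \<open>The equation as a first-order system\<close>

text \<open>
  With \<open>\<beta> = 1 + \<alpha>\<close>, \<open>d = N - 1\<close> and \<open>y = \<bar>w'\<bar>\<^sup>\<alpha> w'\<close> the equation can be solved for \<open>y'\<close>, because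
  \<open>t \<mapsto> \<Gamma>\<^sub>1 t\<close> is invertible. The slopes \<open>b\<close>, \<open>c\<close> are arbitrary: changing the sign of \<open>w\<close> swaps them,
  so that the solutions starting from \<open>-1\<close> need no separate treatment.
\<close>

definition radial_rhs :: "real \<Rightarrow> real \<Rightarrow> real \<Rightarrow> real \<Rightarrow> real \<Rightarrow> real \<Rightarrow> real \<Rightarrow> real" where
  "radial_rhs d \<beta> b c r w y = \<beta> * pl (1/b) (1/c) (- spow \<beta> w - d / r * pl b c y)"

definition radial_system ::
    "real \<Rightarrow> real \<Rightarrow> real \<Rightarrow> real \<Rightarrow> real \<Rightarrow> real \<Rightarrow> (real \<Rightarrow> real) \<Rightarrow> (real \<Rightarrow> real) \<Rightarrow> bool" where
  "radial_system d \<beta> b c l h w y \<longleftrightarrow>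
     continuous_on {l..h} w \<and> continuous_on {l..h} y \<and>
     (\<forall>r\<in>{l<..<h}. (w has_real_derivative spow (1/\<beta>) (y r)) (at r) \<and>
                   (y has_real_derivative radial_rhs d \<beta> b c r (w r) (y r)) (at r))"

lemma radial_system_minus:
  assumes "radial_system d \<beta> b c l h w y"
  shows "radial_system d \<beta> c b l h (\<lambda>r. - w r) (\<lambda>r. - y r)"
proof -
  have "radial_rhs d \<beta> c b r (- w) (- y) = - radial_rhs d \<beta> b c r w y" for r w y
  proof -
    have "- spow \<beta> (- w) - d / r * pl c b (- y) = - (- spow \<beta> w - d / r * pl b c y)"
      by (simp add: spow_minus pl_minus)
    then show ?thesis unfolding radial_rhs_def by (simp only: pl_minus mult_minus_right)
  qed
  then show ?thesis using assms
    by (auto simp: radial_system_def spow_minus intro!: continuous_intros DERIV_minus)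
qed

lemma radial_system_subset:
  assumes "radial_system d \<beta> b c l h w y" "l \<le> l'" "h' \<le> h"
  shows "radial_system d \<beta> b c l' h' w y"
  using assms by (auto simp: radial_system_def intro: continuous_on_subset)

text \<open>One-sided derivatives at an end point come from the limit of the derivative.\<close>

lemma DERIV_at_left_endpoint:
  fixes w v :: "real \<Rightarrow> real"
  assumes w: "continuous_on {l..h} w" and v: "continuous_on {l..h} v" and "l < h"
    and D: "\<And>r. r \<in> {l<..<h} \<Longrightarrow> (w has_real_derivative v r) (at r)"
  shows "(w has_real_derivative v l) (at l within {l..})"
proof -
  have "((\<lambda>x. w l + integral {l..x} v) has_real_derivative 0 + v l) (at l within {l..h})"
    by (intro DERIV_add DERIV_const integral_has_real_derivative[OF v]) (use \<open>l < h\<close> in auto)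
  moreover have "w l + integral {l..x} v = w x" if "x \<in> {l..h}" for x
  proof -
    have "(v has_integral (w x - w l)) {l..x}"
      by (rule fundamental_theorem_of_calculus_interior)
        (use that D in \<open>auto simp: has_real_derivative_iff_has_vector_derivative
          intro: continuous_on_subset[OF w]\<close>)
    then show ?thesis by (simp add: integral_unique)
  qed
  ultimately have "(w has_real_derivative v l) (at l within {l..h})"
    using \<open>l < h\<close> by (auto intro: has_field_derivative_transform_within[where d=1])
  moreover have "at l within {l..h} = at l within {l..}"
    using \<open>l < h\<close> by (simp add: at_within_Icc_at_right at_within_Ici_at_right)
  ultimately show ?thesis by simp
qed

lemma radial_rhs_continuous_on:
  assumes "\<beta> > 0" "continuous_on S w" "continuous_on S y" "0 \<notin> S"
  shows "continuous_on S (\<lambda>r. radial_rhs d \<beta> b c r (w r) (y r))"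
  unfolding radial_rhs_def using assms by (auto intro!: continuous_intros)

lemma continuous_on_Ici:
  fixes f :: "real \<Rightarrow> 'a::topological_space"
  assumes "\<And>h. continuous_on {l..h} f"
  shows "continuous_on {l..} f"
proof (rule continuous_on_eq_continuous_within[THEN iffD2], rule ballI)
  fix x assume "x \<in> {l..}"
  have "at x within {l..} = at x within {l..x+1}"
    by (rule at_within_nhd[of x "{..<x+1}"]) auto
  moreover have "continuous (at x within {l..x+1}) f"
    using assms[of "x+1"] \<open>x \<in> {l..}\<close> by (auto simp: continuous_on_eq_continuous_within)
  ultimately show "continuous (at x within {l..}) f" by simp
qed

lemma radial_system_imp_radial_solution:
  assumes "\<alpha> > -1" "a > 0" "A > 0"
    and sys: "\<And>h. radial_system (real N - 1) (1 + \<alpha>) A a 0 h w y" and "w 0 = s" "y 0 = 0"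
  shows "radial_solution N A \<alpha> a s w"
proof -
  define \<beta> where "\<beta> = 1 + \<alpha>"
  have "\<beta> > 0" using assms by (simp add: \<beta>_def)
  define w' where "w' = (\<lambda>r. spow (1/\<beta>) (y r))"
  define \<psi> where "\<psi> = (\<lambda>r. radial_rhs (real N - 1) \<beta> A a r (w r) (y r) / \<beta>)"
  note sys = sys[unfolded radial_system_def, folded \<beta>_def]
  have cont: "continuous_on {0..} w" "continuous_on {0..} y"
    using sys by (auto intro!: continuous_on_Ici)
  have cw': "continuous_on {0..} w'"
    unfolding w'_def by (intro continuous_intros cont) (use \<open>\<beta> > 0\<close> in auto)
  have y: "spow \<beta> (w' r) = y r" for r
    unfolding w'_def using \<open>\<beta> > 0\<close> by simp
  have Dw: "(w has_real_derivative w' r) (at r)" and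
    Dy: "(y has_real_derivative \<psi> r * \<beta>) (at r)" if "r > 0" for r
    using sys[of "r + 1"] that \<open>\<beta> > 0\<close> by (auto simp: w'_def \<psi>_def)
  have "(w has_real_derivative w' r) (at r within {0..})" if "r \<ge> 0" for r
  proof (cases "r = 0")
    case True
    show ?thesis unfolding True
      by (rule DERIV_at_left_endpoint[of 0 1])
        (use Dw in \<open>auto intro: continuous_on_subset[OF cont(1)] continuous_on_subset[OF cw']\<close>)
  next
    case False
    then show ?thesis using Dw[of r] that by (auto intro: has_field_derivative_at_within)
  qed
  moreover have "has_distributional_derivative (\<lambda>r. signed_power \<alpha> (w' r) / (1 + \<alpha>)) \<psi>"
  proof (rule has_distributional_derivative_classical)
    show "((\<lambda>r. signed_power \<alpha> (w' r) / (1 + \<alpha>)) has_real_derivative \<psi> r) (at r)" if "r > 0" for r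
      using DERIV_cdivide[OF Dy[OF that], of \<beta>] \<open>\<beta> > 0\<close>
      by (simp add: signed_power_eq_spow y flip: \<beta>_def)
    show "continuous_on {0<..} \<psi>"
      unfolding \<psi>_def by (intro continuous_intros radial_rhs_continuous_on)
        (use \<open>\<beta> > 0\<close> in \<open>auto intro: continuous_on_subset[OF cont(1)] continuous_on_subset[OF cont(2)]\<close>)
  qed
  moreover have "Pucci_coeff a A (\<psi> r) * \<psi> r +
           Pucci_coeff a A (w' r) * ((real N - 1) / r) * signed_power \<alpha> (w' r)
           = - signed_power \<alpha> (w r)" if "r > 0" for r
  proof -
    have "Pucci_coeff a A (w' r) = Pucci_coeff a A (y r)"
      unfolding Pucci_coeff_def w'_def spow_pos_iff ..
    then have "Pucci_coeff a A (w' r) * ((real N - 1) / r) * y r = (real N - 1) / r * pl A a (y r)"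
      using Pucci_coeff_mult[of a A "y r"] by simp
    moreover have "pl A a (\<psi> r) = - spow \<beta> (w r) - (real N - 1) / r * pl A a (y r)"
      using \<open>\<beta> > 0\<close> assms(2,3) by (simp add: \<psi>_def radial_rhs_def pl_inverse)
    ultimately show ?thesis
      unfolding Pucci_coeff_mult signed_power_eq_spow \<beta>_def[symmetric] y by simp
  qed
  moreover have "w' 0 = 0" using \<open>y 0 = 0\<close> by (simp add: w'_def)
  ultimately show ?thesis
    unfolding radial_solution_def using cw' \<open>w 0 = s\<close> by (intro exI[of _ w'] exI[of _ \<psi>]) auto
qed

lemma radial_solution_imp_radial_system:
  assumes "\<alpha> > -1" "a > 0" "A > 0" and sol: "radial_solution N A \<alpha> a s w"
  obtains y where "\<And>h. radial_system (real N - 1) (1 + \<alpha>) A a 0 h w y" "w 0 = s" "y 0 = 0"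
proof -
  define \<beta> where "\<beta> = 1 + \<alpha>"
  have "\<beta> > 0" using assms by (simp add: \<beta>_def)
  obtain w' \<psi> where Dw: "\<And>r. r \<ge> 0 \<Longrightarrow> (w has_real_derivative w' r) (at r within {0..})"
    and cw': "continuous_on {0..} w'" and "w' 0 = 0" "w 0 = s"
    and dd: "has_distributional_derivative (\<lambda>r. signed_power \<alpha> (w' r) / (1 + \<alpha>)) \<psi>"
    and ae: "AE r in lebesgue. r > 0 \<longrightarrow> Pucci_coeff a A (\<psi> r) * \<psi> r +
           Pucci_coeff a A (w' r) * ((real N - 1) / r) * signed_power \<alpha> (w' r)
           = - signed_power \<alpha> (w r)"
    using sol unfolding radial_solution_def by auto
  define y where "y = (\<lambda>r. spow \<beta> (w' r))"
  define \<phi> where "\<phi> = (\<lambda>r. radial_rhs (real N - 1) \<beta> A a r (w r) (y r) / \<beta>)"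
  have cw: "continuous_on {0..} w"
    by (rule DERIV_continuous_on) (use Dw in auto)
  have cy: "continuous_on {0..} y"
    unfolding y_def by (intro continuous_intros cw' \<open>\<beta> > 0\<close>)
  have c\<phi>: "continuous_on {0<..} \<phi>"
    unfolding \<phi>_def by (intro continuous_intros radial_rhs_continuous_on)
      (use \<open>\<beta> > 0\<close> in \<open>auto intro: continuous_on_subset[OF cw] continuous_on_subset[OF cy]\<close>)
  have \<psi>_eq: "AE r in lebesgue. r > 0 \<longrightarrow> \<psi> r = \<phi> r"
    using ae
  proof (rule AE_mp, intro AE_I2 impI)
    fix r :: real
    assume "r > 0 \<longrightarrow> Pucci_coeff a A (\<psi> r) * \<psi> r +
           Pucci_coeff a A (w' r) * ((real N - 1) / r) * signed_power \<alpha> (w' r)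
           = - signed_power \<alpha> (w r)" "r > 0"
    then have "pl A a (\<psi> r) + Pucci_coeff a A (w' r) * ((real N - 1) / r) * y r = - spow \<beta> (w r)"
      by (simp add: Pucci_coeff_mult signed_power_eq_spow \<beta>_def y_def)
    moreover have "Pucci_coeff a A (w' r) = Pucci_coeff a A (y r)"
      unfolding Pucci_coeff_def y_def spow_pos_iff ..
    then have "Pucci_coeff a A (w' r) * ((real N - 1) / r) * y r = (real N - 1) / r * pl A a (y r)"
      using Pucci_coeff_mult[of a A "y r"] by simp
    ultimately have "pl A a (\<psi> r) = - spow \<beta> (w r) - (real N - 1) / r * pl A a (y r)" by linarith
    then show "\<psi> r = \<phi> r"
      using \<open>\<beta> > 0\<close> assms(2,3) by (simp add: pl_eq_iff \<phi>_def radial_rhs_def)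
  qed
  have D: "((\<lambda>r. y r / \<beta>) has_real_derivative \<phi> r) (at r)" if "r > 0" for r
  proof (rule du_Bois_Reymond[OF _ c\<phi> _ that])
    show "continuous_on {0<..} (\<lambda>r. y r / \<beta>)"
      by (intro continuous_intros continuous_on_subset[OF cy]) (use \<open>\<beta> > 0\<close> in auto)
    fix \<eta> assume \<eta>: "test_function \<eta>"
    obtain u v where uv: "0 < u" "u < v" "\<And>x. x \<notin> {u<..<v} \<Longrightarrow> \<eta> x = 0 \<and> deriv \<eta> x = 0"
      using test_function_support[OF \<eta>] by blast
    have m\<eta>: "\<eta> \<in> borel_measurable lebesgue"
      using continuous_imp_measurable_on_sets_lebesgue[OF test_function_DERIV(2)[OF \<eta>, of UNIV]]
      by (simp add: lebesgue_on_UNIV_eq)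
    have "compact {u..v}" "{u..v} \<subseteq> {0<..}" using uv by auto
    have "\<psi> absolutely_integrable_on {u..v}"
      by (rule dd[unfolded has_distributional_derivative_def, THEN conjunct1, THEN spec, THEN mp, OF conjI])
        fact+
    then have m\<psi>: "(\<lambda>r. indicator {u..v} r * \<psi> r) \<in> borel_measurable lebesgue"
      unfolding set_integrable_def real_scaleR_def by (rule borel_measurable_integrable)
    have "\<phi> absolutely_integrable_on {u..v}"
      by (intro absolutely_integrable_continuous_real continuous_on_subset[OF c\<phi>]) (use uv in auto)
    then have m\<phi>: "(\<lambda>r. indicator {u..v} r * \<phi> r) \<in> borel_measurable lebesgue"
      unfolding set_integrable_def real_scaleR_def by (rule borel_measurable_integrable)
    have restrict: "(LINT r:{0<..}|lebesgue. f r * \<eta> r)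
        = (LINT r|lebesgue. (indicator {u..v} r * f r) * \<eta> r)" for f :: "real \<Rightarrow> real"
      unfolding set_lebesgue_integral_def
      by (rule Bochner_Integration.integral_cong) (use uv in \<open>auto simp: indicator_def\<close>)
    have "(LINT r:{0<..}|lebesgue. \<psi> r * \<eta> r) = (LINT r:{0<..}|lebesgue. \<phi> r * \<eta> r)"
      unfolding restrict
    proof (rule integral_cong_AE)
      show "AE r in lebesgue. indicator {u..v} r * \<psi> r * \<eta> r = indicator {u..v} r * \<phi> r * \<eta> r"
        using \<psi>_eq by (rule AE_mp, intro AE_I2) (use uv in \<open>auto simp: indicator_def\<close>)
    qed (intro borel_measurable_times m\<psi> m\<phi> m\<eta>)+
    then show "(LINT r:{0<..}|lebesgue. y r / \<beta> * deriv \<eta> r) = - (LINT r:{0<..}|lebesgue. \<phi> r * \<eta> r)"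
      using dd \<eta> by (simp add: has_distributional_derivative_def signed_power_eq_spow y_def \<beta>_def)
  qed
  have "radial_system (real N - 1) (1 + \<alpha>) A a 0 h w y" for h
    unfolding radial_system_def
  proof (intro conjI ballI)
    show "continuous_on {0..h} w" "continuous_on {0..h} y"
      by (auto intro: continuous_on_subset[OF cw] continuous_on_subset[OF cy])
    fix r assume r: "r \<in> {0<..<h}"
    have "at r within {0..} = at r" by (rule at_within_interior) (use r in auto)
    then show "(w has_real_derivative spow (1 / (1 + \<alpha>)) (y r)) (at r)"
      using Dw[of r] r \<open>\<beta> > 0\<close> by (simp add: y_def flip: \<beta>_def)
    have "((\<lambda>r. \<beta> * (y r / \<beta>)) has_real_derivative \<beta> * \<phi> r) (at r)"
      by (intro DERIV_cmult D) (use r in auto)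
    moreover have "(\<lambda>r. \<beta> * (y r / \<beta>)) = y" using \<open>\<beta> > 0\<close> by simp
    ultimately have "(y has_real_derivative \<beta> * \<phi> r) (at r)" by simp
    then show "(y has_real_derivative radial_rhs (real N - 1) (1 + \<alpha>) A a r (w r) (y r)) (at r)"
      using \<open>\<beta> > 0\<close> by (simp add: \<phi>_def flip: \<beta>_def)
  qed
  then show ?thesis using \<open>w 0 = s\<close> \<open>w' 0 = 0\<close> by (intro that[of y]) (simp_all add: y_def)
qed

section \<open>Compactness and existence\<close>

lemma MVT_interior:
  fixes u :: "real \<Rightarrow> real"
  assumes "s < t" "continuous_on {s..t} u" "\<And>r. r \<in> {s<..<t} \<Longrightarrow> (u has_real_derivative u' r) (at r)"
  obtains r where "r \<in> {s<..<t}" "u t - u s = (t - s) * u' r"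
proof -
  have "\<exists>D z. s < z \<and> z < t \<and> (u has_real_derivative D) (at z) \<and> u t - u s = (t - s) * D"
    by (rule MVT) (use assms in \<open>auto simp: real_differentiable_def\<close>)
  then obtain D z where "z \<in> {s<..<t}" "(u has_real_derivative D) (at z)" "u t - u s = (t - s) * D" by auto
  then show ?thesis using that DERIV_unique assms(3) by metis
qed

lemma Lipschitz_if_bounded_derivative:
  fixes u :: "real \<Rightarrow> real"
  assumes "continuous_on {l..h} u" "\<And>r. r \<in> {l<..<h} \<Longrightarrow> (u has_real_derivative u' r) (at r)"
    and "\<And>r. r \<in> {l<..<h} \<Longrightarrow> \<bar>u' r\<bar> \<le> M" and "s \<in> {l..h}" "t \<in> {l..h}"
  shows "\<bar>u s - u t\<bar> \<le> M * \<bar>s - t\<bar>"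
proof -
  have *: "\<bar>u t - u s\<bar> \<le> M * \<bar>t - s\<bar>" if st: "s < t" "s \<in> {l..h}" "t \<in> {l..h}" for s t
  proof -
    have "continuous_on {s..t} u" by (rule continuous_on_subset[OF assms(1)]) (use st in auto)
    then obtain r where "r \<in> {s<..<t}" "u t - u s = (t - s) * u' r"
      by (rule MVT_interior[OF st(1), of u u']) (use assms(2) st in auto)
    then show ?thesis using assms(3)[of r] st by (simp add: abs_mult mult_right_mono mult.commute)
  qed
  consider "s = t" | "s < t" | "t < s" by linarith
  then show ?thesis
  proof cases
    case 2
    from *[OF this assms(4,5)] show ?thesis by (subst (1 2) abs_minus_commute)
  qed (use *[of t s] assms in auto)
qed

text \<open>
  Differential equations pass to pointwise limits if the derivatives are bounded: by dominated convergence
  the integrated equations converge.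
\<close>

lemma DERIV_limit:
  fixes u g :: "nat \<Rightarrow> real \<Rightarrow> real"
  assumes D: "\<And>n r. r \<in> {l<..<h} \<Longrightarrow> (u n has_real_derivative g n r) (at r)"
    and M: "\<And>n r. r \<in> {l<..<h} \<Longrightarrow> \<bar>g n r\<bar> \<le> M"
    and U: "\<And>r. r \<in> {l<..<h} \<Longrightarrow> (\<lambda>n. u n r) \<longlonglongrightarrow> U r"
    and G: "\<And>r. r \<in> {l<..<h} \<Longrightarrow> (\<lambda>n. g n r) \<longlonglongrightarrow> G r"
    and cont: "continuous_on {l<..<h} G" and r: "r \<in> {l<..<h}"
  shows "(U has_real_derivative G r) (at r)"
proof -
  define p q where "p = (l + r) / 2" and "q = (r + h) / 2"
  have pq: "l < p" "p < r" "r < q" "q < h" using r by (auto simp: p_def q_def)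
  have "U p + integral {p..x} G = U x" if x: "x \<in> {p..q}" for x
  proof -
    have "(G has_integral (U x - U p)) {p..x}"
    proof (rule has_integral_dominated_convergence)
      show "(g n has_integral u n x - u n p) {p..x}" for n
        by (rule fundamental_theorem_of_calculus)
          (use x pq in \<open>auto intro!: has_field_derivative_at_within D
             simp: has_real_derivative_iff_has_vector_derivative[symmetric]\<close>)
      show "(\<lambda>n. u n x - u n p) \<longlonglongrightarrow> U x - U p"
        by (intro tendsto_intros U) (use x pq in auto)
      show "\<forall>t\<in>{p..x}. norm (g n t) \<le> M" for n using M x pq by auto
      show "\<forall>t\<in>{p..x}. (\<lambda>n. g n t) \<longlonglongrightarrow> G t" using G x pq by auto
    qed auto
    then show ?thesis by (simp add: integral_unique)
  qed
  moreover have "((\<lambda>x. U p + integral {p..x} G) has_real_derivative 0 + G r) (at r within {p..q})"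
    by (intro DERIV_add DERIV_const integral_has_real_derivative continuous_on_subset[OF cont]) (use pq in auto)
  ultimately have "(U has_real_derivative G r) (at r within {p..q})"
    using pq by (auto intro: has_field_derivative_transform_within[where d=1])
  moreover have "at r within {p..q} = at r" by (rule at_within_interior) (use pq in auto)
  ultimately show ?thesis by simp
qed

lemma Arzela_Ascoli_pair:
  fixes w y :: "nat \<Rightarrow> real \<Rightarrow> real"
  assumes Lw: "\<And>n s t. s \<in> {0..R} \<Longrightarrow> t \<in> {0..R} \<Longrightarrow> \<bar>w n s - w n t\<bar> \<le> M * \<bar>s - t\<bar>"
    and Ly: "\<And>n s t. s \<in> {0..R} \<Longrightarrow> t \<in> {0..R} \<Longrightarrow> \<bar>y n s - y n t\<bar> \<le> M * \<bar>s - t\<bar>"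
    and B0: "\<And>n. \<bar>w n 0\<bar> \<le> B" "\<And>n. \<bar>y n 0\<bar> \<le> B"
  obtains k W Y where "strict_mono (k :: nat \<Rightarrow> nat)" "continuous_on {0..R} W" "continuous_on {0..R} Y"
    "uniform_limit {0..R} (\<lambda>n. w (k n)) W sequentially" "uniform_limit {0..R} (\<lambda>n. y (k n)) Y sequentially"
proof -
  define F where "F = (\<lambda>n t. (w n t, y n t))"
  have L: "norm (F n s - F n t) \<le> 2 * \<bar>M\<bar> * \<bar>s - t\<bar>" if "s \<in> {0..R}" "t \<in> {0..R}" for n s t
  proof -
    have "norm (F n s - F n t) \<le> \<bar>w n s - w n t\<bar> + \<bar>y n s - y n t\<bar>"
      using norm_Pair_le[of "w n s - w n t" "y n s - y n t"] by (simp add: F_def)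
    also have "\<dots> \<le> \<bar>M\<bar> * \<bar>s - t\<bar> + \<bar>M\<bar> * \<bar>s - t\<bar>"
      using Lw[OF that, of n] Ly[OF that, of n] abs_ge_self[of M] mult_right_mono[of M "\<bar>M\<bar>" "\<bar>s - t\<bar>"] by simp
    finally show ?thesis by simp
  qed
  obtain G and k :: "nat \<Rightarrow> nat" where "continuous_on {0..R} G" "strict_mono k"
    and lim: "\<And>e. 0 < e \<Longrightarrow> \<exists>N. \<forall>n x. n \<ge> N \<and> x \<in> {0..R} \<longrightarrow> norm (F (k n) x - G x) < e"
  proof (rule Arzela_Ascoli[of "{0..R}" F "2 * B + 2 * \<bar>M\<bar> * R"])
    show "norm (F n t) \<le> 2 * B + 2 * \<bar>M\<bar> * R" if "t \<in> {0..R}" for n t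
    proof -
      have "norm (F n t) \<le> norm (F n 0) + norm (F n t - F n 0)"
        by (metis add.commute diff_add_cancel norm_triangle_ineq)
      also have "norm (F n 0) \<le> 2 * B"
        using norm_Pair_le[of "w n 0" "y n 0"] B0[of n] by (simp add: F_def)
      also have "norm (F n t - F n 0) \<le> 2 * \<bar>M\<bar> * R"
        using L[of t 0 n] that mult_left_mono[of t R "2 * \<bar>M\<bar>"] by auto
      finally show ?thesis by simp
    qed
    show "\<exists>d. 0 < d \<and> (\<forall>n y. y \<in> {0..R} \<and> norm (x - y) < d \<longrightarrow> norm (F n x - F n y) < e)"
      if "x \<in> {0..R}" "0 < e" for x e
    proof (intro exI[of _ "e / (2 * \<bar>M\<bar> + 1)"] conjI allI impI)
      show "0 < e / (2 * \<bar>M\<bar> + 1)" using \<open>e > 0\<close> by (auto intro!: divide_pos_pos)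
      fix n y assume y: "y \<in> {0..R} \<and> norm (x - y) < e / (2 * \<bar>M\<bar> + 1)"
      have "norm (F n x - F n y) \<le> (2 * \<bar>M\<bar>) * \<bar>x - y\<bar>" using L that y by simp
      also have "\<dots> \<le> (2 * \<bar>M\<bar> + 1) * \<bar>x - y\<bar>" by (intro mult_right_mono) auto
      also have "\<dots> < e" using y by (simp add: field_simps)
      finally show "norm (F n x - F n y) < e" .
    qed
  qed auto
  have UL: "uniform_limit {0..R} (\<lambda>n. F (k n)) G sequentially"
    unfolding uniform_limit_sequentially_iff dist_norm using lim by meson
  show ?thesis
  proof (rule that[of k "\<lambda>t. fst (G t)" "\<lambda>t. snd (G t)"])
    show "continuous_on {0..R} (\<lambda>t. fst (G t))" "continuous_on {0..R} (\<lambda>t. snd (G t))"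
      by (intro continuous_intros \<open>continuous_on {0..R} G\<close>)+
    show "uniform_limit {0..R} (\<lambda>n. w (k n)) (\<lambda>t. fst (G t)) sequentially"
      using bounded_linear.uniform_limit[OF bounded_linear_fst UL] by (simp add: F_def)
    show "uniform_limit {0..R} (\<lambda>n. y (k n)) (\<lambda>t. snd (G t)) sequentially"
      using bounded_linear.uniform_limit[OF bounded_linear_snd UL] by (simp add: F_def)
  qed fact
qed

text \<open>
  Tonelli's delayed equation \<open>x'(t) = f(t, x(t - \<delta>))\<close> with constant history. The Picard iteration for it
  becomes stationary on \<open>{..m * \<delta>}\<close> after \<open>m\<close> steps.
\<close>

lemma delayed_equation_solvable:
  fixes f :: "real \<Rightarrow> 'a::banach \<Rightarrow> 'a"
  assumes "\<delta> > 0" and f: "\<And>X. continuous_on {0..} X \<Longrightarrow> continuous_on {0..} (\<lambda>s. f s (X s))"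
  obtains X where "continuous_on UNIV X" "\<And>t. t \<le> 0 \<Longrightarrow> X t = x0"
    "\<And>t. t \<in> {0<..<R} \<Longrightarrow> (X has_vector_derivative f t (X (t - \<delta>))) (at t)"
proof -
  define T where "T = (\<lambda>X t. x0 + integral {0..max 0 t} (\<lambda>s. f s (X (s - \<delta>))))"
  define it where "it = (\<lambda>m. (T ^^ m) (\<lambda>t. x0))"
  have cf: "continuous_on {0..} (\<lambda>s. f s (X (s - \<delta>)))" if "continuous_on UNIV X" for X
    by (intro f continuous_on_compose2[OF that]) (auto intro!: continuous_intros)
  have cT: "continuous_on UNIV (T X)" if "continuous_on UNIV X" for X
  proof -
    have "continuous_on {0..h} (\<lambda>t. integral {0..t} (\<lambda>s. f s (X (s - \<delta>))))" for h
      by (intro indefinite_integral_continuous_1 integrable_continuous_real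
          continuous_on_subset[OF cf[OF that]]) auto
    then have c: "continuous_on {0..} (\<lambda>t. integral {0..t} (\<lambda>s. f s (X (s - \<delta>))))"
      by (rule continuous_on_Ici)
    show ?thesis unfolding T_def
      by (intro continuous_intros continuous_on_compose2[OF c]) auto
  qed
  have c: "continuous_on UNIV (it m)" for m
    unfolding it_def by (induction m) (auto intro: cT)
  have it_Suc: "it (Suc m) = T (it m)" for m by (simp add: it_def)
  have stat: "it (Suc m) t = it m t" if "t \<le> real m * \<delta>" for m t
    using that
  proof (induction m arbitrary: t)
    case 0
    then show ?case by (simp add: it_def T_def)
  next
    case (Suc m)
    have "it (Suc m) (s - \<delta>) = it m (s - \<delta>)" if "s \<in> {0..max 0 t}" for s
    proof (cases "t \<ge> 0")
      case True
      then have "s - \<delta> \<le> real m * \<delta>" using that Suc.prems by (simp add: algebra_simps)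
      then show ?thesis by (rule Suc.IH)
    next
      case False
      then have "s - \<delta> \<le> real m * \<delta>" using that \<open>\<delta> > 0\<close> by (auto intro: order_trans[of _ 0])
      then show ?thesis by (rule Suc.IH)
    qed
    then have "integral {0..max 0 t} (\<lambda>s. f s (it (Suc m) (s - \<delta>)))
        = integral {0..max 0 t} (\<lambda>s. f s (it m (s - \<delta>)))"
      by (intro Henstock_Kurzweil_Integration.integral_cong) simp
    then show ?case unfolding it_Suc[of "Suc m"] it_Suc[of m] by (simp add: T_def)
  qed
  obtain m :: nat where m: "R \<le> real m * \<delta>"
    using reals_Archimedean3[OF \<open>\<delta> > 0\<close>] by (meson less_imp_le)
  define X where "X = it m"
  have X: "X t = x0 + integral {0..max 0 t} (\<lambda>s. f s (X (s - \<delta>)))" if "t \<le> max 0 R" for t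
  proof -
    have "0 \<le> real m * \<delta>" using \<open>\<delta> > 0\<close> by simp
    then have "t \<le> real m * \<delta>" using that m by linarith
    from stat[OF this] show ?thesis by (simp add: it_Suc X_def T_def)
  qed
  show ?thesis
  proof (rule that[of X])
    show "continuous_on UNIV X" by (simp add: X_def c)
    then have cfX: "continuous_on {0..R} (\<lambda>s. f s (X (s - \<delta>)))"
      by (intro continuous_on_subset[OF cf]) auto
    show "X t = x0" if "t \<le> 0" for t using X[of t] that by (simp add: max_def)
    show "(X has_vector_derivative f t (X (t - \<delta>))) (at t)" if t: "t \<in> {0<..<R}" for t
    proof -
      have "((\<lambda>t. x0 + integral {0..t} (\<lambda>s. f s (X (s - \<delta>)))) has_vector_derivative 0 + f t (X (t - \<delta>)))
          (at t within {0..R})"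
        by (intro has_vector_derivative_add has_vector_derivative_const integral_has_vector_derivative[OF cfX])
          (use t in auto)
      then have "(X has_vector_derivative f t (X (t - \<delta>))) (at t within {0..R})"
        using t X by (auto intro: has_vector_derivative_transform_within[where d=1])
      moreover have "at t within {0..R} = at t" by (rule at_within_interior) (use t in auto)
      ultimately show ?thesis by simp
    qed
  qed
qed

text \<open>
  The derivative of \<open>u\<close> has to be controlled only where \<open>u > 0\<close>: the comparison with \<open>g\<close> starts at the last
  point where \<open>u \<le> 0\<close>.
\<close>

lemma upper_bound_where_positive:
  fixes u g :: "real \<Rightarrow> real"
  assumes cu: "continuous_on {0..R} u" and cg: "continuous_on {0..R} g" and "u 0 \<le> 0" "g 0 \<ge> 0"
    and Du: "\<And>r. r \<in> {0<..<R} \<Longrightarrow> (u has_real_derivative u' r) (at r)"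
    and Dg: "\<And>r. r \<in> {0<..<R} \<Longrightarrow> (g has_real_derivative g' r) (at r)"
    and "\<And>r. r \<in> {0<..<R} \<Longrightarrow> g' r \<ge> 0"
    and le: "\<And>r. r \<in> {0<..<R} \<Longrightarrow> u r > 0 \<Longrightarrow> u' r \<le> g' r"
    and r: "r \<in> {0..R}"
  shows "u r \<le> g r"
proof (rule ccontr)
  assume "\<not> u r \<le> g r"
  have g_pos: "g s \<ge> 0" if s: "s \<in> {0..R}" for s
  proof (cases "s = 0")
    case False
    then have "s > 0" using that by simp
    moreover have "continuous_on {0..s} g" by (rule continuous_on_subset[OF cg]) (use that in auto)
    ultimately obtain z where "z \<in> {0<..<s}" "g s - g 0 = (s - 0) * g' z"
      by (rule MVT_interior[of 0 s g g']) (use s in \<open>auto intro!: Dg\<close>)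
    moreover have "s * g' z \<ge> 0"
      using assms(7)[of z] that \<open>z \<in> {0<..<s}\<close> by (intro mult_nonneg_nonneg) auto
    ultimately show ?thesis using \<open>g 0 \<ge> 0\<close> by simp
  qed (use \<open>g 0 \<ge> 0\<close> in simp)
  have cu': "continuous_on {0..r} u" by (rule continuous_on_subset[OF cu]) (use r in auto)
  \<comment> \<open>The last point \<open>s\<close> before \<open>r\<close> where \<open>u \<le> 0\<close>.\<close>
  define S where "S = {0..r} \<inter> u -` {..0}"
  have "closed S" unfolding S_def by (intro continuous_closed_preimage cu') auto
  moreover have "bounded S" unfolding S_def by (rule bounded_subset[OF bounded_closed_interval]) auto
  ultimately have "compact S" by (simp add: compact_eq_bounded_closed)
  moreover have "0 \<in> S" using \<open>u 0 \<le> 0\<close> r by (auto simp: S_def)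
  ultimately obtain s where s: "s \<in> S" "\<And>t. t \<in> S \<Longrightarrow> t \<le> s"
    using compact_attains_sup[of S] by auto
  have "s \<noteq> r" using s(1) \<open>\<not> u r \<le> g r\<close> g_pos[OF r] by (auto simp: S_def)
  then have sr: "s < r" "0 \<le> s" using s(1) by (auto simp: S_def)
  have pos: "u t > 0" if "t \<in> {s<..<r}" for t
    using s(2)[of t] that sr by (force simp: S_def)
  have "continuous_on {s..r} (\<lambda>t. u t - g t)"
    by (intro continuous_intros continuous_on_subset[OF cu] continuous_on_subset[OF cg]) (use sr r in auto)
  then obtain z where z: "z \<in> {s<..<r}" "(u r - g r) - (u s - g s) = (r - s) * (u' z - g' z)"
    by (rule MVT_interior[OF sr(1), of "\<lambda>t. u t - g t" "\<lambda>t. u' t - g' t"])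
      (use Du Dg sr r in \<open>auto intro!: DERIV_diff\<close>)
  have "(r - s) * (u' z - g' z) \<le> 0"
    using le[of z] pos[of z] z(1) sr r by (intro mult_nonneg_nonpos) auto
  then show False using z(2) s(1) g_pos[of s] sr r \<open>\<not> u r \<le> g r\<close> by (auto simp: S_def)
qed

definition clip :: "real \<Rightarrow> real \<Rightarrow> real" where
  "clip k x = max (- k) (min k x)"

lemma abs_clip_le: "k \<ge> 0 \<Longrightarrow> \<bar>clip k x\<bar> \<le> k"
  by (auto simp: clip_def)

lemma clip_eq: "\<bar>x\<bar> \<le> k \<Longrightarrow> clip k x = x"
  by (auto simp: clip_def)

lemma clip_minus: "clip k (- x) = - clip k x" if "k \<ge> 0"
  using that by (auto simp: clip_def)

lemma clip_nonneg: "k \<ge> 0 \<Longrightarrow> x \<ge> 0 \<Longrightarrow> clip k x \<ge> 0"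
  by (auto simp: clip_def)

lemma tendsto_clip [tendsto_intros]: "(f \<longlongrightarrow> x) F \<Longrightarrow> ((\<lambda>t. clip k (f t)) \<longlongrightarrow> clip k x) F"
  unfolding clip_def by (intro tendsto_intros)

lemma continuous_on_clip [continuous_intros]:
  "continuous_on S k \<Longrightarrow> continuous_on S f \<Longrightarrow> continuous_on S (\<lambda>t. clip (k t) (f t))"
  unfolding clip_def by (intro continuous_intros)

text \<open>
  Existence is shown for a system with bounded right-hand side, in which \<open>w\<close> is clipped at
  \<open>2 * exp (L * r)\<close> and \<open>y / r\<close> at a constant. It is solved by compactness from delayed equations in
  which \<open>1 / r\<close> is replaced by \<open>1 / (r + e)\<close>. As the singular term opposes the growth of \<open>y\<close>, the
  derivative of \<open>\<bar>y\<bar>\<close> is at most \<open>\<beta> * L * (2 * exp (L * r))\<^sup>\<beta>\<close>. Integrating twice shows that the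
  solution stays below the clipping levels.
\<close>

lemma radial_system_exists:
  assumes "\<beta> > 0" "b > 0" "c > 0" "d \<ge> 0" "R > 0" and L: "L \<ge> 4" "1 \<le> L * b" "1 \<le> L * c"
  obtains w y where "radial_system d \<beta> b c 0 R w y" "w 0 = 1" "y 0 = 0"
    "\<And>r. r \<in> {0..R} \<Longrightarrow> \<bar>w r\<bar> \<le> 2 * exp (L * r)"
    "\<And>r. r \<in> {0..R} \<Longrightarrow> \<bar>y r\<bar> \<le> \<beta> * L * (2 * exp (L * R)) powr \<beta> * r"
proof -
  define K where "K = (\<lambda>r. 2 * exp (L * r))"
  define C where "C = \<beta> * L * K R powr \<beta>"
  have K_pos: "K r > 0" for r by (simp add: K_def)
  have K_mono: "K r \<le> K R" if "r \<le> R" for r using that L by (simp add: K_def)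
  have C_pos: "C > 0" using \<open>\<beta> > 0\<close> L K_pos[of R] by (simp add: C_def)
  \<comment> \<open>The right-hand sides of the clipped system; \<open>e\<close> regularizes the singularity and is also the delay.\<close>
  define P where "P = (\<lambda>z. spow (1/\<beta>) (clip (C * R) z))"
  define Q where "Q = (\<lambda>e r u z.
    \<beta> * pl (1/b) (1/c) (- spow \<beta> (clip (K r) u) - d * pl b c (clip C (z / (r + e)))))"
  define e where "e = (\<lambda>n. 1 / (real n + 1))"
  have e_pos: "e n > 0" for n by (simp add: e_def)
  have e_lim: "e \<longlonglongrightarrow> 0" unfolding e_def using LIMSEQ_inverse_real_of_nat by (simp add: inverse_eq_divide add.commute)
  define MP where "MP = (C * R) powr (1/\<beta>)"
  define MQ where "MQ = \<beta> * (L * (K R powr \<beta> + d * ((b + c) * C)))"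
  have inv: "1/b \<le> L" "1/c \<le> L" "0 \<le> 1/b" "0 \<le> 1/c" using assms by (auto simp: field_simps)
  have P_le: "\<bar>P z\<bar> \<le> MP" for z
    unfolding P_def MP_def abs_spow
    using abs_clip_le[of "C * R" z] C_pos \<open>R > 0\<close> \<open>\<beta> > 0\<close> by (intro powr_mono2) auto
  have clip_powr: "\<bar>spow \<beta> (clip (K r) u)\<bar> \<le> K r powr \<beta>" for r u
    unfolding abs_spow using abs_clip_le[of "K r" u] K_pos[of r] \<open>\<beta> > 0\<close> by (intro powr_mono2) auto
  have Q_le: "\<bar>Q \<epsilon> r u z\<bar> \<le> MQ" if "r \<le> R" for \<epsilon> r u z
  proof -
    let ?p = "pl b c (clip C (z / (r + \<epsilon>)))"
    have "\<bar>?p\<bar> \<le> (b + c) * \<bar>clip C (z / (r + \<epsilon>))\<bar>" using assms by (intro abs_pl_le) auto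
    also have "\<dots> \<le> (b + c) * C" using assms C_pos by (intro mult_left_mono abs_clip_le) auto
    finally have "\<bar>d * ?p\<bar> \<le> d * ((b + c) * C)" using \<open>d \<ge> 0\<close> by (simp add: abs_mult mult_left_mono)
    moreover have "\<bar>spow \<beta> (clip (K r) u)\<bar> \<le> K R powr \<beta>"
      using clip_powr[of r u] powr_mono2[OF _ _ K_mono[OF that], of \<beta>] K_pos[of r] \<open>\<beta> > 0\<close> by simp
    ultimately have "\<bar>- spow \<beta> (clip (K r) u) - d * ?p\<bar> \<le> K R powr \<beta> + d * ((b + c) * C)" by linarith
    moreover have "\<bar>pl (1/b) (1/c) t\<bar> \<le> L * \<bar>t\<bar>" for t using inv by (intro abs_pl_le) auto
    ultimately have "\<bar>pl (1/b) (1/c) (- spow \<beta> (clip (K r) u) - d * ?p)\<bar> \<le> L * (K R powr \<beta> + d * ((b + c) * C))"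
      using L by (meson mult_left_mono order_trans zero_le_numeral)
    then show ?thesis using \<open>\<beta> > 0\<close> by (simp add: Q_def MQ_def abs_mult)
  qed
  have nonneg: "MP \<ge> 0" "MQ \<ge> 0"
    using Q_le[of R 1 1 1] by (auto simp: MP_def)
  have "\<exists>X. continuous_on UNIV X \<and> (\<forall>t\<le>0. X t = (1, 0)) \<and> (\<forall>t\<in>{0<..<R}.
      (X has_vector_derivative (P (snd (X (t - e n))), Q (e n) t (fst (X (t - e n))) (snd (X (t - e n))))) (at t))" for n
  proof (rule delayed_equation_solvable[of "e n" "\<lambda>t x. (P (snd x), Q (e n) t (fst x) (snd x))" "(1,0)" R])
    show "continuous_on {0..} (\<lambda>s. (P (snd (X s)), Q (e n) s (fst (X s)) (snd (X s))))"
      if "continuous_on {0..} X" for X :: "real \<Rightarrow> real \<times> real"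
      unfolding P_def Q_def K_def using \<open>\<beta> > 0\<close> e_pos[of n] that
      by (intro continuous_intros) auto
  qed (use e_pos in auto)
  then obtain X where cX: "\<And>n. continuous_on UNIV (X n)" and X0: "\<And>n t. t \<le> 0 \<Longrightarrow> X n t = (1, 0)"
    and DX: "\<And>n t. t \<in> {0<..<R} \<Longrightarrow> (X n has_vector_derivative
        (P (snd (X n (t - e n))), Q (e n) t (fst (X n (t - e n))) (snd (X n (t - e n))))) (at t)"
    by metis
  define w where "w = (\<lambda>n t. fst (X n t))"
  define y where "y = (\<lambda>n t. snd (X n t))"
  have cw: "continuous_on S (w n)" and cy: "continuous_on S (y n)" for n S
    unfolding w_def y_def by (intro continuous_intros continuous_on_subset[OF cX]; simp)+
  have Dw: "(w n has_real_derivative P (y n (t - e n))) (at t)"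
    and Dy: "(y n has_real_derivative Q (e n) t (w n (t - e n)) (y n (t - e n))) (at t)"
    if "t \<in> {0<..<R}" for n t
    using bounded_linear.has_vector_derivative[OF bounded_linear_fst DX[OF that, of n]]
      bounded_linear.has_vector_derivative[OF bounded_linear_snd DX[OF that, of n]]
    by (simp_all add: w_def y_def has_real_derivative_iff_has_vector_derivative)
  define M where "M = MP + MQ"
  have P_M: "\<bar>P z\<bar> \<le> M" for z using P_le[of z] nonneg by (simp add: M_def)
  have Q_M: "\<bar>Q \<epsilon> r u z\<bar> \<le> M" if "r \<in> {0<..<R}" for \<epsilon> r u z
    using Q_le[of r \<epsilon> u z] nonneg that by (simp add: M_def)
  have Lw: "\<bar>w n s - w n t\<bar> \<le> M * \<bar>s - t\<bar>" if "s \<in> {0..R}" "t \<in> {0..R}" for n s t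
    by (rule Lipschitz_if_bounded_derivative[OF cw Dw P_M that])
  have Ly: "\<bar>y n s - y n t\<bar> \<le> M * \<bar>s - t\<bar>" if "s \<in> {0..R}" "t \<in> {0..R}" for n s t
    by (rule Lipschitz_if_bounded_derivative[OF cy Dy Q_M that])
  obtain k W Y where k: "strict_mono k" and cW: "continuous_on {0..R} W" and cY: "continuous_on {0..R} Y"
    and lim: "uniform_limit {0..R} (\<lambda>n. w (k n)) W sequentially"
      "uniform_limit {0..R} (\<lambda>n. y (k n)) Y sequentially"
    by (rule Arzela_Ascoli_pair[of R w M y 1]) (use Lw Ly in \<open>auto simp: w_def y_def X0\<close>)
  have limW: "(\<lambda>n. w (k n) t) \<longlonglongrightarrow> W t" and limY: "(\<lambda>n. y (k n) t) \<longlonglongrightarrow> Y t" if "t \<in> {0..R}" for t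
    using tendsto_uniform_limitI[OF lim(1) that] tendsto_uniform_limitI[OF lim(2) that] by auto
  have W0: "W 0 = 1" and Y0: "Y 0 = 0"
    using limW[of 0] limY[of 0] \<open>R > 0\<close> by (auto simp: w_def y_def X0 LIMSEQ_const_iff)
  have ek: "(\<lambda>n. e (k n)) \<longlonglongrightarrow> 0" using LIMSEQ_subseq_LIMSEQ[OF e_lim k] by (simp add: o_def)
  have delay: "(\<lambda>n. u (k n) (t - e (k n))) \<longlonglongrightarrow> U t"
    if t: "t \<in> {0<..<R}" and U: "(\<lambda>n. u (k n) t) \<longlonglongrightarrow> U t"
      and Lu: "\<And>n s t. s \<in> {0..R} \<Longrightarrow> t \<in> {0..R} \<Longrightarrow> \<bar>u n s - u n t\<bar> \<le> M * \<bar>s - t\<bar>"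
    for t U and u :: "nat \<Rightarrow> real \<Rightarrow> real"
  proof -
    have "(\<lambda>n. u (k n) (t - e (k n)) - u (k n) t) \<longlonglongrightarrow> 0"
    proof (rule Lim_null_comparison)
      have "\<forall>\<^sub>F n in sequentially. e (k n) < t" using ek t by (intro order_tendstoD(2)) auto
      then show "\<forall>\<^sub>F n in sequentially. norm (u (k n) (t - e (k n)) - u (k n) t) \<le> M * e (k n)"
      proof eventually_elim
        case (elim n)
        then show ?case using Lu[of "t - e (k n)" t "k n"] t e_pos[of "k n"] by simp
      qed
      show "(\<lambda>n. M * e (k n)) \<longlonglongrightarrow> 0" using tendsto_mult_right_zero[OF ek] by simp
    qed
    from tendsto_add[OF this U] show ?thesis by simp
  qed
  have delayW: "(\<lambda>n. w (k n) (t - e (k n))) \<longlonglongrightarrow> W t" and delayY: "(\<lambda>n. y (k n) (t - e (k n))) \<longlonglongrightarrow> Y t"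
    if "t \<in> {0<..<R}" for t
    using delay[where u=w and U=W, OF that limW Lw] delay[where u=y and U=Y, OF that limY Ly] that by auto
  have DW: "(W has_real_derivative P (Y r)) (at r)" if "r \<in> {0<..<R}" for r
  proof (rule DERIV_limit[of 0 R "\<lambda>n. w (k n)" "\<lambda>n t. P (y (k n) (t - e (k n)))" MP])
    show "(\<lambda>n. P (y (k n) (t - e (k n)))) \<longlonglongrightarrow> P (Y t)" if "t \<in> {0<..<R}" for t
      unfolding P_def using \<open>\<beta> > 0\<close> by (intro tendsto_spow tendsto_intros delayY that) auto
    show "continuous_on {0<..<R} (\<lambda>t. P (Y t))"
      unfolding P_def using \<open>\<beta> > 0\<close> by (intro continuous_intros continuous_on_subset[OF cY]) auto
  qed (use Dw P_le limW that in auto)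
  have DY: "(Y has_real_derivative Q 0 r (W r) (Y r)) (at r)" if "r \<in> {0<..<R}" for r
  proof (rule DERIV_limit[of 0 R "\<lambda>n. y (k n)"
        "\<lambda>n t. Q (e (k n)) t (w (k n) (t - e (k n))) (y (k n) (t - e (k n)))" MQ])
    show "(\<lambda>n. Q (e (k n)) t (w (k n) (t - e (k n))) (y (k n) (t - e (k n)))) \<longlonglongrightarrow> Q 0 t (W t) (Y t)"
      if "t \<in> {0<..<R}" for t
      unfolding Q_def using \<open>\<beta> > 0\<close> that
      by (intro tendsto_spow tendsto_intros delayY[OF that] delayW[OF that] ek) auto
    show "continuous_on {0<..<R} (\<lambda>t. Q 0 t (W t) (Y t))"
      unfolding Q_def K_def using \<open>\<beta> > 0\<close>
      by (intro continuous_intros continuous_on_subset[OF cY] continuous_on_subset[OF cW]) auto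
  qed (use Dy Q_le limY that in auto)
  \<comment> \<open>The sign of the singular term is opposite to the sign of \<open>z\<close>, so it may be dropped in these bounds.\<close>
  have Q_pos: "Q 0 r u z \<le> \<beta> * L * K r powr \<beta>" if "z > 0" "r > 0" for r u z
  proof -
    have "pl b c (clip C (z / (r + 0))) \<ge> 0"
      using pl_mono[of b c 0 "clip C (z / (r + 0))"] clip_nonneg[of C "z / (r + 0)"] that C_pos assms by simp
    then have "- spow \<beta> (clip (K r) u) - d * pl b c (clip C (z / (r + 0))) \<le> K r powr \<beta>"
      using clip_powr[of r u] mult_nonneg_nonneg[OF \<open>d \<ge> 0\<close>] by (smt (verit))
    then have "pl (1/b) (1/c) (- spow \<beta> (clip (K r) u) - d * pl b c (clip C (z / (r + 0)))) \<le> pl (1/b) (1/c) (K r powr \<beta>)"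
      using inv by (intro pl_mono) auto
    also have "\<dots> \<le> L * K r powr \<beta>" using abs_pl_le[OF inv(3,1,4,2), of "K r powr \<beta>"] by simp
    finally show ?thesis using \<open>\<beta> > 0\<close> by (simp add: Q_def mult.assoc)
  qed
  have Q_neg: "- Q 0 r u z \<le> \<beta> * L * K r powr \<beta>" if "- z > 0" "r > 0" for r u z
  proof -
    have "z / (r + 0) \<le> 0" using that by (simp add: divide_nonpos_pos)
    then have "pl b c (clip C (z / (r + 0))) \<le> 0"
      using pl_mono[of b c "clip C (z / (r + 0))" 0] clip_nonneg[of C "- z / (r + 0)"]
        clip_minus[of C "z / (r + 0)"] that C_pos assms by simp
    then have "- spow \<beta> (clip (K r) u) - d * pl b c (clip C (z / (r + 0))) \<ge> - (K r powr \<beta>)"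
      using clip_powr[of r u] mult_nonneg_nonpos[OF \<open>d \<ge> 0\<close>] by (smt (verit))
    then have "pl (1/b) (1/c) (- (K r powr \<beta>)) \<le> pl (1/b) (1/c) (- spow \<beta> (clip (K r) u) - d * pl b c (clip C (z / (r + 0))))"
      using inv by (intro pl_mono) auto
    moreover have "- pl (1/b) (1/c) (- (K r powr \<beta>)) \<le> L * K r powr \<beta>"
      using abs_pl_le[OF inv(3,1,4,2), of "- (K r powr \<beta>)"] by simp
    ultimately have "- pl (1/b) (1/c) (- spow \<beta> (clip (K r) u) - d * pl b c (clip C (z / (r + 0)))) \<le> L * K r powr \<beta>"
      by linarith
    from mult_left_mono[OF this, of \<beta>] show ?thesis using \<open>\<beta> > 0\<close> by (simp add: Q_def mult.assoc)
  qed
  have Y_bound: "\<bar>Y r\<bar> \<le> g r"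
    if cg: "continuous_on {0..R} g" and Dg: "\<And>r. r \<in> {0<..<R} \<Longrightarrow> (g has_real_derivative g' r) (at r)"
      and g': "\<And>r. r \<in> {0<..<R} \<Longrightarrow> \<beta> * L * K r powr \<beta> \<le> g' r" and "g 0 = 0" and r: "r \<in> {0..R}"
    for g g' r
  proof -
    have g'_pos: "g' r \<ge> 0" if "r \<in> {0<..<R}" for r
    proof -
      have "0 \<le> \<beta> * L * K r powr \<beta>" using \<open>\<beta> > 0\<close> L by simp
      then show ?thesis using g'[OF that] by linarith
    qed
    have "Y r \<le> g r"
      by (rule upper_bound_where_positive[OF cY cg _ _ DY Dg g'_pos _ r])
        (use Y0 \<open>g 0 = 0\<close> in \<open>auto intro!: order_trans[OF Q_pos g']\<close>)
    moreover have "- Y r \<le> g r"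
      by (rule upper_bound_where_positive[OF continuous_on_minus[OF cY] cg _ _ DERIV_minus[OF DY] Dg g'_pos _ r])
        (use Y0 \<open>g 0 = 0\<close> in \<open>auto intro!: order_trans[OF Q_neg g']\<close>)
    ultimately show ?thesis by simp
  qed
  \<comment> \<open>The clipping of \<open>y / r\<close> at \<open>C\<close> is inactive.\<close>
  have Y_C: "\<bar>Y r\<bar> \<le> C * r" if "r \<in> {0..R}" for r
  proof (rule Y_bound[of "\<lambda>r. C * r" "\<lambda>r. C"])
    show "\<beta> * L * K r powr \<beta> \<le> C" if "r \<in> {0<..<R}" for r
      using powr_mono2[OF _ _ K_mono[of r], of \<beta>] K_pos[of r] \<open>\<beta> > 0\<close> that L
      by (simp add: C_def mult_left_mono)
  qed (use that in \<open>auto intro!: continuous_intros derivative_eq_intros\<close>)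
  \<comment> \<open>The level \<open>K\<close> is chosen such that \<open>\<beta> * L * K r powr \<beta>\<close> is the derivative of \<open>K r powr \<beta>\<close>.\<close>
  have Y_K: "\<bar>Y r\<bar> \<le> K r powr \<beta>" if "r \<in> {0..R}" for r
  proof -
    have Kp: "K r powr \<beta> = 2 powr \<beta> * exp (L * \<beta> * r)" for r
      by (simp add: K_def powr_mult exp_powr_real mult_ac)
    have "\<bar>Y r\<bar> \<le> 2 powr \<beta> * exp (L * \<beta> * r) - 2 powr \<beta>"
      by (rule Y_bound[of _ "\<lambda>r. \<beta> * L * K r powr \<beta>"])
        (use that in \<open>auto intro!: continuous_intros derivative_eq_intros simp: Kp\<close>)
    moreover have "2 powr \<beta> > 0" by simp
    ultimately show ?thesis unfolding Kp by linarith
  qed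
  have P_Y: "P (Y r) = spow (1/\<beta>) (Y r)" if "r \<in> {0..R}" for r
  proof -
    have "C * r \<le> C * R" using that C_pos by simp
    then have "clip (C * R) (Y r) = Y r" using Y_C[OF that] by (intro clip_eq) auto
    then show ?thesis by (simp add: P_def)
  qed
  \<comment> \<open>Here \<open>L \<ge> 4\<close> leaves room for the initial value: \<open>\<bar>W r\<bar> \<le> 1 + K r / 4 \<le> K r\<close>.\<close>
  have W_K: "\<bar>W r\<bar> \<le> K r" if r: "r \<in> {0..R}" for r
  proof -
    have D_bound: "\<bar>P (Y s)\<bar> \<le> K s" if "s \<in> {0<..<R}" for s
    proof -
      have "\<bar>P (Y s)\<bar> = \<bar>Y s\<bar> powr (1/\<beta>)" using P_Y[of s] that by (simp add: abs_spow)
      also have "\<dots> \<le> (K s powr \<beta>) powr (1/\<beta>)" using Y_K[of s] that \<open>\<beta> > 0\<close> by (intro powr_mono2) auto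
      also have "\<dots> = K s" using \<open>\<beta> > 0\<close> K_pos[of s] by (simp add: powr_powr)
      finally show ?thesis .
    qed
    have cg: "continuous_on {0..R} (\<lambda>r. K r / L - K 0 / L)"
      unfolding K_def using L by (intro continuous_intros) auto
    have Dg: "((\<lambda>r. K r / L - K 0 / L) has_real_derivative K r) (at r)" for r
      unfolding K_def using L by (auto intro!: derivative_eq_intros)
    have "W r - 1 \<le> K r / L - K 0 / L"
      by (rule upper_bound_where_positive[OF _ cg _ _ DERIV_diff[OF DW DERIV_const] Dg _ _ r])
        (use W0 D_bound in \<open>auto intro!: continuous_intros cW less_imp_le[OF K_pos] simp: abs_le_iff\<close>)
    moreover have "- (W r - 1) \<le> K r / L - K 0 / L"
      by (rule upper_bound_where_positive[OF _ cg _ _ DERIV_minus[OF DERIV_diff[OF DW DERIV_const]] Dg _ _ r])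
        (use W0 D_bound in \<open>auto intro!: continuous_intros cW less_imp_le[OF K_pos] simp: abs_le_iff\<close>)
    moreover have "K r / L \<le> K r / 4" using L K_pos[of r] by (intro divide_left_mono) auto
    moreover have "K 0 / L > 0" using L K_pos[of 0] by simp
    moreover have "K r \<ge> 2" using L r by (simp add: K_def)
    ultimately show ?thesis by linarith
  qed
  have "Q 0 r (W r) (Y r) = radial_rhs d \<beta> b c r (W r) (Y r)" if "r \<in> {0<..<R}" for r
  proof -
    have "clip C (Y r / r) = Y r / r"
      using Y_C[of r] that by (intro clip_eq) (auto simp: field_simps)
    moreover have "clip (K r) (W r) = W r" using W_K[of r] that by (intro clip_eq) auto
    ultimately show ?thesis using that by (simp add: Q_def radial_rhs_def pl_divide)
  qed
  then have "radial_system d \<beta> b c 0 R W Y"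
    unfolding radial_system_def using cW cY DW DY P_Y by auto
  moreover have "\<bar>Y r\<bar> \<le> \<beta> * L * (2 * exp (L * R)) powr \<beta> * r" if "r \<in> {0..R}" for r
    using Y_C[OF that] by (simp add: C_def K_def)
  ultimately show ?thesis using W0 Y0 W_K by (intro that[of W Y]) (auto simp: K_def)
qed

section \<open>Uniqueness\<close>

text \<open>
  The function \<open>u\<^sup>2 exp (- 2 * K * r)\<close> is nonincreasing. Only an upper bound for \<open>u u'\<close> is needed, so terms
  that drive \<open>u\<close> back to \<open>0\<close> may be singular.
\<close>

lemma zero_if_one_sided_Lipschitz:
  fixes u :: "real \<Rightarrow> real"
  assumes cu: "continuous_on {l..h} u" and "u l = 0"
    and D: "\<And>r. r \<in> {l<..<h} \<Longrightarrow> (u has_real_derivative u' r) (at r)"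
    and le: "\<And>r. r \<in> {l<..<h} \<Longrightarrow> u r * u' r \<le> K * (u r)\<^sup>2"
    and r: "r \<in> {l..h}"
  shows "u r = 0"
proof (cases "r = l")
  case False
  then have "l < r" using r by simp
  have "continuous_on {l..r} (\<lambda>r. (u r)\<^sup>2 * exp (- 2 * K * r))"
    by (intro continuous_intros continuous_on_subset[OF cu]) (use r in auto)
  then obtain z where z: "z \<in> {l<..<r}"
    "(u r)\<^sup>2 * exp (- 2 * K * r) - (u l)\<^sup>2 * exp (- 2 * K * l)
      = (r - l) * (2 * exp (- 2 * K * z) * (u z * u' z - K * (u z)\<^sup>2))"
  proof (rule MVT_interior[OF \<open>l < r\<close>])
    show "((\<lambda>r. (u r)\<^sup>2 * exp (- 2 * K * r)) has_real_derivative
        2 * exp (- 2 * K * z) * (u z * u' z - K * (u z)\<^sup>2)) (at z)" if "z \<in> {l<..<r}" for z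
      using that r by (auto intro!: derivative_eq_intros D simp: algebra_simps power2_eq_square)
  qed
  have "(r - l) * (2 * exp (- 2 * K * z) * (u z * u' z - K * (u z)\<^sup>2)) \<le> 0"
    using le[of z] z(1) r by (intro mult_nonneg_nonpos) auto
  then have "(u r)\<^sup>2 * exp (- 2 * K * r) \<le> 0" using z(2) \<open>u l = 0\<close> by simp
  then show ?thesis by (simp add: mult_le_0_iff)
qed (use \<open>u l = 0\<close> in simp)

lemma powr_mult_le_add_powr:
  fixes x v :: real
  assumes "\<beta> > 0" "x \<ge> 0" "v \<ge> 0"
  shows "x powr \<beta> * v \<le> x powr (1 + \<beta>) + v powr (1 + \<beta>)"
proof -
  have *: "t powr \<beta> * t = t powr (1 + \<beta>)" if "t \<ge> 0" for t
    using that by (cases "t = 0") (auto simp: powr_add)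
  show ?thesis
  proof (cases "x \<le> v")
    case True
    then have "x powr \<beta> * v \<le> v powr \<beta> * v" using assms by (intro mult_right_mono powr_mono2) auto
    then show ?thesis using *[OF \<open>v \<ge> 0\<close>] by (smt (verit) powr_ge_zero)
  next
    case False
    then have "x powr \<beta> * v \<le> x powr \<beta> * x" by (intro mult_left_mono) auto
    then show ?thesis using *[OF \<open>x \<ge> 0\<close>] by (smt (verit) powr_ge_zero)
  qed
qed

lemma abs_radial_rhs_le:
  assumes "\<beta> > 0" "b > 0" "c > 0" "d \<ge> 0" "r > 0"
  shows "\<bar>radial_rhs d \<beta> b c r w y\<bar> \<le> \<beta> * (1/b + 1/c) * (\<bar>w\<bar> powr \<beta> + d / r * (b + c) * \<bar>y\<bar>)"
proof -
  have "\<bar>d / r * pl b c y\<bar> \<le> d / r * ((b + c) * \<bar>y\<bar>)"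
    using abs_pl_le[of b "b + c" c y] assms by (simp add: abs_mult divide_right_mono mult_left_mono)
  then have "\<bar>- spow \<beta> w - d / r * pl b c y\<bar> \<le> \<bar>w\<bar> powr \<beta> + d / r * (b + c) * \<bar>y\<bar>"
    using abs_spow[of \<beta> w] by (smt (verit) mult.assoc)
  moreover have "\<bar>pl (1/b) (1/c) t\<bar> \<le> (1/b + 1/c) * \<bar>t\<bar>" for t
    using assms by (intro abs_pl_le) auto
  moreover have "0 \<le> 1/b + 1/c" using assms by simp
  ultimately have "\<bar>pl (1/b) (1/c) (- spow \<beta> w - d / r * pl b c y)\<bar>
      \<le> (1/b + 1/c) * (\<bar>w\<bar> powr \<beta> + d / r * (b + c) * \<bar>y\<bar>)"
    by (meson mult_left_mono order_trans)
  then show ?thesis using \<open>\<beta> > 0\<close> by (simp add: radial_rhs_def abs_mult mult.assoc)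
qed

text \<open>
  A solution cannot run into the state \<open>w = y = 0\<close>, although the system is not Lipschitz there: by
  homogeneity the energy \<open>H = \<bar>w\<bar>\<^sup>1\<^sup>+\<^sup>\<beta> + \<bar>y\<bar>\<^sup>1\<^sup>+\<^sup>1\<^sup>/\<^sup>\<beta>\<close> satisfies \<open>\<bar>H'\<bar> \<le> C * H\<close>.
\<close>

lemma radial_system_stays_nonzero:
  assumes sys: "radial_system d \<beta> b c l h w y" and pos: "\<beta> > 0" "b > 0" "c > 0" "d \<ge> 0" "l > 0"
    and ne: "w l \<noteq> 0 \<or> y l \<noteq> 0" and r: "r \<in> {l..h}"
  shows "w r \<noteq> 0 \<or> y r \<noteq> 0"
proof (cases "r = l")
  case False
  then have "l < r" using r by simp
  define H where "H = (\<lambda>r. \<bar>w r\<bar> powr (1 + \<beta>) + \<bar>y r\<bar> powr (1 + 1/\<beta>))"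
  define H' where "H' = (\<lambda>r. (1 + \<beta>) * spow \<beta> (w r) * spow (1/\<beta>) (y r)
      + (1 + 1/\<beta>) * spow (1/\<beta>) (y r) * radial_rhs d \<beta> b c r (w r) (y r))"
  define C where "C = (1 + \<beta>) + (1 + 1/\<beta>) * (\<beta> * (1/b + 1/c) * (1 + d / l * (b + c)))"
  note sys = sys[unfolded radial_system_def]
  have DH: "(H has_real_derivative H' r) (at r)" if "r \<in> {l<..<h}" for r
  proof -
    have "((\<lambda>r. \<bar>w r\<bar> powr (1 + \<beta>)) has_real_derivative ((1 + \<beta>) * spow \<beta> (w r)) * spow (1/\<beta>) (y r)) (at r)"
      by (rule DERIV_chain2[OF DERIV_abs_powr]) (use sys that pos in auto)
    moreover have "((\<lambda>r. \<bar>y r\<bar> powr (1 + 1/\<beta>)) has_real_derivative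
        ((1 + 1/\<beta>) * spow (1/\<beta>) (y r)) * radial_rhs d \<beta> b c r (w r) (y r)) (at r)"
      by (rule DERIV_chain2[OF DERIV_abs_powr]) (use sys that pos in auto)
    ultimately show ?thesis unfolding H_def H'_def by (rule DERIV_add)
  qed
  have H'_le: "\<bar>H' r\<bar> \<le> C * H r" if r: "r \<in> {l<..<h}" for r
  proof -
    let ?S = "\<bar>w r\<bar> powr \<beta>" and ?T = "\<bar>y r\<bar> powr (1/\<beta>)"
    have "?T powr (1 + \<beta>) = \<bar>y r\<bar> powr (1 + 1/\<beta>)"
      using pos by (simp add: powr_powr field_simps)
    then have ST: "?S * ?T \<le> H r"
      using powr_mult_le_add_powr[of \<beta> "\<bar>w r\<bar>" ?T] pos by (simp add: H_def)
    have yT: "\<bar>y r\<bar> * ?T \<le> H r"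
      by (cases "y r = 0") (auto simp: H_def powr_add)
    have "\<bar>radial_rhs d \<beta> b c r (w r) (y r)\<bar> \<le> \<beta> * (1/b + 1/c) * (?S + d / r * (b + c) * \<bar>y r\<bar>)"
      by (rule abs_radial_rhs_le) (use pos r in auto)
    also have "\<dots> \<le> \<beta> * (1/b + 1/c) * (?S + d / l * (b + c) * \<bar>y r\<bar>)"
      using pos r by (intro mult_left_mono add_mono mult_right_mono divide_left_mono) auto
    finally have "?T * \<bar>radial_rhs d \<beta> b c r (w r) (y r)\<bar>
        \<le> ?T * (\<beta> * (1/b + 1/c) * (?S + d / l * (b + c) * \<bar>y r\<bar>))"
      by (intro mult_left_mono) auto
    also have "\<dots> = \<beta> * (1/b + 1/c) * (?S * ?T + d / l * (b + c) * (\<bar>y r\<bar> * ?T))"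
      by (simp only: distrib_left distrib_right mult_ac)
    also have "\<dots> \<le> \<beta> * (1/b + 1/c) * (H r + d / l * (b + c) * H r)"
      using pos ST yT by (intro mult_left_mono add_mono) auto
    also have "\<dots> = (\<beta> * (1/b + 1/c) * (1 + d / l * (b + c))) * H r"
      by (simp only: distrib_left distrib_right mult_ac mult_1_left mult_1_right)
    finally have T: "(1 + 1/\<beta>) * (?T * \<bar>radial_rhs d \<beta> b c r (w r) (y r)\<bar>)
        \<le> (1 + 1/\<beta>) * ((\<beta> * (1/b + 1/c) * (1 + d / l * (b + c))) * H r)"
      using pos by (intro mult_left_mono) auto
    have "\<bar>H' r\<bar> \<le> \<bar>(1 + \<beta>) * spow \<beta> (w r) * spow (1/\<beta>) (y r)\<bar>
        + \<bar>(1 + 1/\<beta>) * spow (1/\<beta>) (y r) * radial_rhs d \<beta> b c r (w r) (y r)\<bar>"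
      unfolding H'_def by (rule abs_triangle_ineq)
    also have "\<dots> = (1 + \<beta>) * (?S * ?T) + (1 + 1/\<beta>) * (?T * \<bar>radial_rhs d \<beta> b c r (w r) (y r)\<bar>)"
      using pos by (simp add: abs_mult abs_spow)
    also have "\<dots> \<le> (1 + \<beta>) * H r + (1 + 1/\<beta>) * ((\<beta> * (1/b + 1/c) * (1 + d / l * (b + c))) * H r)"
      using pos ST by (intro add_mono T mult_left_mono) auto
    also have "\<dots> = C * H r" unfolding C_def by (simp only: distrib_right mult.assoc)
    finally show ?thesis .
  qed
  have cH: "continuous_on {l..r} (\<lambda>r. H r * exp (C * r))"
  proof -
    have "continuous_on {l..h} (\<lambda>r. w r * spow \<beta> (w r) + y r * spow (1/\<beta>) (y r))"
      using sys pos by (intro continuous_intros) auto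
    then have "continuous_on {l..h} H" unfolding H_def mult_spow by simp
    then show ?thesis using r by (intro continuous_intros) (auto intro: continuous_on_subset)
  qed
  obtain z where z: "z \<in> {l<..<r}"
    "H r * exp (C * r) - H l * exp (C * l) = (r - l) * ((H' z + C * H z) * exp (C * z))"
  proof (rule MVT_interior[OF \<open>l < r\<close> cH])
    show "((\<lambda>r. H r * exp (C * r)) has_real_derivative (H' z + C * H z) * exp (C * z)) (at z)"
      if "z \<in> {l<..<r}" for z
      using that r by (auto intro!: derivative_eq_intros DH simp: algebra_simps)
  qed
  have "(r - l) * ((H' z + C * H z) * exp (C * z)) \<ge> 0"
    using H'_le[of z] z(1) r by (intro mult_nonneg_nonneg) auto
  moreover have "H l > 0"
  proof -
    have "\<bar>w l\<bar> powr (1 + \<beta>) > 0 \<or> \<bar>y l\<bar> powr (1 + 1/\<beta>) > 0" using ne by auto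
    then show ?thesis unfolding H_def by (auto intro: add_pos_nonneg add_nonneg_pos)
  qed
  then have "H l * exp (C * l) > 0" by simp
  ultimately have "H r * exp (C * r) > 0" using z(2) by linarith
  then have "H r > 0" by (simp add: zero_less_mult_iff)
  then show ?thesis using pos by (auto simp: H_def)
qed (use ne in simp)

lemma positive_on_right_neighbourhood:
  fixes f :: "real \<Rightarrow> real"
  assumes "continuous_on {l..h} f" "s \<in> {l..<h}" "f s > 0"
  obtains t where "s < t" "t \<le> h" "\<And>x. x \<in> {s..t} \<Longrightarrow> f x > 0"
proof -
  have "(f \<longlongrightarrow> f s) (at s within {l..h})"
    using assms by (auto simp: continuous_on_def)
  then have "\<forall>\<^sub>F x in at s within {l..h}. f x > 0" using assms(3) by (rule order_tendstoD)
  then obtain e where e: "e > 0" "\<And>x. x \<in> {l..h} \<Longrightarrow> x \<noteq> s \<Longrightarrow> dist x s < e \<Longrightarrow> f x > 0"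
    unfolding eventually_at by auto
  show ?thesis
  proof (rule that[of "min h (s + e/2)"])
    show "f x > 0" if "x \<in> {s..min h (s + e/2)}" for x
      using e(2)[of x] that assms e(1) by (cases "x = s") (auto simp: dist_real_def)
  qed (use assms e in auto)
qed

lemma radial_system_nonzero:
  assumes sys: "radial_system d \<beta> b c 0 h w y" and pos: "\<beta> > 0" "b > 0" "c > 0" "d \<ge> 0"
    and "w 0 \<noteq> 0" and r: "r \<in> {0..h}"
  shows "w r \<noteq> 0 \<or> y r \<noteq> 0"
proof (cases "r = 0")
  case False
  then have "0 < r" using r by simp
  have "continuous_on {0..r} (\<lambda>x. \<bar>w x\<bar>)"
    using sys r by (auto simp: radial_system_def intro!: continuous_intros intro: continuous_on_subset)
  then obtain t where t: "0 < t" "t \<le> r" "\<And>x. x \<in> {0..t} \<Longrightarrow> \<bar>w x\<bar> > 0"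
    by (rule positive_on_right_neighbourhood[where s=0]) (use \<open>0 < r\<close> \<open>w 0 \<noteq> 0\<close> in auto)
  show ?thesis
    by (rule radial_system_stays_nonzero[OF radial_system_subset[OF sys, of t h] pos \<open>0 < t\<close>])
      (use t(3)[of t] t r in auto)
qed (use \<open>w 0 \<noteq> 0\<close> in simp)

text \<open>
  Where \<open>w > 0\<close>, the quotient \<open>z = y / w\<^sup>\<beta>\<close> satisfies a Riccati equation. Its singular term is
  decreasing in \<open>z\<close>, which gives uniqueness from \<open>r = 0\<close> on.
\<close>

definition Riccati_rhs :: "real \<Rightarrow> real \<Rightarrow> real \<Rightarrow> real \<Rightarrow> real \<Rightarrow> real \<Rightarrow> real" where
  "Riccati_rhs d \<beta> b c r z = \<beta> * (pl (1/b) (1/c) (- 1 - d / r * pl b c z) - \<bar>z\<bar> powr (1 + 1/\<beta>))"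

lemma DERIV_Riccati:
  assumes "\<beta> > 0" "w r > 0"
    and Dw: "(w has_real_derivative spow (1/\<beta>) (y r)) (at r)"
    and Dy: "(y has_real_derivative radial_rhs d \<beta> b c r (w r) (y r)) (at r)"
  shows "((\<lambda>r. y r / spow \<beta> (w r)) has_real_derivative Riccati_rhs d \<beta> b c r (y r / spow \<beta> (w r))) (at r)"
proof -
  define s where "s = spow \<beta> (w r)"
  have "s > 0" using \<open>w r > 0\<close> by (simp add: s_def)
  have Ds: "((\<lambda>r. spow \<beta> (w r)) has_real_derivative (\<beta> * \<bar>w r\<bar> powr (\<beta> - 1)) * spow (1/\<beta>) (y r)) (at r)"
    by (rule DERIV_chain2[OF DERIV_spow Dw]) (use \<open>w r > 0\<close> in simp)
  have s': "\<bar>w r\<bar> powr (\<beta> - 1) = s / w r"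
    using \<open>w r > 0\<close> by (simp add: s_def spow_of_pos powr_diff)
  have "((\<lambda>r. y r / spow \<beta> (w r)) has_real_derivative
      (radial_rhs d \<beta> b c r (w r) (y r) * s - y r * (\<beta> * \<bar>w r\<bar> powr (\<beta> - 1) * spow (1/\<beta>) (y r))) / (s * s)) (at r)"
    using DERIV_divide[OF Dy Ds] \<open>s > 0\<close> by (simp add: s_def)
  moreover have "(radial_rhs d \<beta> b c r (w r) (y r) * s - y r * (\<beta> * \<bar>w r\<bar> powr (\<beta> - 1) * spow (1/\<beta>) (y r))) / (s * s)
      = radial_rhs d \<beta> b c r (w r) (y r) / s - \<beta> * ((y r / s) * (spow (1/\<beta>) (y r) / w r))"
    unfolding s' using \<open>s > 0\<close> \<open>w r > 0\<close> by (simp add: field_simps)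
  moreover have "radial_rhs d \<beta> b c r (w r) (y r) / s = \<beta> * pl (1/b) (1/c) (- 1 - d / r * pl b c (y r / s))"
  proof -
    have "(- s - d / r * pl b c (y r)) / s = - 1 - d / r * pl b c (y r / s)"
      using \<open>s > 0\<close> by (simp add: pl_divide diff_divide_distrib)
    then show ?thesis
      using pl_divide[of s "1/b" "1/c" "- s - d / r * pl b c (y r)"] \<open>s > 0\<close>
      by (simp add: radial_rhs_def flip: s_def)
  qed
  moreover have "spow (1/\<beta>) (y r) / w r = spow (1/\<beta>) (y r / s)"
    unfolding spow_divide s_def using \<open>\<beta> > 0\<close> by simp
  ultimately show ?thesis
    unfolding Riccati_rhs_def s_def[symmetric] by (simp add: mult_spow right_diff_distrib)
qed

text \<open>
  The constant does not depend on \<open>r\<close>: the part that contains \<open>d / r\<close> is nonincreasing in \<open>z\<close> and only helps.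
\<close>

lemma Riccati_rhs_one_sided_Lipschitz:
  assumes "\<beta> > 0" "b > 0" "c > 0" "d \<ge> 0" "r > 0" "\<bar>z1\<bar> \<le> K" "\<bar>z2\<bar> \<le> K"
  shows "(z1 - z2) * (Riccati_rhs d \<beta> b c r z1 - Riccati_rhs d \<beta> b c r z2)
    \<le> \<beta> * ((1 + 1/\<beta>) * K powr (1/\<beta>)) * (z1 - z2)\<^sup>2"
proof -
  let ?g = "\<lambda>z. pl (1/b) (1/c) (- 1 - d / r * pl b c z)"
  have anti: "?g t \<le> ?g s" if "s \<le> t" for s t
    using assms that by (intro pl_mono diff_mono mult_left_mono) auto
  have "(z1 - z2) * (?g z1 - ?g z2) \<le> 0"
    using anti[of z1 z2] anti[of z2 z1] by (cases "z1 \<le> z2") (auto simp: mult_le_0_iff)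
  moreover have "\<bar>(z1 - z2) * (\<bar>z1\<bar> powr (1 + 1/\<beta>) - \<bar>z2\<bar> powr (1 + 1/\<beta>))\<bar>
      \<le> \<bar>z1 - z2\<bar> * ((1 + 1/\<beta>) * K powr (1/\<beta>) * \<bar>z1 - z2\<bar>)"
    unfolding abs_mult using assms by (intro mult_left_mono abs_powr_Lipschitz) auto
  ultimately have "(z1 - z2) * (?g z1 - ?g z2) - (z1 - z2) * (\<bar>z1\<bar> powr (1 + 1/\<beta>) - \<bar>z2\<bar> powr (1 + 1/\<beta>))
      \<le> \<bar>z1 - z2\<bar> * ((1 + 1/\<beta>) * K powr (1/\<beta>) * \<bar>z1 - z2\<bar>)"
    by linarith
  also have "\<dots> = ((1 + 1/\<beta>) * K powr (1/\<beta>)) * (z1 - z2)\<^sup>2"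
    by (simp add: power2_eq_square mult_ac flip: abs_mult)
  finally have "\<beta> * ((z1 - z2) * (?g z1 - ?g z2) - (z1 - z2) * (\<bar>z1\<bar> powr (1 + 1/\<beta>) - \<bar>z2\<bar> powr (1 + 1/\<beta>)))
      \<le> \<beta> * (((1 + 1/\<beta>) * K powr (1/\<beta>)) * (z1 - z2)\<^sup>2)"
    using \<open>\<beta> > 0\<close> by (intro mult_left_mono) auto
  moreover have "(z1 - z2) * (Riccati_rhs d \<beta> b c r z1 - Riccati_rhs d \<beta> b c r z2)
      = \<beta> * ((z1 - z2) * (?g z1 - ?g z2) - (z1 - z2) * (\<bar>z1\<bar> powr (1 + 1/\<beta>) - \<bar>z2\<bar> powr (1 + 1/\<beta>)))"
    by (simp add: Riccati_rhs_def algebra_simps)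
  ultimately show ?thesis by (simp only: mult.assoc)
qed

lemma continuous_on_bounded_abs:
  fixes f :: "real \<Rightarrow> real"
  assumes "continuous_on {l..h} f"
  obtains K where "\<And>r. r \<in> {l..h} \<Longrightarrow> \<bar>f r\<bar> \<le> K"
proof -
  have "bounded (f ` {l..h})" by (intro compact_imp_bounded compact_continuous_image assms) auto
  then obtain K where "\<forall>r\<in>{l..h}. \<bar>f r\<bar> \<le> K" unfolding bounded_iff by auto
  then show ?thesis by (intro that[of K]) blast
qed

lemma radial_system_unique_where_w_pos:
  assumes sys1: "radial_system d \<beta> b c l h w1 y1" and sys2: "radial_system d \<beta> b c l h w2 y2"
    and pos: "\<beta> > 0" "b > 0" "c > 0" "d \<ge> 0" "l \<ge> 0"
    and w1: "\<And>r. r \<in> {l..h} \<Longrightarrow> w1 r > 0" and w2: "\<And>r. r \<in> {l..h} \<Longrightarrow> w2 r > 0"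
    and init: "w1 l = w2 l" "y1 l = y2 l" and r: "r \<in> {l..h}"
  shows "w1 r = w2 r \<and> y1 r = y2 r"
proof -
  note sys = sys1[unfolded radial_system_def] sys2[unfolded radial_system_def]
  define z1 where "z1 = (\<lambda>r. y1 r / spow \<beta> (w1 r))"
  define z2 where "z2 = (\<lambda>r. y2 r / spow \<beta> (w2 r))"
  have ne: "\<forall>r\<in>{l..h}. spow \<beta> (w1 r) \<noteq> 0" "\<forall>r\<in>{l..h}. spow \<beta> (w2 r) \<noteq> 0"
    unfolding spow_eq_0_iff using less_imp_neq[OF w1] less_imp_neq[OF w2] by metis+
  have cz1: "continuous_on {l..h} z1" and cz2: "continuous_on {l..h} z2"
    unfolding z1_def z2_def using sys pos ne by (auto intro!: continuous_intros)
  obtain K1 where K1: "\<And>r. r \<in> {l..h} \<Longrightarrow> \<bar>z1 r\<bar> \<le> K1" using continuous_on_bounded_abs[OF cz1] by blast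
  obtain K2 where K2: "\<And>r. r \<in> {l..h} \<Longrightarrow> \<bar>z2 r\<bar> \<le> K2" using continuous_on_bounded_abs[OF cz2] by blast
  define K where "K = max K1 K2"
  have K: "\<bar>z1 r\<bar> \<le> K" "\<bar>z2 r\<bar> \<le> K" if "r \<in> {l..h}" for r
    using K1[OF that] K2[OF that] by (auto simp: K_def)
  have D1: "(z1 has_real_derivative Riccati_rhs d \<beta> b c r (z1 r)) (at r)" if "r \<in> {l<..<h}" for r
    unfolding z1_def by (rule DERIV_Riccati) (use that sys w1 pos in auto)
  have D2: "(z2 has_real_derivative Riccati_rhs d \<beta> b c r (z2 r)) (at r)" if "r \<in> {l<..<h}" for r
    unfolding z2_def by (rule DERIV_Riccati) (use that sys w2 pos in auto)
  have z_eq: "z1 r - z2 r = 0" if "r \<in> {l..h}" for r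
  proof (rule zero_if_one_sided_Lipschitz[OF _ _ _ _ that])
    show "continuous_on {l..h} (\<lambda>r. z1 r - z2 r)" by (intro continuous_intros cz1 cz2)
    show "z1 l - z2 l = 0" using init by (simp add: z1_def z2_def)
    show "((\<lambda>r. z1 r - z2 r) has_real_derivative
        Riccati_rhs d \<beta> b c r (z1 r) - Riccati_rhs d \<beta> b c r (z2 r)) (at r)" if "r \<in> {l<..<h}" for r
      by (intro DERIV_diff D1 D2 that)
    show "(z1 r - z2 r) * (Riccati_rhs d \<beta> b c r (z1 r) - Riccati_rhs d \<beta> b c r (z2 r))
        \<le> \<beta> * ((1 + 1/\<beta>) * K powr (1/\<beta>)) * (z1 r - z2 r)\<^sup>2" if "r \<in> {l<..<h}" for r
      by (rule Riccati_rhs_one_sided_Lipschitz) (use that pos K[of r] in auto)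
  qed
  have v1: "spow (1/\<beta>) (y1 r) = spow (1/\<beta>) (z1 r) * w1 r"
    and v2: "spow (1/\<beta>) (y2 r) = spow (1/\<beta>) (z1 r) * w2 r" if "r \<in> {l..h}" for r
  proof -
    have "y1 r = z1 r * spow \<beta> (w1 r)" "y2 r = z1 r * spow \<beta> (w2 r)"
    proof -
      have "z1 r = z2 r" using z_eq[OF that] by simp
      then show "y2 r = z1 r * spow \<beta> (w2 r)" using w2[OF that] by (simp add: z2_def)
      show "y1 r = z1 r * spow \<beta> (w1 r)" using w1[OF that] by (simp add: z1_def)
    qed
    then show "spow (1/\<beta>) (y1 r) = spow (1/\<beta>) (z1 r) * w1 r"
      "spow (1/\<beta>) (y2 r) = spow (1/\<beta>) (z1 r) * w2 r" using pos by (simp_all add: spow_mult)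
  qed
  have w_eq: "w1 r - w2 r = 0" if "r \<in> {l..h}" for r
  proof (rule zero_if_one_sided_Lipschitz[OF _ _ _ _ that])
    show "continuous_on {l..h} (\<lambda>r. w1 r - w2 r)" using sys by (intro continuous_intros) auto
    show "w1 l - w2 l = 0" using init by simp
    show "((\<lambda>r. w1 r - w2 r) has_real_derivative spow (1/\<beta>) (z1 r) * (w1 r - w2 r)) (at r)"
      if "r \<in> {l<..<h}" for r
      using sys that v1[of r] v2[of r] by (auto intro!: derivative_eq_intros simp: algebra_simps)
    show "(w1 r - w2 r) * (spow (1/\<beta>) (z1 r) * (w1 r - w2 r)) \<le> K powr (1/\<beta>) * (w1 r - w2 r)\<^sup>2"
      if "r \<in> {l<..<h}" for r
    proof -
      have "spow (1/\<beta>) (z1 r) \<le> \<bar>z1 r\<bar> powr (1/\<beta>)" using abs_spow[of "1/\<beta>" "z1 r"] by simp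
      also have "\<dots> \<le> K powr (1/\<beta>)" using K[of r] that pos by (intro powr_mono2) auto
      finally have "spow (1/\<beta>) (z1 r) * (w1 r - w2 r)\<^sup>2 \<le> K powr (1/\<beta>) * (w1 r - w2 r)\<^sup>2"
        by (rule mult_right_mono) simp
      then show ?thesis by (simp add: power2_eq_square mult_ac)
    qed
  qed
  have "y1 r = y2 r"
    using z_eq[OF r] w_eq[OF r] w1[OF r] by (simp add: z1_def z2_def)
  then show ?thesis using w_eq[OF r] by simp
qed

text \<open>
  Where \<open>y < 0\<close>, so in particular near a zero of \<open>w\<close> with negative slope, the reciprocal quotient
  \<open>w / w'\<close> is used. Its equation is Lipschitz because the signed power of it occurs only multiplied by
  the quotient itself.
\<close>

definition reciprocal_rhs :: "real \<Rightarrow> real \<Rightarrow> real \<Rightarrow> real \<Rightarrow> real \<Rightarrow> real \<Rightarrow> real" where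
  "reciprocal_rhs d \<beta> b c r z = pl (1/b) (1/c) (spow \<beta> z + d * c / r)"

lemma radial_rhs_via_reciprocal:
  assumes "\<beta> > 0" "y < 0"
  shows "radial_rhs d \<beta> b c r w y = - \<beta> * reciprocal_rhs d \<beta> b c r (w / spow (1/\<beta>) y) * y"
proof -
  have "spow \<beta> (w / spow (1/\<beta>) y) = spow \<beta> w / y" using assms by (simp add: spow_divide)
  then have "- spow \<beta> w - d / r * pl b c y = (- y) * (spow \<beta> (w / spow (1/\<beta>) y) + d * c / r)"
    using assms by (simp add: pl_nonpos_eq field_simps)
  then have "pl (1/b) (1/c) (- spow \<beta> w - d / r * pl b c y)
      = (- y) * reciprocal_rhs d \<beta> b c r (w / spow (1/\<beta>) y)"
    using assms by (simp only: pl_mult[of "- y"] reciprocal_rhs_def)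
  then show ?thesis by (simp add: radial_rhs_def)
qed

lemma DERIV_reciprocal:
  assumes "\<beta> > 0" "y r < 0"
    and Dw: "(w has_real_derivative spow (1/\<beta>) (y r)) (at r)"
    and Dy: "(y has_real_derivative radial_rhs d \<beta> b c r (w r) (y r)) (at r)"
  shows "((\<lambda>r. w r / spow (1/\<beta>) (y r)) has_real_derivative
    1 + w r / spow (1/\<beta>) (y r) * reciprocal_rhs d \<beta> b c r (w r / spow (1/\<beta>) (y r))) (at r)"
proof -
  define v where "v = spow (1/\<beta>) (y r)"
  have "v < 0" using assms by (simp add: v_def)
  define G where "G = reciprocal_rhs d \<beta> b c r (w r / v)"
  have "((\<lambda>r. spow (1/\<beta>) (y r)) has_real_derivative
      (1/\<beta> * \<bar>y r\<bar> powr (1/\<beta> - 1)) * radial_rhs d \<beta> b c r (w r) (y r)) (at r)"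
    by (rule DERIV_chain2[OF DERIV_spow Dy]) (use assms in simp)
  moreover have "(1/\<beta> * \<bar>y r\<bar> powr (1/\<beta> - 1)) * radial_rhs d \<beta> b c r (w r) (y r) = - v * G"
  proof -
    have "\<bar>y r\<bar> powr (1/\<beta> - 1) * y r = v" using assms by (simp add: v_def spow_def powr_diff)
    moreover have "radial_rhs d \<beta> b c r (w r) (y r) = - \<beta> * G * y r"
      unfolding G_def v_def by (rule radial_rhs_via_reciprocal) (use assms in auto)
    ultimately show ?thesis using \<open>\<beta> > 0\<close> by (simp add: mult.assoc mult.left_commute)
  qed
  ultimately have "((\<lambda>r. spow (1/\<beta>) (y r)) has_real_derivative - v * G) (at r)" by simp
  from DERIV_divide[OF Dw this] have "((\<lambda>r. w r / spow (1/\<beta>) (y r)) has_real_derivative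
      (v * v - w r * (- v * G)) / (v * v)) (at r)"
    using \<open>v < 0\<close> by (simp add: v_def)
  moreover have "(v * v - w r * (- v * G)) / (v * v) = 1 + w r / v * G"
    using \<open>v < 0\<close> by (simp add: field_simps)
  ultimately show ?thesis unfolding G_def v_def by simp
qed

lemma abs_reciprocal_rhs_le:
  assumes "\<beta> > 0" "b > 0" "c > 0" "d \<ge> 0" "0 < l" "l \<le> r" "\<bar>z\<bar> \<le> K"
  shows "\<bar>reciprocal_rhs d \<beta> b c r z\<bar> \<le> (1/b + 1/c) * (K powr \<beta> + d * c / l)"
proof -
  have "\<bar>reciprocal_rhs d \<beta> b c r z\<bar> \<le> (1/b + 1/c) * \<bar>spow \<beta> z + d * c / r\<bar>"
    unfolding reciprocal_rhs_def using assms by (intro abs_pl_le) auto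
  also have "\<dots> \<le> (1/b + 1/c) * (K powr \<beta> + d * c / l)"
  proof (intro mult_left_mono order_trans[OF abs_triangle_ineq] add_mono)
    show "\<bar>spow \<beta> z\<bar> \<le> K powr \<beta>" unfolding abs_spow using assms by (intro powr_mono2) auto
    show "\<bar>d * c / r\<bar> \<le> d * c / l" using assms by (auto intro!: divide_left_mono)
  qed (use assms in auto)
  finally show ?thesis .
qed

text \<open>
  The critical term is \<open>z2 * (spow \<beta> z1 - spow \<beta> z2)\<close>. Up to a multiple of \<open>z1 - z2\<close> it is the difference of
  the powers \<open>\<bar>z\<bar>\<^sup>1\<^sup>+\<^sup>\<beta>\<close>, which are differentiable at \<open>0\<close>.
\<close>

lemma mult_reciprocal_rhs_Lipschitz:
  assumes "\<beta> > 0" "b > 0" "c > 0" "d \<ge> 0" "0 < l" "l \<le> r" "\<bar>z1\<bar> \<le> K" "\<bar>z2\<bar> \<le> K"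
  shows "\<bar>z1 * reciprocal_rhs d \<beta> b c r z1 - z2 * reciprocal_rhs d \<beta> b c r z2\<bar>
    \<le> (1/b + 1/c) * (K powr \<beta> + d * c / l + ((1 + \<beta>) * K powr \<beta> + K powr \<beta>)) * \<bar>z1 - z2\<bar>"
proof -
  let ?G = "reciprocal_rhs d \<beta> b c r"
  have "\<bar>z2 * (spow \<beta> z1 - spow \<beta> z2)\<bar> \<le> ((1 + \<beta>) * K powr \<beta> + K powr \<beta>) * \<bar>z1 - z2\<bar>"
  proof -
    have "z2 * (spow \<beta> z1 - spow \<beta> z2)
        = (\<bar>z1\<bar> powr (1 + \<beta>) - \<bar>z2\<bar> powr (1 + \<beta>)) - spow \<beta> z1 * (z1 - z2)"
      by (simp add: mult_spow[symmetric] algebra_simps)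
    moreover have "\<bar>\<bar>z1\<bar> powr (1 + \<beta>) - \<bar>z2\<bar> powr (1 + \<beta>)\<bar> \<le> (1 + \<beta>) * K powr \<beta> * \<bar>z1 - z2\<bar>"
      using assms by (intro abs_powr_Lipschitz) auto
    moreover have "\<bar>spow \<beta> z1 * (z1 - z2)\<bar> \<le> K powr \<beta> * \<bar>z1 - z2\<bar>"
      unfolding abs_mult abs_spow using assms by (intro mult_right_mono powr_mono2) auto
    ultimately show ?thesis unfolding distrib_right[of "(1 + \<beta>) * K powr \<beta>"] by linarith
  qed
  moreover have "0 \<le> 1/b + 1/c" using assms by simp
  moreover have "\<bar>z2 * (?G z1 - ?G z2)\<bar> \<le> (1/b + 1/c) * \<bar>z2 * (spow \<beta> z1 - spow \<beta> z2)\<bar>"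
  proof -
    have "\<bar>?G z1 - ?G z2\<bar> \<le> (1/b + 1/c) * \<bar>(spow \<beta> z1 + d * c / r) - (spow \<beta> z2 + d * c / r)\<bar>"
      unfolding reciprocal_rhs_def using assms by (intro pl_Lipschitz) auto
    then have "\<bar>z2\<bar> * \<bar>?G z1 - ?G z2\<bar> \<le> \<bar>z2\<bar> * ((1/b + 1/c) * \<bar>spow \<beta> z1 - spow \<beta> z2\<bar>)"
      by (intro mult_left_mono) auto
    then show ?thesis by (simp add: abs_mult mult.left_commute)
  qed
  ultimately have 1: "\<bar>z2 * (?G z1 - ?G z2)\<bar> \<le> (1/b + 1/c) * (((1 + \<beta>) * K powr \<beta> + K powr \<beta>) * \<bar>z1 - z2\<bar>)"
    by (meson mult_left_mono order_trans)
  have 2: "\<bar>(z1 - z2) * ?G z1\<bar> \<le> \<bar>z1 - z2\<bar> * ((1/b + 1/c) * (K powr \<beta> + d * c / l))"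
    unfolding abs_mult using assms by (intro mult_left_mono abs_reciprocal_rhs_le) auto
  have "z1 * ?G z1 - z2 * ?G z2 = (z1 - z2) * ?G z1 + z2 * (?G z1 - ?G z2)"
    by (simp add: algebra_simps)
  then have "\<bar>z1 * ?G z1 - z2 * ?G z2\<bar> \<le> \<bar>z1 - z2\<bar> * ((1/b + 1/c) * (K powr \<beta> + d * c / l))
      + (1/b + 1/c) * (((1 + \<beta>) * K powr \<beta> + K powr \<beta>) * \<bar>z1 - z2\<bar>)"
    using 1 2 by linarith
  also have "\<dots> = (1/b + 1/c) * (K powr \<beta> + d * c / l + ((1 + \<beta>) * K powr \<beta> + K powr \<beta>)) * \<bar>z1 - z2\<bar>"
    by (simp only: distrib_left distrib_right mult_ac)
  finally show ?thesis .
qed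

lemma mult_le_of_abs_le: "\<bar>g\<bar> \<le> K * \<bar>u\<bar> \<Longrightarrow> u * g \<le> K * u\<^sup>2" for u g K :: real
proof -
  assume "\<bar>g\<bar> \<le> K * \<bar>u\<bar>"
  then have "\<bar>u\<bar> * \<bar>g\<bar> \<le> \<bar>u\<bar> * (K * \<bar>u\<bar>)" by (intro mult_left_mono) auto
  moreover have "u * g \<le> \<bar>u\<bar> * \<bar>g\<bar>" by (simp flip: abs_mult)
  moreover have "\<bar>u\<bar> * (K * \<bar>u\<bar>) = K * u\<^sup>2" by (simp add: power2_eq_square mult.left_commute)
  ultimately show ?thesis by simp
qed

lemma radial_system_unique_where_y_neg:
  assumes sys1: "radial_system d \<beta> b c l h w1 y1" and sys2: "radial_system d \<beta> b c l h w2 y2"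
    and pos: "\<beta> > 0" "b > 0" "c > 0" "d \<ge> 0" "l > 0"
    and y1: "\<And>r. r \<in> {l..h} \<Longrightarrow> y1 r < 0" and y2: "\<And>r. r \<in> {l..h} \<Longrightarrow> y2 r < 0"
    and init: "w1 l = w2 l" "y1 l = y2 l" and r: "r \<in> {l..h}"
  shows "w1 r = w2 r \<and> y1 r = y2 r"
proof -
  note sys = sys1[unfolded radial_system_def] sys2[unfolded radial_system_def]
  define z1 where "z1 = (\<lambda>r. w1 r / spow (1/\<beta>) (y1 r))"
  define z2 where "z2 = (\<lambda>r. w2 r / spow (1/\<beta>) (y2 r))"
  have ne: "\<forall>r\<in>{l..h}. spow (1/\<beta>) (y1 r) \<noteq> 0" "\<forall>r\<in>{l..h}. spow (1/\<beta>) (y2 r) \<noteq> 0"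
    unfolding spow_eq_0_iff using less_imp_neq[OF y1] less_imp_neq[OF y2] by metis+
  have cz1: "continuous_on {l..h} z1" and cz2: "continuous_on {l..h} z2"
    unfolding z1_def z2_def using sys pos ne by (auto intro!: continuous_intros)
  obtain K1 where K1: "\<And>r. r \<in> {l..h} \<Longrightarrow> \<bar>z1 r\<bar> \<le> K1" using continuous_on_bounded_abs[OF cz1] by blast
  obtain K2 where K2: "\<And>r. r \<in> {l..h} \<Longrightarrow> \<bar>z2 r\<bar> \<le> K2" using continuous_on_bounded_abs[OF cz2] by blast
  define K where "K = max K1 K2"
  have K: "\<bar>z1 r\<bar> \<le> K" "\<bar>z2 r\<bar> \<le> K" if "r \<in> {l..h}" for r
    using K1[OF that] K2[OF that] by (auto simp: K_def)
  let ?G = "\<lambda>r. reciprocal_rhs d \<beta> b c r"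
  have D1: "(z1 has_real_derivative 1 + z1 r * ?G r (z1 r)) (at r)" if "r \<in> {l<..<h}" for r
    unfolding z1_def by (rule DERIV_reciprocal) (use that sys y1 pos in auto)
  have D2: "(z2 has_real_derivative 1 + z2 r * ?G r (z2 r)) (at r)" if "r \<in> {l<..<h}" for r
    unfolding z2_def by (rule DERIV_reciprocal) (use that sys y2 pos in auto)
  define C where "C = (1/b + 1/c) * (K powr \<beta> + d * c / l + ((1 + \<beta>) * K powr \<beta> + K powr \<beta>))"
  have z_eq: "z1 r - z2 r = 0" if "r \<in> {l..h}" for r
  proof (rule zero_if_one_sided_Lipschitz[OF _ _ _ _ that])
    show "continuous_on {l..h} (\<lambda>r. z1 r - z2 r)" by (intro continuous_intros cz1 cz2)
    show "z1 l - z2 l = 0" using init by (simp add: z1_def z2_def)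
    show "((\<lambda>r. z1 r - z2 r) has_real_derivative z1 r * ?G r (z1 r) - z2 r * ?G r (z2 r)) (at r)"
      if "r \<in> {l<..<h}" for r
      using DERIV_diff[OF D1 D2, OF that that] by simp
    show "(z1 r - z2 r) * (z1 r * ?G r (z1 r) - z2 r * ?G r (z2 r)) \<le> C * (z1 r - z2 r)\<^sup>2"
      if "r \<in> {l<..<h}" for r
      unfolding C_def by (rule mult_le_of_abs_le, rule mult_reciprocal_rhs_Lipschitz) (use that pos K[of r] in auto)
  qed
  have y_eq: "y1 r - y2 r = 0" if "r \<in> {l..h}" for r
  proof (rule zero_if_one_sided_Lipschitz[OF _ _ _ _ that])
    show "continuous_on {l..h} (\<lambda>r. y1 r - y2 r)" using sys by (intro continuous_intros) auto
    show "y1 l - y2 l = 0" using init by simp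
    fix r assume r: "r \<in> {l<..<h}"
    have "radial_rhs d \<beta> b c r (w1 r) (y1 r) = - \<beta> * ?G r (z1 r) * y1 r"
      "radial_rhs d \<beta> b c r (w2 r) (y2 r) = - \<beta> * ?G r (z1 r) * y2 r"
      using radial_rhs_via_reciprocal[of \<beta> "y1 r" d b c r "w1 r"] y1[of r]
        radial_rhs_via_reciprocal[of \<beta> "y2 r" d b c r "w2 r"] y2[of r] z_eq[of r] pos r
      by (auto simp: z1_def z2_def)
    moreover have "((\<lambda>r. y1 r - y2 r) has_real_derivative
        radial_rhs d \<beta> b c r (w1 r) (y1 r) - radial_rhs d \<beta> b c r (w2 r) (y2 r)) (at r)"
      using sys r by (intro DERIV_diff) auto
    ultimately show "((\<lambda>r. y1 r - y2 r) has_real_derivative (- \<beta> * ?G r (z1 r)) * (y1 r - y2 r)) (at r)"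
      by (simp only: right_diff_distrib)
    have "\<bar>?G r (z1 r)\<bar> \<le> (1/b + 1/c) * (K powr \<beta> + d * c / l)"
      by (rule abs_reciprocal_rhs_le) (use pos r K[of r] in auto)
    then have "\<bar>(- \<beta> * ?G r (z1 r)) * (y1 r - y2 r)\<bar> \<le> (\<beta> * ((1/b + 1/c) * (K powr \<beta> + d * c / l))) * \<bar>y1 r - y2 r\<bar>"
      unfolding abs_mult using pos by (intro mult_right_mono mult_mono) auto
    then show "(y1 r - y2 r) * ((- \<beta> * ?G r (z1 r)) * (y1 r - y2 r))
        \<le> (\<beta> * ((1/b + 1/c) * (K powr \<beta> + d * c / l))) * (y1 r - y2 r)\<^sup>2"
      by (rule mult_le_of_abs_le)
  qed
  have "w1 r = w2 r"
    using z_eq[OF r] y_eq[OF r] y1[OF r] by (simp add: z1_def z2_def)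
  then show ?thesis using y_eq[OF r] by simp
qed

text \<open>
  At the infimum \<open>s\<close> of the points where two solutions differ they still agree, in a state other than
  \<open>(0, 0)\<close>. One of the two quotients is defined there, after a change of sign if necessary, and shows
  that they agree a little longer.
\<close>

lemma radial_system_unique:
  assumes sys1: "radial_system d \<beta> b c 0 h w1 y1" and sys2: "radial_system d \<beta> b c 0 h w2 y2"
    and pos: "\<beta> > 0" "b > 0" "c > 0" "d \<ge> 0"
    and init: "w1 0 = w2 0" "y1 0 = y2 0" "w1 0 \<noteq> 0" and r: "r \<in> {0..h}"
  shows "w1 r = w2 r \<and> y1 r = y2 r"
proof (rule ccontr)
  assume "\<not> (w1 r = w2 r \<and> y1 r = y2 r)"
  define E where "E = (\<lambda>s. w1 s = w2 s \<and> y1 s = y2 s)"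
  have diff: "\<not> E r" unfolding E_def by fact
  define D where "D = {s \<in> {0..h}. \<not> E s}"
  have "r \<in> D" using diff r by (simp add: D_def)
  have bdd: "bdd_below D" by (rule bdd_belowI[of _ 0]) (simp add: D_def)
  define s where "s = Inf D"
  have "0 \<le> s" unfolding s_def by (rule cInf_greatest) (use \<open>r \<in> D\<close> in \<open>auto simp: D_def\<close>)
  moreover have "s \<le> r" unfolding s_def by (rule cInf_lower[OF \<open>r \<in> D\<close> bdd])
  ultimately have s: "0 \<le> s" "s \<le> r" .
  have before: "E t" if "0 \<le> t" "t < s" for t
  proof (rule ccontr)
    assume "\<not> E t"
    then have "t \<in> D" using that s r by (simp add: D_def)
    from cInf_lower[OF this bdd] show False using that by (simp add: s_def)
  qed
  have at_s: "w1 s = w2 s \<and> y1 s = y2 s"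
  proof (cases "s = 0")
    case False
    then have "0 < s" using s by simp
    have eq: "f s = g s"
      if "continuous_on {0..h} f" "continuous_on {0..h} g" "\<And>t. 0 \<le> t \<Longrightarrow> t < s \<Longrightarrow> f t = g t"
      for f g :: "real \<Rightarrow> real"
    proof -
      have cl: "closure {0..<s} = {0..s}" using \<open>0 < s\<close> by simp
      have sub: "{0..s} \<subseteq> {0..h}" using s r by auto
      have "f s - g s = 0"
      proof (rule continuous_constant_on_closure[of "{0..<s}" "\<lambda>x. f x - g x"])
        show "continuous_on (closure {0..<s}) (\<lambda>x. f x - g x)"
          unfolding cl by (intro continuous_intros continuous_on_subset[OF that(1) sub] continuous_on_subset[OF that(2) sub])
        show "s \<in> closure {0..<s}" unfolding cl using \<open>0 < s\<close> by simp
        show "f x - g x = 0" if "x \<in> {0..<s}" for x using \<open>\<And>t. 0 \<le> t \<Longrightarrow> t < s \<Longrightarrow> f t = g t\<close>[of x] that by simp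
      qed
      then show ?thesis by simp
    qed
    have "w1 s = w2 s" "y1 s = y2 s"
      by (rule eq; use sys1 sys2 before in \<open>simp add: radial_system_def E_def\<close>)+
    then show ?thesis by simp
  qed (use init in simp)
  then have "s \<noteq> r" using diff by (auto simp: E_def)
  then have "s < h" using s r by simp
  have nz: "w1 s \<noteq> 0 \<or> y1 s \<noteq> 0"
    by (rule radial_system_nonzero[OF sys1 pos]) (use init s r in auto)
  have contra: False
    if "s < t" "t \<le> h" and eq: "\<And>x. x \<in> {s..t} \<Longrightarrow> w1 x = w2 x \<and> y1 x = y2 x" for t
  proof -
    have "t \<le> Inf D"
    proof (rule cInf_greatest)
      show "D \<noteq> {}" using \<open>r \<in> D\<close> by auto
      show "t \<le> x" if "x \<in> D" for x
      proof (rule ccontr)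
        assume "\<not> t \<le> x"
        have "E x"
        proof (cases "x < s")
          case True
          then show ?thesis using \<open>x \<in> D\<close> by (intro before) (auto simp: D_def)
        next
          case False
          then show ?thesis using \<open>\<not> t \<le> x\<close> unfolding E_def by (intro eq) auto
        qed
        then show False using \<open>x \<in> D\<close> by (simp add: D_def)
      qed
    qed
    then show False using \<open>s < t\<close> by (simp add: s_def)
  qed
  have w_pos: False
    if sys1: "radial_system d \<beta> b c 0 h w1 y1" and sys2: "radial_system d \<beta> b c 0 h w2 y2"
      and bc: "b > 0" "c > 0" and at_s: "w1 s = w2 s" "y1 s = y2 s" "w1 s > 0"
      and contra: "\<And>t. s < t \<Longrightarrow> t \<le> h \<Longrightarrow> (\<And>x. x \<in> {s..t} \<Longrightarrow> w1 x = w2 x \<and> y1 x = y2 x) \<Longrightarrow> False"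
    for w1 w2 y1 y2 b c
  proof -
    have "continuous_on {0..h} (\<lambda>x. min (w1 x) (w2 x))"
      using sys1 sys2 by (auto simp: radial_system_def intro!: continuous_intros)
    then obtain t where t: "s < t" "t \<le> h" "\<And>x. x \<in> {s..t} \<Longrightarrow> min (w1 x) (w2 x) > 0"
      by (rule positive_on_right_neighbourhood[where s=s]) (use at_s s \<open>s < h\<close> in auto)
    show False
      by (rule contra[OF t(1,2)], rule radial_system_unique_where_w_pos[OF
          radial_system_subset[OF sys1, of s t] radial_system_subset[OF sys2, of s t]])
        (use t at_s s bc pos in auto)
  qed
  have y_neg: False
    if sys1: "radial_system d \<beta> b c 0 h w1 y1" and sys2: "radial_system d \<beta> b c 0 h w2 y2"
      and bc: "b > 0" "c > 0" and at_s: "w1 s = w2 s" "y1 s = y2 s" "y1 s < 0" "s > 0"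
      and contra: "\<And>t. s < t \<Longrightarrow> t \<le> h \<Longrightarrow> (\<And>x. x \<in> {s..t} \<Longrightarrow> w1 x = w2 x \<and> y1 x = y2 x) \<Longrightarrow> False"
    for w1 w2 y1 y2 b c
  proof -
    have "continuous_on {0..h} (\<lambda>x. min (- y1 x) (- y2 x))"
      using sys1 sys2 by (auto simp: radial_system_def intro!: continuous_intros)
    then obtain t where t: "s < t" "t \<le> h" "\<And>x. x \<in> {s..t} \<Longrightarrow> min (- y1 x) (- y2 x) > 0"
      by (rule positive_on_right_neighbourhood[where s=s]) (use at_s s \<open>s < h\<close> in auto)
    show False
      by (rule contra[OF t(1,2)], rule radial_system_unique_where_y_neg[OF
          radial_system_subset[OF sys1, of s t] radial_system_subset[OF sys2, of s t]])
        (use t at_s bc pos in auto)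
  qed
  note swap = radial_system_minus[OF sys1] radial_system_minus[OF sys2]
  have contra_swap: False
    if "s < t" "t \<le> h" "\<And>x. x \<in> {s..t} \<Longrightarrow> - w1 x = - w2 x \<and> - y1 x = - y2 x" for t
    by (rule contra[OF that(1,2)], drule that(3)) simp
  consider "w1 s > 0" | "w1 s < 0" | "w1 s = 0" "y1 s < 0" | "w1 s = 0" "y1 s > 0" using nz by linarith
  then show False
  proof cases
    case 1
    show False by (rule w_pos[OF sys1 sys2 pos(2,3) _ _ 1 contra]) (simp_all add: at_s)
  next
    case 2
    show False by (rule w_pos[OF swap pos(3,2) _ _ _ contra_swap]) (use at_s 2 in simp_all)
  next
    case 3
    then have "s > 0" using s init(3) by (cases "s = 0") auto
    show False by (rule y_neg[OF sys1 sys2 pos(2,3) _ _ 3(2) \<open>s > 0\<close> contra]) (simp_all add: at_s)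
  next
    case 4
    then have "s > 0" using s init(3) by (cases "s = 0") auto
    show False by (rule y_neg[OF swap pos(3,2) _ _ _ \<open>s > 0\<close> contra_swap]) (use at_s 4 in simp_all)
  qed
qed

section \<open>Global solutions and their zeros\<close>

definition global_solution ::
    "real \<Rightarrow> real \<Rightarrow> real \<Rightarrow> real \<Rightarrow> (real \<Rightarrow> real) \<Rightarrow> (real \<Rightarrow> real) \<Rightarrow> bool" where
  "global_solution d \<beta> b c w y \<longleftrightarrow>
     (\<forall>h. radial_system d \<beta> b c 0 h w y) \<and> w 0 = 1 \<and> y 0 = 0"

lemma radial_system_cong:
  assumes sys: "radial_system d \<beta> b c l h w y"
    and eq: "\<And>r. r \<in> {l..h} \<Longrightarrow> w' r = w r" "\<And>r. r \<in> {l..h} \<Longrightarrow> y' r = y r"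
  shows "radial_system d \<beta> b c l h w' y'"
  unfolding radial_system_def
proof (intro conjI ballI)
  note sys = sys[unfolded radial_system_def]
  show "continuous_on {l..h} w'" by (rule continuous_on_eq[of _ w]) (use sys eq in auto)
  show "continuous_on {l..h} y'" by (rule continuous_on_eq[of _ y]) (use sys eq in auto)
  fix r assume r: "r \<in> {l<..<h}"
  show "(w' has_real_derivative spow (1/\<beta>) (y' r)) (at r)"
    by (rule has_field_derivative_transform_within_open[of w _ _ "{l<..<h}"]) (use sys r eq in auto)
  show "(y' has_real_derivative radial_rhs d \<beta> b c r (w' r) (y' r)) (at r)"
    by (rule has_field_derivative_transform_within_open[of y _ _ "{l<..<h}"]) (use sys r eq in auto)
qed

lemma global_solution_exists:
  assumes "\<beta> > 0" "b > 0" "c > 0" "d \<ge> 0"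
  obtains w y where "global_solution d \<beta> b c w y"
proof -
  define L where "L = max 4 (max (1/b) (1/c))"
  have L: "L \<ge> 4" "1/b \<le> L" "1/c \<le> L" by (auto simp: L_def)
  then have L': "1 \<le> L * b" "1 \<le> L * c" using assms by (auto simp: field_simps)
  have "\<exists>w y. radial_system d \<beta> b c 0 R w y \<and> w 0 = 1 \<and> y 0 = 0" if "R > 0" for R
    using radial_system_exists[OF assms that L(1) L'] by metis
  then obtain w y where
    sys: "\<And>R. R > 0 \<Longrightarrow> radial_system d \<beta> b c 0 R (w R) (y R) \<and> w R 0 = 1 \<and> y R 0 = 0"
    by metis
  \<comment> \<open>By uniqueness the solutions on different intervals fit together.\<close>
  have agree: "w R r = w S r \<and> y R r = y S r" if "0 \<le> r" "r < R" "R \<le> S" for r R S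
  proof (rule radial_system_unique[of d \<beta> b c R "w R" "y R" "w S" "y S" r, OF _ _ assms])
    show "radial_system d \<beta> b c 0 R (w R) (y R)" using sys[of R] that by auto
    show "radial_system d \<beta> b c 0 R (w S) (y S)"
      using sys[of S] that radial_system_subset[of d \<beta> b c 0 S "w S" "y S" 0 R] by auto
  qed (use sys[of R] sys[of S] that in auto)
  define W where "W = (\<lambda>r. w (r + 1) r)"
  define Y where "Y = (\<lambda>r. y (r + 1) r)"
  have "radial_system d \<beta> b c 0 h W Y" for h
  proof (cases "h \<ge> 0")
    case True
    show ?thesis
    proof (rule radial_system_cong)
      show "radial_system d \<beta> b c 0 h (w (h + 1)) (y (h + 1))"
        using sys[of "h + 1"] True radial_system_subset[of d \<beta> b c 0 "h + 1" _ _ 0 h] by auto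
      show "W r = w (h + 1) r" "Y r = y (h + 1) r" if "r \<in> {0..h}" for r
        using agree[of r "r + 1" "h + 1"] that by (auto simp: W_def Y_def)
    qed
  qed (simp add: radial_system_def)
  moreover have "W 0 = 1" "Y 0 = 0" using sys[of 1] by (auto simp: W_def Y_def)
  ultimately show ?thesis by (intro that[of W Y]) (simp add: global_solution_def)
qed

lemma global_solution_bounds:
  assumes "\<beta> > 0" "b > 0" "c > 0" "d \<ge> 0" and sol: "global_solution d \<beta> b c w y"
    and L: "L \<ge> 4" "1 \<le> L * b" "1 \<le> L * c" and r: "r \<in> {0..R}" "R > 0"
  shows "\<bar>w r\<bar> \<le> 2 * exp (L * R)" "\<bar>y r\<bar> \<le> \<beta> * L * (2 * exp (L * R)) powr \<beta> * r"
proof -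
  obtain w2 y2 where sys2: "radial_system d \<beta> b c 0 R w2 y2" "w2 0 = 1" "y2 0 = 0"
    and bounds: "\<bar>w2 r\<bar> \<le> 2 * exp (L * r)" "\<bar>y2 r\<bar> \<le> \<beta> * L * (2 * exp (L * R)) powr \<beta> * r"
    using radial_system_exists[OF assms(1-4) r(2) L] r(1) by metis
  have "w r = w2 r \<and> y r = y2 r"
    by (rule radial_system_unique[of d \<beta> b c R w y w2 y2 r])
      (use assms sys2 in \<open>auto simp: global_solution_def\<close>)
  moreover have "2 * exp (L * r) \<le> 2 * exp (L * R)" using r L by simp
  ultimately show "\<bar>w r\<bar> \<le> 2 * exp (L * R)" "\<bar>y r\<bar> \<le> \<beta> * L * (2 * exp (L * R)) powr \<beta> * r"
    using bounds order_trans by metis+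
qed

lemma linear_decrease:
  fixes f :: "real \<Rightarrow> real"
  assumes D: "\<And>r. r \<ge> p \<Longrightarrow> (f has_real_derivative f' r) (at r)"
    and le: "\<And>r. r \<ge> p \<Longrightarrow> f' r \<le> - k" and "p \<le> q"
  shows "f q \<le> f p - k * (q - p)"
proof (cases "p = q")
  case False
  then have "p < q" using \<open>p \<le> q\<close> by simp
  have "continuous_on {p..q} f"
    by (rule DERIV_continuous_on[where D=f']) (use D in \<open>auto intro: has_field_derivative_at_within\<close>)
  then obtain z where "z \<in> {p<..<q}" "f q - f p = (q - p) * f' z"
    by (rule MVT_interior[OF \<open>p < q\<close>]) (use D in auto)
  moreover from this have "(q - p) * f' z \<le> (q - p) * (- k)"
    using le[of z] \<open>p < q\<close> by (intro mult_left_mono) auto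
  ultimately show ?thesis by (simp add: algebra_simps)
qed simp

text \<open>
  For \<open>z \<ge> 0\<close> all terms have the same sign. For \<open>z < 0\<close> and large \<open>r\<close> the singular term is dominated: by the constant \<open>- 1\<close> as long as \<open>d * c / r * \<bar>z\<bar> \<le> 1/2\<close>, and
  by the superlinear power \<open>\<bar>z\<bar>\<^sup>1\<^sup>+\<^sup>1\<^sup>/\<^sup>\<beta>\<close> otherwise.
\<close>

lemma Riccati_rhs_le:
  assumes pos: "\<beta> > 0" "b > 0" "c > 0" "d \<ge> 0" "r > 0" and r: "d * c / r \<le> 1/2" "d * c / r \<le> b/2"
  shows "Riccati_rhs d \<beta> b c r z \<le> - (\<beta> * min (1 / (2 * c)) (1/2))" (is ?A)
    and "z \<le> - 1 \<Longrightarrow> Riccati_rhs d \<beta> b c r z \<le> - (\<beta> / 2 * (- z) powr (1 + 1/\<beta>))" (is "_ \<Longrightarrow> ?B")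
proof -
  let ?g = "pl (1/b) (1/c) (- 1 - d / r * pl b c z)"
  let ?q = "\<bar>z\<bar> powr (1 + 1/\<beta>)"
  have mono: "pl (1/b) (1/c) s \<le> pl (1/b) (1/c) t" if "s \<le> t" for s t
    using that pos by (intro pl_mono) auto
  have q0: "?q \<ge> 0" and c0: "1 / (2 * c) > 0" and m: "min (1 / (2 * c)) (1/2) \<le> 1 / (2 * c)"
    "min (1 / (2 * c)) (1/2) \<le> 1 / 2" using pos by auto
  have key: "?g - ?q \<le> - min (1 / (2 * c)) (1/2) \<and> (z \<le> - 1 \<longrightarrow> ?g - ?q \<le> - ?q / 2)"
  proof (cases "z \<ge> 0")
    case True
    then have "?g \<le> pl (1/b) (1/c) (- 1)" using pos by (intro mono) (simp add: pl_nonneg_eq)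
    also have "\<dots> = - (1/c)" by (simp add: pl_nonpos_eq)
    also have "\<dots> \<le> - (1 / (2 * c))" using pos by (simp add: field_simps)
    finally show ?thesis using True q0 m by (intro conjI impI) linarith+
  next
    case False
    define x where "x = - z"
    define \<delta> where "\<delta> = d * c / r"
    have x: "x > 0" using False by (simp add: x_def)
    have \<delta>: "0 \<le> \<delta>" "\<delta> \<le> 1/2" "\<delta> \<le> b/2" using r pos by (auto simp: \<delta>_def)
    have g: "?g = pl (1/b) (1/c) (- 1 + \<delta> * x)"
      using False by (simp add: x_def \<delta>_def pl_nonpos_eq mult_ac)
    have q: "?q = x powr (1 + 1/\<beta>)" using False by (simp add: x_def)
    have x_le: "x \<le> ?q" if "x \<ge> 1"
      unfolding q using powr_mono[of 1 "1 + 1/\<beta>" x] that pos by simp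
    show ?thesis
    proof (cases "\<delta> * x \<le> 1/2")
      case True
      then have "?g \<le> pl (1/b) (1/c) (- 1/2)" unfolding g by (intro mono) simp
      also have "\<dots> = - (1 / (2 * c))" by (simp add: pl_nonpos_eq)
      finally have "?g \<le> - (1 / (2 * c))" .
      then show ?thesis using q0 m c0 by (intro conjI impI) linarith+
    next
      case False
      have "1 < x"
      proof (rule ccontr)
        assume "\<not> 1 < x"
        then have "\<delta> * x \<le> 1/2 * 1" using \<delta> x by (intro mult_mono) auto
        then show False using False by simp
      qed
      have "?g \<le> pl (1/b) (1/c) (\<delta> * x)" unfolding g by (intro mono) simp
      also have "\<dots> = \<delta> * x / b" using \<delta> x by (simp add: pl_nonneg_eq)
      also have "\<dots> \<le> (b/2) * x / b" using \<delta> x pos by (intro divide_right_mono mult_right_mono) auto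
      also have "\<dots> = x / 2" using pos by simp
      finally have "?g \<le> x / 2" .
      then show ?thesis using x_le \<open>1 < x\<close> m by (intro conjI impI) linarith+
    qed
  qed
  have eq: "Riccati_rhs d \<beta> b c r z = \<beta> * (?g - ?q)" by (simp add: Riccati_rhs_def)
  show ?A unfolding eq using mult_left_mono[of "?g - ?q" "- min (1 / (2 * c)) (1/2)" \<beta>] key pos by simp
  show ?B if "z \<le> - 1"
    unfolding eq using mult_left_mono[of "?g - ?q" "- ?q / 2" \<beta>] key pos that by simp
qed

text \<open>
  Oscillation: a solution that stays positive would give a solution of the Riccati equation on a half
  line. It decreases below \<open>-1\<close>, and from there \<open>(- z)\<^sup>-\<^sup>1\<^sup>/\<^sup>\<beta>\<close> would decrease to \<open>0\<close> at least linearly,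
  so that \<open>z\<close> blows up in finite time.
\<close>

lemma no_eventually_positive_solution:
  assumes pos: "\<beta> > 0" "b > 0" "c > 0" "d \<ge> 0" "l \<ge> 0"
    and sys: "\<And>h. radial_system d \<beta> b c l h w y" and w: "\<And>r. r > l \<Longrightarrow> w r > 0"
  shows False
proof -
  define z where "z = (\<lambda>r. y r / spow \<beta> (w r))"
  \<comment> \<open>From \<open>p\<close> on the estimates for large \<open>r\<close> apply; at \<open>q\<close> the quotient has dropped below \<open>- 1\<close>.\<close>
  define p where "p = l + 1 + 2 * d * c + 2 * d * c / b"
  have "2 * d * c \<ge> 0" "2 * d * c / b \<ge> 0" using pos by auto
  then have p: "p > l" "p > 0" "2 * d * c \<le> p" "2 * d * c / b \<le> p"
    using pos(5) unfolding p_def by linarith+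
  have large: "d * c / r \<le> 1/2" "d * c / r \<le> b/2" if "r \<ge> p" for r
  proof -
    have "2 * d * c \<le> r" "2 * d * c / b \<le> r" "r > 0" using p that by linarith+
    then show "d * c / r \<le> 1/2" "d * c / r \<le> b/2" using pos by (simp_all add: field_simps)
  qed
  have Dz: "(z has_real_derivative Riccati_rhs d \<beta> b c r (z r)) (at r)" if "r \<ge> p" for r
    unfolding z_def
    by (rule DERIV_Riccati) (use sys[of "r + 1", unfolded radial_system_def] w that p pos in auto)
  define k where "k = \<beta> * min (1 / (2 * c)) (1/2)"
  have "k > 0" using pos by (simp add: k_def)
  have slope: "Riccati_rhs d \<beta> b c r (z r) \<le> - k" if "r \<ge> p" for r
    unfolding k_def by (rule Riccati_rhs_le) (use pos that p large in auto)
  define q where "q = p + (\<bar>z p\<bar> + 1) / k"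
  have "q \<ge> p" using \<open>k > 0\<close> by (simp add: q_def)
  have zq: "z r \<le> - 1" if "r \<ge> q" for r
  proof -
    have "z q \<le> z p - k * (q - p)" by (rule linear_decrease[OF Dz slope \<open>q \<ge> p\<close>])
    also have "k * (q - p) = \<bar>z p\<bar> + 1" using \<open>k > 0\<close> by (simp add: q_def)
    finally have "z q \<le> - 1" by simp
    moreover have "z r \<le> z q - k * (r - q)"
      by (rule linear_decrease[OF Dz slope]) (use \<open>q \<ge> p\<close> that in auto)
    moreover have "k * (r - q) \<ge> 0" using \<open>k > 0\<close> that by simp
    ultimately show ?thesis by linarith
  qed
  define f where "f = (\<lambda>r. (- z r) powr (- (1/\<beta>)))"
  define f' where "f' = (\<lambda>r. - (1/\<beta>) * (- z r) powr (- (1/\<beta>) - 1) * (- Riccati_rhs d \<beta> b c r (z r)))"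
  have Df: "(f has_real_derivative f' r) (at r)" if "r \<ge> q" for r
    unfolding f_def f'_def
    by (rule DERIV_chain2[OF has_real_derivative_powr DERIV_minus[OF Dz]])
      (use zq[OF that] that \<open>q \<ge> p\<close> in auto)
  have "f' r \<le> - (1/2)" if "r \<ge> q" for r
  proof -
    have zr: "- z r > 0" using zq[OF that] by simp
    have "\<beta> / 2 * (- z r) powr (1 + 1/\<beta>) \<le> - Riccati_rhs d \<beta> b c r (z r)"
      using Riccati_rhs_le(2)[OF pos(1-4) _ large, of r "z r"] zq[OF that] that \<open>q \<ge> p\<close> p by simp
    then have "((1/\<beta>) * (- z r) powr (- (1/\<beta>) - 1)) * (\<beta> / 2 * (- z r) powr (1 + 1/\<beta>))
        \<le> ((1/\<beta>) * (- z r) powr (- (1/\<beta>) - 1)) * (- Riccati_rhs d \<beta> b c r (z r))"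
      using pos by (intro mult_left_mono) auto
    moreover have "(- z r) powr (- (1/\<beta>) - 1) * (- z r) powr (1 + 1/\<beta>) = 1"
      using zr by (simp flip: powr_add)
    then have "((1/\<beta>) * (- z r) powr (- (1/\<beta>) - 1)) * (\<beta> / 2 * (- z r) powr (1 + 1/\<beta>)) = 1/2"
      using pos by (simp add: mult.assoc mult.left_commute)
    moreover have "f' r = - (((1/\<beta>) * (- z r) powr (- (1/\<beta>) - 1)) * (- Riccati_rhs d \<beta> b c r (z r)))"
      by (simp add: f'_def)
    ultimately show ?thesis by linarith
  qed
  then have "f (q + 2 * f q) \<le> f q - 1/2 * ((q + 2 * f q) - q)"
    by (intro linear_decrease[OF Df]) (auto simp: f_def)
  then have "f (q + 2 * f q) \<le> 0" by simp
  moreover have "f (q + 2 * f q) > 0" using zq[of "q + 2 * f q"] by (simp add: f_def)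
  ultimately show False by simp
qed

lemma constant_sign_if_nonzero:
  fixes f :: "real \<Rightarrow> real"
  assumes "\<And>h. continuous_on {l..h} f" "\<And>r. r > l \<Longrightarrow> f r \<noteq> 0"
  shows "(\<forall>r>l. f r > 0) \<or> (\<forall>r>l. f r < 0)"
proof (rule ccontr)
  assume "\<not> ?thesis"
  then obtain s t where st: "s > l" "t > l" "f s < 0" "f t > 0"
    using assms(2) by (meson linorder_neqE_linordered_idom)
  have cont: "continuous_on {min s t..max s t} f"
    by (rule continuous_on_subset[OF assms(1)[of "max s t"]]) (use st in auto)
  have "\<exists>x\<ge>min s t. x \<le> max s t \<and> f x = 0"
  proof (cases "s \<le> t")
    case True
    then show ?thesis using IVT'[of f s 0 t] st cont by (auto simp: max_def min_def)
  next
    case False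
    then show ?thesis using IVT2'[of f s 0 t] st cont by (auto simp: max_def min_def)
  qed
  then show False using assms(2) st by auto
qed

lemma global_solution_zeros_unbounded:
  assumes pos: "\<beta> > 0" "b > 0" "c > 0" "d \<ge> 0" and sol: "global_solution d \<beta> b c w y" and "l \<ge> 0"
  shows "\<exists>r>l. w r = 0"
proof (rule ccontr)
  assume "\<not> ?thesis"
  then have nz: "\<And>r. r > l \<Longrightarrow> w r \<noteq> 0" by auto
  have sys: "radial_system d \<beta> b c l h w y" for h
    using sol \<open>l \<ge> 0\<close> by (auto simp: global_solution_def intro: radial_system_subset)
  then have "continuous_on {l..h} w" for h by (simp add: radial_system_def)
  from constant_sign_if_nonzero[OF this nz] show False
  proof
    assume "\<forall>r>l. w r > 0"
    then show False using no_eventually_positive_solution[OF pos \<open>l \<ge> 0\<close> sys] by blast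
  next
    assume "\<forall>r>l. w r < 0"
    then show False
      using no_eventually_positive_solution[OF pos(1,3,2,4) \<open>l \<ge> 0\<close> radial_system_minus[OF sys]] by auto
  qed
qed

definition zeros_upto :: "(real \<Rightarrow> real) \<Rightarrow> real \<Rightarrow> real set" where
  "zeros_upto w r = {x. 0 < x \<and> x \<le> r \<and> w x = 0}"

lemma global_solution_D:
  assumes "global_solution d \<beta> b c w y"
  shows "continuous_on {0..h} w" "continuous_on {0..h} y"
    "r > 0 \<Longrightarrow> (w has_real_derivative spow (1/\<beta>) (y r)) (at r)"
    "r > 0 \<Longrightarrow> (y has_real_derivative radial_rhs d \<beta> b c r (w r) (y r)) (at r)"
proof -
  have "radial_system d \<beta> b c 0 h w y" for h using assms by (simp add: global_solution_def)
  from this[of h] this[of "r + 1"] show "continuous_on {0..h} w" "continuous_on {0..h} y"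
    "r > 0 \<Longrightarrow> (w has_real_derivative spow (1/\<beta>) (y r)) (at r)"
    "r > 0 \<Longrightarrow> (y has_real_derivative radial_rhs d \<beta> b c r (w r) (y r)) (at r)"
    by (auto simp: radial_system_def)
qed

lemma global_solution_simple_zero:
  assumes pos: "\<beta> > 0" "b > 0" "c > 0" "d \<ge> 0" and sol: "global_solution d \<beta> b c w y"
    and "r \<ge> 0" "w r = 0"
  shows "y r \<noteq> 0"
  using radial_system_nonzero[of d \<beta> b c r w y r] assms by (auto simp: global_solution_def)

lemma finite_zeros_upto:
  assumes pos: "\<beta> > 0" "b > 0" "c > 0" "d \<ge> 0" and sol: "global_solution d \<beta> b c w y"
  shows "finite (zeros_upto w R)"
proof (rule ccontr)
  assume inf: "infinite (zeros_upto w R)"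
  have "zeros_upto w R \<subseteq> {0..R}" by (auto simp: zeros_upto_def)
  with inf have "\<exists>x\<in>{0..R}. x islimpt zeros_upto w R"
    by (intro compact_eq_Bolzano_Weierstrass[THEN iffD1, OF compact_Icc, THEN spec, THEN mp, OF conjI])
  then obtain x where x: "x \<in> {0..R}" "x islimpt zeros_upto w R" by (rule bexE)
  have "w x = 0"
  proof -
    have "closed ({0..R} \<inter> w -` {0})"
      by (intro continuous_closed_preimage global_solution_D(1)[OF sol]) auto
    moreover have "x islimpt ({0..R} \<inter> w -` {0})"
      using x(2) by (rule islimpt_subset) (auto simp: zeros_upto_def)
    ultimately have "x \<in> {0..R} \<inter> w -` {0}" by (rule closed_limpt[THEN iffD1, rule_format])
    then show ?thesis by simp
  qed
  then have "x > 0" using sol x(1) by (cases "x = 0") (auto simp: global_solution_def)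
  have "y x \<noteq> 0" using global_solution_simple_zero[OF pos sol _ \<open>w x = 0\<close>] x(1) by simp
  \<comment> \<open>The accumulation point \<open>x\<close> would be a simple zero, but simple zeros are isolated.\<close>
  have "((\<lambda>t. (w t - w x) / (t - x)) \<longlongrightarrow> spow (1/\<beta>) (y x)) (at x)"
    using global_solution_D(3)[OF sol \<open>x > 0\<close>] by (simp add: has_field_derivative_iff)
  moreover have "spow (1/\<beta>) (y x) \<noteq> 0" using \<open>y x \<noteq> 0\<close> by simp
  ultimately have "\<forall>\<^sub>F t in at x. (w t - w x) / (t - x) \<noteq> 0"
    by (rule tendsto_imp_eventually_ne)
  then have "\<forall>\<^sub>F t in at x. t \<notin> zeros_upto w R"
    by eventually_elim (use \<open>w x = 0\<close> in \<open>auto simp: zeros_upto_def\<close>)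
  then show False using x(2) by (simp add: islimpt_iff_eventually)
qed

lemma ex1_kth_element:
  fixes Z :: "real set"
  assumes fin: "\<And>r. finite {x \<in> Z. x \<le> r}" and unb: "\<And>r. \<exists>x\<in>Z. x > r" and "k \<ge> 1"
  shows "\<exists>!b. b \<in> Z \<and> card {x \<in> Z. x \<le> b} = k"
proof -
  have "\<exists>b. b \<in> Z \<and> card {x \<in> Z. x \<le> b} = Suc m" for m
  proof (induction m)
    case 0
    obtain x where x: "x \<in> Z" using unb by blast
    define b where "b = Min {t \<in> Z. t \<le> x}"
    have b: "b \<in> {t \<in> Z. t \<le> x}" unfolding b_def by (rule Min_in) (use fin x in auto)
    have "b \<le> t" if "t \<in> Z" "t \<le> x" for t unfolding b_def by (rule Min_le) (use fin that in auto)
    then have "{t \<in> Z. t \<le> b} = {b}" using b by force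
    then show ?case using b by (intro exI[of _ b]) simp
  next
    case (Suc m)
    then obtain b where b: "b \<in> Z" "card {x \<in> Z. x \<le> b} = Suc m" by blast
    obtain x where x: "x \<in> Z" "x > b" using unb by blast
    have fin': "finite {t \<in> Z. b < t \<and> t \<le> x}" by (rule finite_subset[OF _ fin[of x]]) auto
    define b' where "b' = Min {t \<in> Z. b < t \<and> t \<le> x}"
    have b': "b' \<in> {t \<in> Z. b < t \<and> t \<le> x}" unfolding b'_def by (rule Min_in) (use fin' x in auto)
    have "b' \<le> t" if "t \<in> Z" "b < t" "t \<le> x" for t
      unfolding b'_def by (rule Min_le) (use fin' that in auto)
    then have "{t \<in> Z. t \<le> b'} = insert b' {t \<in> Z. t \<le> b}" using b' by force
    then have "card {t \<in> Z. t \<le> b'} = Suc (Suc m)" using b fin b' by simp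
    then show ?case using b' by blast
  qed
  then obtain b where b: "b \<in> Z" "card {x \<in> Z. x \<le> b} = k"
    using \<open>k \<ge> 1\<close> by (metis Suc_le_D One_nat_def)
  have less: "card {x \<in> Z. x \<le> s} < card {x \<in> Z. x \<le> t}" if "t \<in> Z" "s < t" for s t
    by (rule psubset_card_mono[OF fin]) (use that in force)
  show ?thesis
  proof (rule ex1I[of _ b])
    show "b \<in> Z \<and> card {x \<in> Z. x \<le> b} = k" using b by simp
    show "b' = b" if "b' \<in> Z \<and> card {x \<in> Z. x \<le> b'} = k" for b'
      using less[of b b'] less[of b' b] b that by (cases b b' rule: linorder_cases) auto
  qed
qed

lemma kth_positive_zero_properties:
  assumes pos: "\<beta> > 0" "b > 0" "c > 0" "d \<ge> 0" and sol: "global_solution d \<beta> b c w y" and "k \<ge> 1"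
  shows "kth_positive_zero w k > 0" "w (kth_positive_zero w k) = 0"
    "card (zeros_upto w (kth_positive_zero w k)) = k"
proof -
  define Z where "Z = {x. 0 < x \<and> w x = 0}"
  have Z: "{x \<in> Z. x \<le> r} = zeros_upto w r" for r by (auto simp: Z_def zeros_upto_def)
  have "\<exists>!b. b \<in> Z \<and> card {x \<in> Z. x \<le> b} = k"
  proof (rule ex1_kth_element[OF _ _ \<open>k \<ge> 1\<close>])
    show "finite {x \<in> Z. x \<le> r}" for r unfolding Z by (rule finite_zeros_upto[OF pos sol])
    show "\<exists>x\<in>Z. x > r" for r
      using global_solution_zeros_unbounded[OF pos sol, of "max 0 r"] by (auto simp: Z_def)
  qed
  then have "\<exists>!b. b > 0 \<and> w b = 0 \<and> card {r. 0 < r \<and> r \<le> b \<and> w r = 0} = k"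
    unfolding Z zeros_upto_def by (simp add: Z_def conj_assoc)
  from theI'[OF this] show "kth_positive_zero w k > 0" "w (kth_positive_zero w k) = 0"
    "card (zeros_upto w (kth_positive_zero w k)) = k"
    unfolding kth_positive_zero_def zeros_upto_def by auto
qed

lemma bounded_away_from_zero:
  fixes f :: "real \<Rightarrow> real"
  assumes "continuous_on {p..q} f" "\<And>x. x \<in> {p..q} \<Longrightarrow> f x \<noteq> 0"
  obtains m where "m > 0" "\<And>x. x \<in> {p..q} \<Longrightarrow> m \<le> \<bar>f x\<bar>"
proof (cases "p \<le> q")
  case True
  have "continuous_on {p..q} (\<lambda>x. \<bar>f x\<bar>)" by (intro continuous_intros assms)
  then obtain x where "x \<in> {p..q}" "\<And>y. y \<in> {p..q} \<Longrightarrow> \<bar>f x\<bar> \<le> \<bar>f y\<bar>"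
    using continuous_attains_inf[of "{p..q}" "\<lambda>x. \<bar>f x\<bar>"] True by auto
  then show ?thesis using assms(2) by (intro that[of "\<bar>f x\<bar>"]) auto
qed (auto intro: that[of 1])

lemma sgn_eq_if_close: "\<bar>s - t\<bar> < \<bar>t\<bar> \<Longrightarrow> sgn s = sgn t" for s t :: real
  by (cases "t > 0"; cases "s > 0"; cases "s = 0") (auto simp: sgn_real_def)

lemma nonzero_if_sgn_eq: "sgn s = sgn t \<Longrightarrow> t \<noteq> 0 \<Longrightarrow> s \<noteq> 0" for s t :: real
  by (auto simp: sgn_real_def split: if_splits)

lemma eventually_same_sign:
  fixes f :: "real \<Rightarrow> real"
  assumes cont: "continuous_on {p..q} f" and nz: "\<And>x. x \<in> {p..q} \<Longrightarrow> f x \<noteq> 0"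
    and lim: "uniform_limit {p..q} g f F"
  shows "\<forall>\<^sub>F n in F. \<forall>x\<in>{p..q}. sgn (g n x) = sgn (f x)"
proof -
  obtain m where m: "m > 0" "\<And>x. x \<in> {p..q} \<Longrightarrow> m \<le> \<bar>f x\<bar>"
    using bounded_away_from_zero[OF cont nz] by blast
  have "\<forall>\<^sub>F n in F. \<forall>x\<in>{p..q}. dist (g n x) (f x) < m"
    using lim m(1) by (auto simp: uniform_limit_iff)
  then show ?thesis
  proof eventually_elim
    case (elim n)
    show ?case
    proof
      fix x assume x: "x \<in> {p..q}"
      have "\<bar>g n x - f x\<bar> < m" using elim x by (auto simp: dist_real_def)
      then have "\<bar>g n x - f x\<bar> < \<bar>f x\<bar>" using m(2)[OF x] by linarith
      then show "sgn (g n x) = sgn (f x)" by (rule sgn_eq_if_close)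
    qed
  qed
qed

lemma unique_zero_if_derivative_nonzero:
  fixes w :: "real \<Rightarrow> real"
  assumes "p < q" and D: "\<And>x. x \<in> {p..q} \<Longrightarrow> (w has_real_derivative v x) (at x)"
    and v: "\<And>x. x \<in> {p..q} \<Longrightarrow> v x \<noteq> 0" and "w p * w q < 0"
  obtains z where "{x \<in> {p..q}. w x = 0} = {z}"
proof -
  have cont: "continuous_on {s..t} w" if "p \<le> s" "t \<le> q" for s t
    by (rule DERIV_continuous_on[where D=v]) (use that in \<open>auto intro!: has_field_derivative_at_within[OF D]\<close>)
  have "\<exists>z\<ge>p. z \<le> q \<and> w z = 0"
  proof (cases "w p < 0")
    case True
    then have "w q > 0" using \<open>w p * w q < 0\<close> by (simp add: mult_less_0_iff)
    then show ?thesis using IVT'[of w p 0 q] True \<open>p < q\<close> cont by auto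
  next
    case False
    then have "w p > 0" "w q < 0" using \<open>w p * w q < 0\<close> by (auto simp: mult_less_0_iff)
    then show ?thesis using IVT2'[of w q 0 p] \<open>p < q\<close> cont by auto
  qed
  then obtain z where z: "z \<in> {p..q}" "w z = 0" by auto
  have no_two: False if "x < x'" "x \<in> {p..q}" "x' \<in> {p..q}" "w x = 0" "w x' = 0" for x x'
  proof -
    have c: "continuous_on {x..x'} w" using that by (intro cont) auto
    have "\<exists>r. r \<in> {x<..<x'} \<and> w x' - w x = (x' - x) * v r"
      by (rule MVT_interior[OF \<open>x < x'\<close> c, of v]) (use that D in auto)
    then obtain r where "r \<in> {x<..<x'}" "w x' - w x = (x' - x) * v r" by blast
    then show False using that v[of r] by auto
  qed
  have "x = z" if "x \<in> {p..q}" "w x = 0" for x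
    using no_two[of x z] no_two[of z x] that z by (cases x z rule: linorder_cases) auto
  then have "{x \<in> {p..q}. w x = 0} = {z}" using z by blast
  then show ?thesis by (rule that)
qed

lemma isolate_simple_zero:
  assumes pos: "\<beta> > 0" "b > 0" "c > 0" "d \<ge> 0" and sol: "global_solution d \<beta> b c w y"
    and z: "z > 0" "w z = 0" and "e0 > 0"
  obtains e where "0 < e" "e < e0" "e < z" "\<And>x. x \<in> {z-e..z+e} \<Longrightarrow> y x \<noteq> 0"
    "w (z - e) * w (z + e) < 0" "{x \<in> {z-e..z+e}. w x = 0} = {z}"
proof -
  have yz: "y z \<noteq> 0" using global_solution_simple_zero[OF pos sol _ z(2)] z(1) by simp
  \<comment> \<open>On a small interval \<open>y\<close> keeps its sign, so \<open>w\<close> is strictly monotone there.\<close>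
  have "isCont y z" using global_solution_D(4)[OF sol z(1)] by (rule DERIV_isCont)
  moreover have "\<bar>y z\<bar> > 0" using yz by simp
  ultimately obtain e1 where e1: "e1 > 0" "\<And>x. \<bar>x - z\<bar> < e1 \<Longrightarrow> \<bar>y x - y z\<bar> < \<bar>y z\<bar>"
    unfolding continuous_at_eps_delta dist_real_def by blast
  define e where "e = min e1 (min e0 z) / 2"
  have e: "0 < e" "e < e0" "e < z" "e < e1" using e1 \<open>e0 > 0\<close> z by (auto simp: e_def)
  have y_sgn: "sgn (y x) = sgn (y z)" if "x \<in> {z-e..z+e}" for x
  proof -
    have "\<bar>x - z\<bar> < e1" using that e by auto
    then show ?thesis by (intro sgn_eq_if_close e1)
  qed
  have D: "(w has_real_derivative spow (1/\<beta>) (y x)) (at x)" if "x \<in> {z-e..z+e}" for x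
    using that e by (intro global_solution_D(3)[OF sol]) auto
  have c: "continuous_on {s..t} w" if "0 \<le> s" for s t
    by (rule continuous_on_subset[OF global_solution_D(1)[OF sol, of t]]) (use that in auto)
  obtain r1 where r1: "r1 \<in> {z-e<..<z}" "w z - w (z - e) = (z - (z - e)) * spow (1/\<beta>) (y r1)"
    by (rule MVT_interior[of "z - e" z w "\<lambda>x. spow (1/\<beta>) (y x)"]) (use e D c in auto)
  obtain r2 where r2: "r2 \<in> {z<..<z+e}" "w (z + e) - w z = ((z + e) - z) * spow (1/\<beta>) (y r2)"
    by (rule MVT_interior[of z "z + e" w "\<lambda>x. spow (1/\<beta>) (y x)"]) (use e z D c in auto)
  have "w (z - e) = - (e * spow (1/\<beta>) (y r1))" "w (z + e) = e * spow (1/\<beta>) (y r2)"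
    using r1(2) r2(2) z(2) by simp_all
  moreover have "sgn (y r1) = sgn (y z)" "sgn (y r2) = sgn (y z)"
    using y_sgn[of r1] y_sgn[of r2] r1(1) r2(1) e by simp_all
  ultimately have "sgn (w (z - e)) = - sgn (y z)" "sgn (w (z + e)) = sgn (y z)"
    using e by (simp_all add: sgn_mult sgn_minus)
  then have "sgn (w (z - e) * w (z + e)) = - (sgn (y z) * sgn (y z))" by (simp only: sgn_mult mult_minus_left)
  also have "sgn (y z) * sgn (y z) = 1" using yz by (cases "y z > 0") auto
  finally have neg: "w (z - e) * w (z + e) < 0" by (simp only: sgn_1_neg)
  have nz: "y x \<noteq> 0" if "x \<in> {z-e..z+e}" for x using y_sgn[OF that] yz by (metis sgn_0_0)
  obtain z' where "{x \<in> {z-e..z+e}. w x = 0} = {z'}"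
    by (rule unique_zero_if_derivative_nonzero[OF _ D _ neg]) (use e nz in auto)
  moreover have "z \<in> {x \<in> {z-e..z+e}. w x = 0}" using z e by auto
  ultimately have "{x \<in> {z-e..z+e}. w x = 0} = {z}" by auto
  then show ?thesis using e nz neg by (intro that[of e]) auto
qed

text \<open>
  The number of zeros in \<open>]0,r]\<close> is stable under uniform convergence: an approximating solution has no
  zeros away from those of the limit, and exactly one near each of them, because it changes sign there
  while its derivative does not vanish.
\<close>

lemma zero_count_converges:
  assumes pos: "\<beta> > 0" "b > 0" "c > 0" "d \<ge> 0" and sol: "global_solution d \<beta> b c w y"
    and posn: "\<And>n. \<beta>s n > 0" "\<And>n. bs n > 0" "\<And>n. cs n > 0"
    and soln: "\<And>n. global_solution d (\<beta>s n) (bs n) (cs n) (W n) (Y n)"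
    and lim: "uniform_limit {0..R} W w sequentially" "uniform_limit {0..R} Y y sequentially"
    and r: "0 < r" "r \<le> R" "w r \<noteq> 0"
  shows "\<forall>\<^sub>F n in sequentially. card (zeros_upto (W n) r) = card (zeros_upto w r)"
  using r
proof (induction "card (zeros_upto w r)" arbitrary: r)
  case 0
  then have "zeros_upto w r = {}" using finite_zeros_upto[OF pos sol, of r] by simp
  moreover have "w 0 \<noteq> 0" using sol by (simp add: global_solution_def)
  ultimately have nz: "w x \<noteq> 0" if "x \<in> {0..r}" for x
    using that by (cases "x = 0") (auto simp: zeros_upto_def)
  have "\<forall>\<^sub>F n in sequentially. \<forall>x\<in>{0..r}. sgn (W n x) = sgn (w x)"
    by (rule eventually_same_sign[OF global_solution_D(1)[OF sol] nz uniform_limit_on_subset[OF lim(1)]])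
      (use 0 in auto)
  then show ?case
  proof eventually_elim
    case (elim n)
    have "W n x \<noteq> 0" if "x \<in> {0..r}" for x
      by (rule nonzero_if_sgn_eq[OF bspec[OF elim that] nz[OF that]])
    then have "zeros_upto (W n) r = {}" by (auto simp: zeros_upto_def)
    then show ?case using \<open>zeros_upto w r = {}\<close> by simp
  qed
next
  case (Suc m)
  \<comment> \<open>Split \<open>]0,r]\<close> at \<open>z - e\<close> and \<open>z + e\<close> around the last zero \<open>z\<close>.\<close>
  define z where "z = Max (zeros_upto w r)"
  have fin: "finite (zeros_upto w r)" by (rule finite_zeros_upto[OF pos sol])
  have "z \<in> zeros_upto w r" unfolding z_def by (rule Max_in[OF fin]) (use Suc.hyps(2) in auto)
  then have z: "z > 0" "z \<le> r" "w z = 0" by (auto simp: zeros_upto_def)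
  have z_max: "x \<le> z" if "x \<in> zeros_upto w r" for x unfolding z_def by (rule Max_ge[OF fin that])
  have "z < r" using z \<open>w r \<noteq> 0\<close> by (cases "z = r") auto
  obtain e where e: "0 < e" "e < r - z" "e < z" "\<And>x. x \<in> {z-e..z+e} \<Longrightarrow> y x \<noteq> 0"
    and sign: "w (z - e) * w (z + e) < 0" and only: "{x \<in> {z-e..z+e}. w x = 0} = {z}"
    by (rule isolate_simple_zero[OF pos sol z(1,3), of "r - z"]) (use \<open>z < r\<close> in auto)
  have w_ne: "w (z - e) \<noteq> 0" "w (z + e) \<noteq> 0" using sign by auto
  have "zeros_upto w r = insert z (zeros_upto w (z - e))"
  proof -
    have "x = z" if "x \<in> zeros_upto w r" "\<not> x \<le> z - e" for x
    proof -
      have "x \<in> {x \<in> {z-e..z+e}. w x = 0}" using that z_max[OF that(1)] e by (auto simp: zeros_upto_def)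
      then show ?thesis using only by blast
    qed
    then show ?thesis using z e by (auto simp: zeros_upto_def)
  qed
  moreover have "z \<notin> zeros_upto w (z - e)" using e by (auto simp: zeros_upto_def)
  ultimately have m: "m = card (zeros_upto w (z - e))"
    using Suc.hyps(2) finite_zeros_upto[OF pos sol, of "z - e"] by simp
  have IH: "\<forall>\<^sub>F n in sequentially. card (zeros_upto (W n) (z - e)) = card (zeros_upto w (z - e))"
    by (rule Suc.hyps(1)[OF m]) (use e z w_ne Suc.prems in auto)
  have cw: "continuous_on {p..q} w" and cy: "continuous_on {p..q} y" if "0 \<le> p" for p q
    by (rule continuous_on_subset[OF global_solution_D(1)[OF sol, of q]]
        continuous_on_subset[OF global_solution_D(2)[OF sol, of q]]; use that in auto)+
  have w_right: "w x \<noteq> 0" if "x \<in> {z+e..r}" for x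
    using z_max[of x] that e z by (auto simp: zeros_upto_def)
  have evW: "\<forall>\<^sub>F n in sequentially. \<forall>x\<in>{p..q}. sgn (W n x) = sgn (w x)"
    if "0 \<le> p" "q \<le> r" "\<And>x. x \<in> {p..q} \<Longrightarrow> w x \<noteq> 0" for p q
    by (rule eventually_same_sign[OF cw that(3) uniform_limit_on_subset[OF lim(1)]])
      (use that Suc.prems in auto)
  have ev1: "\<forall>\<^sub>F n in sequentially. \<forall>x\<in>{z+e..r}. sgn (W n x) = sgn (w x)"
    by (rule evW) (use e z w_right in auto)
  have ev2: "\<forall>\<^sub>F n in sequentially. \<forall>x\<in>{z-e..z-e}. sgn (W n x) = sgn (w x)"
    by (rule evW) (use e z w_ne in auto)
  have ev3: "\<forall>\<^sub>F n in sequentially. \<forall>x\<in>{z-e..z+e}. sgn (Y n x) = sgn (y x)"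
    by (rule eventually_same_sign[OF cy e(4) uniform_limit_on_subset[OF lim(2)]])
      (use e z Suc.prems in auto)
  show ?case using IH ev1 ev2 ev3
  proof eventually_elim
    case (elim n)
    have Wn_right: "W n x \<noteq> 0" if "x \<in> {z+e..r}" for x
      by (rule nonzero_if_sgn_eq[OF bspec[OF elim(2) that] w_right[OF that]])
    have right: "x < z + e" if "x \<in> zeros_upto (W n) r" for x
    proof (rule ccontr)
      assume "\<not> x < z + e"
      then have "W n x \<noteq> 0" using that by (intro Wn_right) (auto simp: zeros_upto_def)
      then show False using that by (simp add: zeros_upto_def)
    qed
    have sgns: "sgn (W n (z - e)) = sgn (w (z - e))" "sgn (W n (z + e)) = sgn (w (z + e))"
      by (rule bspec[OF elim(3)] bspec[OF elim(2)]; use e in simp)+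
    have "sgn (W n (z - e) * W n (z + e)) = sgn (w (z - e) * w (z + e))"
      unfolding sgn_mult sgns ..
    also have "\<dots> = - 1" using sign by simp
    finally have "W n (z - e) * W n (z + e) < 0" by (simp add: sgn_1_neg)
    moreover have "spow (1 / \<beta>s n) (Y n x) \<noteq> 0" if "x \<in> {z-e..z+e}" for x
      unfolding spow_eq_0_iff by (rule nonzero_if_sgn_eq[OF bspec[OF elim(4) that] e(4)[OF that]])
    ultimately obtain z' where z': "{x \<in> {z-e..z+e}. W n x = 0} = {z'}"
      using unique_zero_if_derivative_nonzero[of "z - e" "z + e" "W n" "\<lambda>x. spow (1 / \<beta>s n) (Y n x)"]
        global_solution_D(3)[OF soln[of n]] e by auto
    then have z'2: "z' \<in> {z-e..z+e}" "W n z' = 0" by blast+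
    have "W n (z - e) \<noteq> 0" using \<open>W n (z - e) * W n (z + e) < 0\<close> by auto
    then have "z' \<noteq> z - e" using z'2 by auto
    then have "z' \<notin> zeros_upto (W n) (z - e)" using z'2 by (auto simp: zeros_upto_def)
    moreover have "zeros_upto (W n) r = insert z' (zeros_upto (W n) (z - e))"
    proof -
      have "x = z'" if "x \<in> zeros_upto (W n) r" "\<not> x \<le> z - e" for x
      proof -
        have "x \<in> {x \<in> {z-e..z+e}. W n x = 0}" using that right[OF that(1)] by (auto simp: zeros_upto_def)
        then show ?thesis using z' by blast
      qed
      moreover have "z' \<in> zeros_upto (W n) r" using z'2 e by (auto simp: zeros_upto_def)
      moreover have "zeros_upto (W n) (z - e) \<subseteq> zeros_upto (W n) r" using e z by (auto simp: zeros_upto_def)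
      moreover have "x \<in> zeros_upto (W n) (z - e)" if "x \<in> zeros_upto (W n) r" "x \<le> z - e" for x
        using that by (auto simp: zeros_upto_def)
      ultimately show ?thesis by blast
    qed
    ultimately have "card (zeros_upto (W n) r) = Suc (card (zeros_upto (W n) (z - e)))"
      using finite_zeros_upto[OF posn pos(4) soln, of n "z - e"] by simp
    then show ?case using elim(1) m Suc.hyps(2) by simp
  qed
qed

text \<open>
  The counting function of the limit jumps from below \<open>k\<close> to \<open>k\<close> between \<open>z - e\<close> and \<open>z + e\<close>. By stability the
  counting functions of the approximating solutions do so too.
\<close>

lemma kth_positive_zero_converges:
  assumes pos: "\<beta> > 0" "b > 0" "c > 0" "d \<ge> 0" and sol: "global_solution d \<beta> b c w y"
    and posn: "\<And>n. \<beta>s n > 0" "\<And>n. bs n > 0" "\<And>n. cs n > 0"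
    and soln: "\<And>n. global_solution d (\<beta>s n) (bs n) (cs n) (W n) (Y n)" and "k \<ge> 1"
    and R: "R = kth_positive_zero w k + 1"
    and lim: "uniform_limit {0..R} W w sequentially" "uniform_limit {0..R} Y y sequentially"
  shows "(\<lambda>n. kth_positive_zero (W n) k) \<longlonglongrightarrow> kth_positive_zero w k"
proof (rule LIMSEQ_I)
  fix \<epsilon> :: real assume "\<epsilon> > 0"
  define z where "z = kth_positive_zero w k"
  have z: "z > 0" "w z = 0" "card (zeros_upto w z) = k"
    using kth_positive_zero_properties[OF pos sol \<open>k \<ge> 1\<close>] by (auto simp: z_def)
  have "min \<epsilon> 1 > 0" using \<open>\<epsilon> > 0\<close> by simp
  then obtain e where e: "0 < e" "e < min \<epsilon> 1" "e < z" and sign: "w (z - e) * w (z + e) < 0"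
    and only: "{x \<in> {z-e..z+e}. w x = 0} = {z}"
    by (rule isolate_simple_zero[OF pos sol z(1,2)])
  have w_ne: "w (z - e) \<noteq> 0" "w (z + e) \<noteq> 0" using sign by auto
  have only': "x = z" if "x \<in> {z-e..z+e}" "w x = 0" for x using only that by blast
  have near: "x \<le> z - e \<or> x = z" if "0 < x" "x \<le> z + e" "w x = 0" for x
  proof (cases "x \<le> z - e")
    case False
    then have "x = z" using that by (intro only') auto
    then show ?thesis ..
  qed simp
  have "x \<le> z" if "0 < x" "x \<le> z + e" "w x = 0" for x using near[OF that] e by auto
  then have "zeros_upto w (z + e) = zeros_upto w z"
    using e by (auto simp: zeros_upto_def)
  then have card2: "card (zeros_upto w (z + e)) = k" using z by simp
  have "x \<le> z - e \<or> x = z" if "0 < x" "x \<le> z" "w x = 0" for x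
    using near[OF that(1) _ that(3)] that(2) e by auto
  then have "zeros_upto w z = insert z (zeros_upto w (z - e))"
    using e z by (auto simp: zeros_upto_def)
  moreover have "z \<notin> zeros_upto w (z - e)" using e by (auto simp: zeros_upto_def)
  ultimately have card1: "card (zeros_upto w (z - e)) < k"
    using z finite_zeros_upto[OF pos sol, of "z - e"] by auto
  note conv = zero_count_converges[OF pos sol posn soln lim]
  have "\<forall>\<^sub>F n in sequentially. card (zeros_upto (W n) (z - e)) = card (zeros_upto w (z - e))"
    by (rule conv) (use e w_ne R z_def in auto)
  moreover have "\<forall>\<^sub>F n in sequentially. card (zeros_upto (W n) (z + e)) = card (zeros_upto w (z + e))"
    by (rule conv) (use e w_ne R z_def in auto)
  ultimately have "\<forall>\<^sub>F n in sequentially. norm (kth_positive_zero (W n) k - kth_positive_zero w k) < \<epsilon>"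
  proof eventually_elim
    case (elim n)
    define z' where "z' = kth_positive_zero (W n) k"
    have z': "z' > 0" "W n z' = 0" "card (zeros_upto (W n) z') = k"
      using kth_positive_zero_properties[OF posn pos(4) soln \<open>k \<ge> 1\<close>] by (auto simp: z'_def)
    have fin: "finite (zeros_upto (W n) x)" for x by (rule finite_zeros_upto[OF posn pos(4) soln])
    have "z - e < z'"
    proof (rule ccontr)
      assume "\<not> z - e < z'"
      then have "zeros_upto (W n) z' \<subseteq> zeros_upto (W n) (z - e)" by (auto simp: zeros_upto_def)
      from card_mono[OF fin this] show False using elim(1) card1 z'(3) by simp
    qed
    moreover have "z' \<le> z + e"
    proof (rule ccontr)
      assume "\<not> z' \<le> z + e"
      then have "zeros_upto (W n) (z + e) \<subset> zeros_upto (W n) z'"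
        using z' by (auto simp: zeros_upto_def psubset_eq)
      from psubset_card_mono[OF fin this] show False using elim(2) card2 z'(3) by simp
    qed
    ultimately show ?case using e by (auto simp: z'_def z_def)
  qed
  then show "\<exists>no. \<forall>n\<ge>no. norm (kth_positive_zero (W n) k - kth_positive_zero w k) < \<epsilon>"
    by (simp add: eventually_sequentially)
qed

section \<open>Continuous dependence on the parameters\<close>

lemma abs_powr_le_max_powr:
  fixes x D p q :: real
  assumes "\<bar>x\<bar> \<le> D" "0 \<le> p" "p \<le> q"
  shows "\<bar>x\<bar> powr p \<le> (max 1 D) powr q"
proof -
  have "\<bar>x\<bar> powr p \<le> (max 1 D) powr p" using assms by (intro powr_mono2) auto
  also have "\<dots> \<le> (max 1 D) powr q" using assms by (intro powr_mono) auto
  finally show ?thesis .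
qed

text \<open>
  The bounds for solutions depend on the parameters only through \<open>L\<close>, so a sequence of solutions is
  equicontinuous together with the functions \<open>y\<close>. The limit of a convergent subsequence solves the limit
  equation, and by uniqueness it is the solution in question.
\<close>

lemma solutions_subsequence_converges:
  assumes pos: "\<beta> > 0" "b > 0" "c > 0" "d \<ge> 0" and sol: "global_solution d \<beta> b c w y" and "R > 0"
    and posn: "\<And>n. \<beta>s n > 0" "\<And>n. bs n > 0" "\<And>n. cs n > 0"
    and soln: "\<And>n. global_solution d (\<beta>s n) (bs n) (cs n) (W n) (Y n)"
    and conv: "\<beta>s \<longlonglongrightarrow> \<beta>" "bs \<longlonglongrightarrow> b" "cs \<longlonglongrightarrow> c"
  obtains k :: "nat \<Rightarrow> nat" where "strict_mono k" "uniform_limit {0..R} (\<lambda>n. W (k n)) w sequentially"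
    "uniform_limit {0..R} (\<lambda>n. Y (k n)) y sequentially"
proof -
  have bound: "\<exists>B. \<forall>n. \<bar>x n\<bar> \<le> B" if "x \<longlonglongrightarrow> l" for x :: "nat \<Rightarrow> real" and l
    using convergent_imp_Bseq[OF convergentI[OF that]] by (auto simp: Bseq_def)
  have inv: "(\<lambda>n. 1 / x n) \<longlonglongrightarrow> 1 / l" if "x \<longlonglongrightarrow> l" "l > 0" for x :: "nat \<Rightarrow> real" and l
    using that by (intro tendsto_intros) auto
  obtain B1 B2 B3 B4 B5 B6 where B: "\<And>n. \<bar>\<beta>s n\<bar> \<le> B1" "\<And>n. \<bar>bs n\<bar> \<le> B2" "\<And>n. \<bar>cs n\<bar> \<le> B3"
    "\<And>n. \<bar>1 / \<beta>s n\<bar> \<le> B4" "\<And>n. \<bar>1 / bs n\<bar> \<le> B5" "\<And>n. \<bar>1 / cs n\<bar> \<le> B6"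
    using bound[OF conv(1)] bound[OF conv(2)] bound[OF conv(3)] bound[OF inv[OF conv(1) pos(1)]]
      bound[OF inv[OF conv(2) pos(2)]] bound[OF inv[OF conv(3) pos(3)]] by blast
  \<comment> \<open>A common bound for the parameters and their inverses, which controls all constants below.\<close>
  define L where "L = Max {4, B1, B2, B3, B4, B5, B6}"
  have LB: "4 \<le> L" "B1 \<le> L" "B2 \<le> L" "B3 \<le> L" "B4 \<le> L" "B5 \<le> L" "B6 \<le> L"
    unfolding L_def by (rule Max_ge; simp)+
  have L: "\<beta>s n \<le> L" "bs n \<le> L" "cs n \<le> L" "1 / \<beta>s n \<le> L" "1 / bs n \<le> L" "1 / cs n \<le> L" for n
    using order_trans[OF abs_ge_self order_trans[OF B(1) LB(2)]] order_trans[OF abs_ge_self order_trans[OF B(2) LB(3)]]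
      order_trans[OF abs_ge_self order_trans[OF B(3) LB(4)]] order_trans[OF abs_ge_self order_trans[OF B(4) LB(5)]]
      order_trans[OF abs_ge_self order_trans[OF B(5) LB(6)]] order_trans[OF abs_ge_self order_trans[OF B(6) LB(7)]]
    by simp_all
  have L': "1 \<le> L * bs n" "1 \<le> L * cs n" for n
    using L(5,6)[of n] posn[of n] by (auto simp: field_simps)
  define K where "K = 2 * exp (L * R)"
  have "exp (L * R) \<ge> 1" using LB(1) \<open>R > 0\<close> by simp
  then have "K \<ge> 1" unfolding K_def by linarith
  define D where "D = L * L * K powr L"
  have "D \<ge> 0" using LB by (simp add: D_def)
  have Wb: "\<bar>W n r\<bar> \<le> K" and Yb: "\<bar>Y n r\<bar> \<le> D * r" if r: "r \<in> {0..R}" for n r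
  proof -
    note bounds = global_solution_bounds[OF posn pos(4) soln LB(1) L' r \<open>R > 0\<close>, folded K_def]
    show "\<bar>W n r\<bar> \<le> K" by (rule bounds)
    have "\<beta>s n * L * K powr \<beta>s n \<le> D"
      unfolding D_def using L[of n] LB posn[of n] \<open>K \<ge> 1\<close> by (intro mult_mono powr_mono) auto
    then have "\<beta>s n * L * K powr \<beta>s n * r \<le> D * r" using r by (intro mult_right_mono) auto
    then show "\<bar>Y n r\<bar> \<le> D * r" using bounds(2)[of n] by linarith
  qed
  define M1 where "M1 = (max 1 (D * R)) powr L"
  define M2 where "M2 = L * (2 * L) * (K powr L + d * (2 * L) * D)"
  have W': "\<bar>spow (1 / \<beta>s n) (Y n r)\<bar> \<le> M1" if "r \<in> {0<..<R}" for n r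
  proof -
    have "D * r \<le> D * R" using that \<open>D \<ge> 0\<close> by (intro mult_left_mono) auto
    then have "\<bar>Y n r\<bar> \<le> D * R" using Yb[of r n] that by auto
    then show ?thesis unfolding abs_spow M1_def
      using posn[of n] L(4)[of n] by (intro abs_powr_le_max_powr) auto
  qed
  have Y': "\<bar>radial_rhs d (\<beta>s n) (bs n) (cs n) r (W n r) (Y n r)\<bar> \<le> M2" if r: "r \<in> {0<..<R}" for n r
  proof -
    have "\<bar>radial_rhs d (\<beta>s n) (bs n) (cs n) r (W n r) (Y n r)\<bar>
        \<le> \<beta>s n * (1 / bs n + 1 / cs n) * (\<bar>W n r\<bar> powr \<beta>s n + d / r * (bs n + cs n) * \<bar>Y n r\<bar>)"
      by (rule abs_radial_rhs_le) (use posn pos r in auto)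
    also have "\<dots> \<le> M2"
      unfolding M2_def
    proof (rule mult_mono)
      have "1 / bs n + 1 / cs n \<le> 2 * L" using L(5,6)[of n] by simp
      then show "\<beta>s n * (1 / bs n + 1 / cs n) \<le> L * (2 * L)"
        using L(1)[of n] posn[of n] LB by (intro mult_mono) auto
      have "\<bar>W n r\<bar> powr \<beta>s n \<le> K powr L"
        using abs_powr_le_max_powr[of "W n r" K "\<beta>s n" L] Wb[of r n] r posn[of n] L(1)[of n] \<open>K \<ge> 1\<close> by simp
      moreover have "d / r * (bs n + cs n) * \<bar>Y n r\<bar> \<le> d / r * (2 * L) * (D * r)"
        using Yb[of r n] r L[of n] posn[of n] LB pos \<open>D \<ge> 0\<close> by (intro mult_mono) auto
      moreover have "d / r * (2 * L) * (D * r) = d * (2 * L) * D" using r by simp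
      ultimately show "\<bar>W n r\<bar> powr \<beta>s n + d / r * (bs n + cs n) * \<bar>Y n r\<bar> \<le> K powr L + d * (2 * L) * D"
        by linarith
      show "0 \<le> \<bar>W n r\<bar> powr \<beta>s n + d / r * (bs n + cs n) * \<bar>Y n r\<bar>"
        using pos posn[of n] r by (intro add_nonneg_nonneg mult_nonneg_nonneg) auto
      show "0 \<le> L * (2 * L)" by simp
    qed
    finally show ?thesis .
  qed
  define M where "M = max M1 M2"
  have LW: "\<bar>W n s - W n t\<bar> \<le> M * \<bar>s - t\<bar>" if "s \<in> {0..R}" "t \<in> {0..R}" for n s t
  proof (rule Lipschitz_if_bounded_derivative[OF global_solution_D(1)[OF soln] global_solution_D(3)[OF soln] _ that])
    show "\<bar>spow (1 / \<beta>s n) (Y n r)\<bar> \<le> M" if "r \<in> {0<..<R}" for r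
      using W'[OF that, of n] by (simp add: M_def)
  qed auto
  have LY: "\<bar>Y n s - Y n t\<bar> \<le> M * \<bar>s - t\<bar>" if "s \<in> {0..R}" "t \<in> {0..R}" for n s t
  proof (rule Lipschitz_if_bounded_derivative[OF global_solution_D(2)[OF soln] global_solution_D(4)[OF soln] _ that])
    show "\<bar>radial_rhs d (\<beta>s n) (bs n) (cs n) r (W n r) (Y n r)\<bar> \<le> M" if "r \<in> {0<..<R}" for r
      using Y'[OF that, of n] by (simp add: M_def)
  qed auto
  have init: "W n 0 = 1" "Y n 0 = 0" for n using soln[of n] by (auto simp: global_solution_def)
  obtain k w' y' where k: "strict_mono (k :: nat \<Rightarrow> nat)"
    and cw': "continuous_on {0..R} w'" and cy': "continuous_on {0..R} y'"
    and lim: "uniform_limit {0..R} (\<lambda>n. W (k n)) w' sequentially" "uniform_limit {0..R} (\<lambda>n. Y (k n)) y' sequentially"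
    by (rule Arzela_Ascoli_pair[of R W M Y 1]) (use LW LY init in auto)
  have limW: "(\<lambda>n. W (k n) t) \<longlonglongrightarrow> w' t" and limY: "(\<lambda>n. Y (k n) t) \<longlonglongrightarrow> y' t" if "t \<in> {0..R}" for t
    using tendsto_uniform_limitI[OF lim(1) that] tendsto_uniform_limitI[OF lim(2) that] by auto
  note convk = conv[THEN LIMSEQ_subseq_LIMSEQ, OF k, unfolded o_def]
  have "radial_system d \<beta> b c 0 R w' y'"
    unfolding radial_system_def
  proof (intro conjI ballI cw' cy')
    fix r assume r: "r \<in> {0<..<R}"
    show "(w' has_real_derivative spow (1/\<beta>) (y' r)) (at r)"
    proof (rule DERIV_limit[of 0 R "\<lambda>n. W (k n)" "\<lambda>n t. spow (1 / \<beta>s (k n)) (Y (k n) t)" M1])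
      show "(\<lambda>n. spow (1 / \<beta>s (k n)) (Y (k n) t)) \<longlonglongrightarrow> spow (1/\<beta>) (y' t)" if "t \<in> {0<..<R}" for t
        using that pos by (intro tendsto_spow limY inv[OF convk(1)]) auto
      show "continuous_on {0<..<R} (\<lambda>t. spow (1/\<beta>) (y' t))"
        using pos by (intro continuous_intros continuous_on_subset[OF cy']) auto
    qed (use global_solution_D(3)[OF soln] W' limW r in auto)
    show "(y' has_real_derivative radial_rhs d \<beta> b c r (w' r) (y' r)) (at r)"
    proof (rule DERIV_limit[of 0 R "\<lambda>n. Y (k n)"
          "\<lambda>n t. radial_rhs d (\<beta>s (k n)) (bs (k n)) (cs (k n)) t (W (k n) t) (Y (k n) t)" M2])
      show "(\<lambda>n. radial_rhs d (\<beta>s (k n)) (bs (k n)) (cs (k n)) t (W (k n) t) (Y (k n) t))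
          \<longlonglongrightarrow> radial_rhs d \<beta> b c t (w' t) (y' t)" if "t \<in> {0<..<R}" for t
      proof -
        have "(\<lambda>n. spow (\<beta>s (k n)) (W (k n) t)) \<longlonglongrightarrow> spow \<beta> (w' t)"
          using that pos by (intro tendsto_spow limW convk(1)) auto
        moreover have "(\<lambda>n. Y (k n) t) \<longlonglongrightarrow> y' t" using that by (intro limY) auto
        moreover note inv[OF convk(2) pos(2)] inv[OF convk(3) pos(3)] convk
        ultimately show ?thesis unfolding radial_rhs_def
          by (intro tendsto_mult tendsto_pl tendsto_diff tendsto_minus tendsto_const)
      qed
      show "continuous_on {0<..<R} (\<lambda>t. radial_rhs d \<beta> b c t (w' t) (y' t))"
        using pos by (intro radial_rhs_continuous_on continuous_on_subset[OF cw'] continuous_on_subset[OF cy']) auto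
    qed (use global_solution_D(4)[OF soln] Y' limY r in auto)
  qed
  moreover have "w' 0 = 1" "y' 0 = 0"
    using limW[of 0] limY[of 0] \<open>R > 0\<close> by (simp_all add: init LIMSEQ_const_iff)
  ultimately have eq: "w' r = w r \<and> y' r = y r" if "r \<in> {0..R}" for r
    using sol that by (intro radial_system_unique[of d \<beta> b c R w' y' w y r] pos)
      (auto simp: global_solution_def)
  have "uniform_limit {0..R} (\<lambda>n. W (k n)) w sequentially \<longleftrightarrow> uniform_limit {0..R} (\<lambda>n. W (k n)) w' sequentially"
    by (rule uniform_limit_cong') (use eq in auto)
  moreover have "uniform_limit {0..R} (\<lambda>n. Y (k n)) y sequentially \<longleftrightarrow> uniform_limit {0..R} (\<lambda>n. Y (k n)) y' sequentially"
    by (rule uniform_limit_cong') (use eq in auto)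
  ultimately show ?thesis using that[OF k] lim by blast
qed

lemma LIMSEQ_if_subsequences_have_convergent_subsequences:
  fixes x :: "nat \<Rightarrow> real"
  assumes "\<And>s :: nat \<Rightarrow> nat. strict_mono s \<Longrightarrow> \<exists>t. strict_mono t \<and> (\<lambda>n. x (s (t n))) \<longlonglongrightarrow> l"
  shows "x \<longlonglongrightarrow> l"
proof (rule ccontr)
  assume "\<not> x \<longlonglongrightarrow> l"
  then obtain e where "e > 0" and e: "\<And>N. \<exists>n\<ge>N. \<not> norm (x n - l) < e"
    unfolding LIMSEQ_iff by blast
  then have "infinite {n. \<not> norm (x n - l) < e}" by (auto simp: infinite_nat_iff_unbounded_le)
  then obtain s :: "nat \<Rightarrow> nat" where s: "strict_mono s" "\<And>n. s n \<in> {n. \<not> norm (x n - l) < e}"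
    using infinite_enumerate by blast
  obtain t where "(\<lambda>n. x (s (t n))) \<longlonglongrightarrow> l" using assms[OF s(1)] by blast
  then obtain N where "\<forall>n\<ge>N. norm (x (s (t n)) - l) < e" using \<open>e > 0\<close> by (meson LIMSEQ_D)
  then show False using s(2)[of "t N"] by auto
qed

lemma kth_positive_zero_continuous:
  assumes pos: "\<beta> > 0" "b > 0" "c > 0" "d \<ge> 0" and sol: "global_solution d \<beta> b c w y" and "k \<ge> 1"
    and posn: "\<And>n. \<beta>s n > 0" "\<And>n. bs n > 0" "\<And>n. cs n > 0"
    and soln: "\<And>n. global_solution d (\<beta>s n) (bs n) (cs n) (W n) (Y n)"
    and conv: "\<beta>s \<longlonglongrightarrow> \<beta>" "bs \<longlonglongrightarrow> b" "cs \<longlonglongrightarrow> c"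
  shows "(\<lambda>n. kth_positive_zero (W n) k) \<longlonglongrightarrow> kth_positive_zero w k"
proof (rule LIMSEQ_if_subsequences_have_convergent_subsequences)
  fix s :: "nat \<Rightarrow> nat" assume "strict_mono s"
  note convs = conv[THEN LIMSEQ_subseq_LIMSEQ, OF \<open>strict_mono s\<close>, unfolded o_def]
  define R where "R = kth_positive_zero w k + 1"
  have "R > 0" using kth_positive_zero_properties(1)[OF pos sol \<open>k \<ge> 1\<close>] by (simp add: R_def)
  obtain t :: "nat \<Rightarrow> nat" where t: "strict_mono t"
    and lim: "uniform_limit {0..R} (\<lambda>n. W (s (t n))) w sequentially"
      "uniform_limit {0..R} (\<lambda>n. Y (s (t n))) y sequentially"
    by (rule solutions_subsequence_converges[where \<beta>s="\<lambda>n. \<beta>s (s n)" and bs="\<lambda>n. bs (s n)" and cs="\<lambda>n. cs (s n)"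
          and W="\<lambda>n. W (s n)" and Y="\<lambda>n. Y (s n)", OF pos sol \<open>R > 0\<close> posn soln convs])
  have "(\<lambda>n. kth_positive_zero (W (s (t n))) k) \<longlonglongrightarrow> kth_positive_zero w k"
    by (rule kth_positive_zero_converges[where \<beta>s="\<lambda>n. \<beta>s (s (t n))" and bs="\<lambda>n. bs (s (t n))"
          and cs="\<lambda>n. cs (s (t n))", OF pos sol posn soln \<open>k \<ge> 1\<close> R_def lim])
  then show "\<exists>t. strict_mono t \<and> (\<lambda>n. kth_positive_zero (W (s (t n))) k) \<longlonglongrightarrow> kth_positive_zero w k"
    using t by blast
qed

section \<open>The eigenvalues\<close>

text \<open>
  The description of the solution by \<open>THE\<close> is justified by uniqueness for the system: every radial solution
  comes from a solution of the system with the same initial values.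
\<close>

lemma the_radial_solution_eq:
  assumes par: "\<alpha> > -1" "a > 0" "A > 0" and "N \<ge> 1"
    and sys: "\<And>h. radial_system (real N - 1) (1 + \<alpha>) A a 0 h w y" and init: "w 0 = s" "y 0 = 0" "s \<noteq> 0"
    and "r \<ge> 0"
  shows "the_radial_solution N A \<alpha> a s r = w r"
proof -
  define v where "v = restrict w {0..}"
  have pos: "1 + \<alpha> > 0" "A > 0" "a > 0" "real N - 1 \<ge> 0" using par \<open>N \<ge> 1\<close> by auto
  have rad: "radial_solution N A \<alpha> a s v"
  proof (rule radial_system_imp_radial_solution[OF par])
    show "radial_system (real N - 1) (1 + \<alpha>) A a 0 h v y" for h
      by (rule radial_system_cong[OF sys]) (auto simp: v_def)
  qed (use init in \<open>auto simp: v_def\<close>)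
  have ext: "v \<in> extensional {0..}" by (simp add: v_def)
  have uniq: "u = v" if u: "u \<in> extensional {0..}" "radial_solution N A \<alpha> a s u" for u
  proof -
    obtain y' where sys': "\<And>h. radial_system (real N - 1) (1 + \<alpha>) A a 0 h u y'" "u 0 = s" "y' 0 = 0"
      using radial_solution_imp_radial_system[OF par u(2)] by blast
    show ?thesis
    proof (rule extensionalityI[OF u(1) ext])
      fix x :: real assume "x \<in> {0..}"
      have "u x = w x \<and> y' x = y x"
        by (rule radial_system_unique[OF sys'(1)[of x] sys[of x] pos]) (use sys' init \<open>x \<in> {0..}\<close> in simp_all)
      then show "u x = v x" using \<open>x \<in> {0..}\<close> by (simp add: v_def)
    qed
  qed
  have "the_radial_solution N A \<alpha> a s = v"
    unfolding the_radial_solution_def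
    by (rule the_equality[where P = "\<lambda>w. w \<in> extensional {0..} \<and> radial_solution N A \<alpha> a s w", OF conjI[OF ext rad]])
      (elim conjE, rule uniq)
  then show ?thesis using \<open>r \<ge> 0\<close> by (simp add: v_def)
qed

lemma kth_positive_zero_cong:
  assumes "\<And>r. r > 0 \<Longrightarrow> u r = 0 \<longleftrightarrow> w r = 0"
  shows "kth_positive_zero u k = kth_positive_zero w k"
proof -
  have "{r. 0 < r \<and> r \<le> b \<and> u r = 0} = {r. 0 < r \<and> r \<le> b \<and> w r = 0}" for b using assms by auto
  moreover have "b > 0 \<and> u b = 0 \<longleftrightarrow> b > 0 \<and> w b = 0" for b using assms by auto
  ultimately show ?thesis unfolding kth_positive_zero_def by (simp only: conj_assoc[symmetric])
qed

text \<open>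
  Both families of eigenvalues come from zeros of solutions starting from \<open>1\<close>: the negative of \<open>w\<^sup>-\<close> solves
  the equation with the two coefficients exchanged.
\<close>

lemma mu_plus_eq:
  assumes "\<alpha> > -1" "a > 0" "A > 0" "N \<ge> 1" and sol: "global_solution (real N - 1) (1 + \<alpha>) A a w y"
  shows "mu_plus N A k \<alpha> a = kth_positive_zero w k powr (\<alpha> + 2)"
proof -
  have sys: "radial_system (real N - 1) (1 + \<alpha>) A a 0 h w y" for h
    using sol by (simp add: global_solution_def)
  have "w_plus N A \<alpha> a r = w r" if "r > 0" for r
    unfolding w_plus_def
    by (rule the_radial_solution_eq[OF assms(1-4) sys])
      (use sol that in \<open>simp_all add: global_solution_def\<close>)
  then have "kth_positive_zero (w_plus N A \<alpha> a) k = kth_positive_zero w k"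
    by (intro kth_positive_zero_cong) simp
  then show ?thesis unfolding mu_plus_def by simp
qed

lemma mu_minus_eq:
  assumes "\<alpha> > -1" "a > 0" "A > 0" "N \<ge> 1" and sol: "global_solution (real N - 1) (1 + \<alpha>) a A w y"
  shows "mu_minus N A k \<alpha> a = kth_positive_zero w k powr (\<alpha> + 2)"
proof -
  have sys: "radial_system (real N - 1) (1 + \<alpha>) a A 0 h w y" for h
    using sol by (simp add: global_solution_def)
  have "w_minus N A \<alpha> a r = - w r" if "r > 0" for r
    unfolding w_minus_def
    by (rule the_radial_solution_eq[OF assms(1-4) radial_system_minus[OF sys]])
      (use sol that in \<open>simp_all add: global_solution_def\<close>)
  then have "kth_positive_zero (w_minus N A \<alpha> a) k = kth_positive_zero w k"
    by (intro kth_positive_zero_cong) simp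
  then show ?thesis unfolding mu_minus_def by simp
qed

theorem proposition6p4:
  fixes N k :: nat and A M \<alpha> a :: real and \<alpha>_seq a_seq :: "nat \<Rightarrow> real"
  assumes "N \<ge> 1" and "A > 0" and "M > 0" and "k \<ge> 1"
    and "\<And>n. \<alpha>_seq n > -1" and "\<And>n. a_seq n \<in> {0<..A}"
    and "(\<alpha>, a) \<in> {-1<..<M} \<times> {0<..A}"
    and "(\<lambda>n. (\<alpha>_seq n, a_seq n)) \<longlonglongrightarrow> (\<alpha>, a)"
  shows "(\<lambda>n. mu_plus N A k (\<alpha>_seq n) (a_seq n)) \<longlonglongrightarrow> mu_plus N A k \<alpha> a \<and>
         (\<lambda>n. mu_minus N A k (\<alpha>_seq n) (a_seq n)) \<longlonglongrightarrow> mu_minus N A k \<alpha> a"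
proof -
  have lim\<alpha>: "\<alpha>_seq \<longlonglongrightarrow> \<alpha>" and lima: "a_seq \<longlonglongrightarrow> a"
    using tendsto_fst[OF assms(8)] tendsto_snd[OF assms(8)] by simp_all
  have \<alpha>: "\<alpha> > -1" and a: "a > 0" using assms(7) by auto
  have an: "a_seq n > 0" for n using assms(6)[of n] by simp
  have d: "real N - 1 \<ge> 0" using assms(1) by simp
  have \<beta>: "1 + \<alpha> > 0" "1 + \<alpha>_seq n > 0" for n using \<alpha> assms(5)[of n] by auto
  have lim\<beta>: "(\<lambda>n. 1 + \<alpha>_seq n) \<longlonglongrightarrow> 1 + \<alpha>" by (intro tendsto_intros lim\<alpha>)
  have limpow: "(\<lambda>n. z n powr (\<alpha>_seq n + 2)) \<longlonglongrightarrow> z0 powr (\<alpha> + 2)"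
    if "z \<longlonglongrightarrow> z0" "z0 > 0" for z :: "nat \<Rightarrow> real" and z0
    using that by (intro tendsto_intros lim\<alpha>) auto
  have zeros: "(\<lambda>n. kth_positive_zero (W n) k powr (\<alpha>_seq n + 2)) \<longlonglongrightarrow> kth_positive_zero w k powr (\<alpha> + 2)"
    if "b > 0" "c > 0" "\<And>n. bs n > 0" "\<And>n. cs n > 0" "bs \<longlonglongrightarrow> b" "cs \<longlonglongrightarrow> c"
      and sol: "global_solution (real N - 1) (1 + \<alpha>) b c w y"
      and soln: "\<And>n. global_solution (real N - 1) (1 + \<alpha>_seq n) (bs n) (cs n) (W n) (Y n)"
    for b c bs cs w y W Y
  proof (rule limpow)
    show "(\<lambda>n. kth_positive_zero (W n) k) \<longlonglongrightarrow> kth_positive_zero w k"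
      by (rule kth_positive_zero_continuous[OF \<beta>(1) that(1,2) d sol assms(4) \<beta>(2) that(3,4) soln lim\<beta> that(5,6)])
    show "kth_positive_zero w k > 0"
      by (rule kth_positive_zero_properties(1)[OF \<beta>(1) that(1,2) d sol assms(4)])
  qed
  have ex: "\<exists>w y. global_solution (real N - 1) \<beta> b c w y" if "\<beta> > 0" "b > 0" "c > 0" for \<beta> b c
    by (rule global_solution_exists[OF that d]) (intro exI)
  obtain w y where wy: "global_solution (real N - 1) (1 + \<alpha>) A a w y"
    using ex[OF \<beta>(1) assms(2) a] by (elim exE)
  obtain u v where uv: "global_solution (real N - 1) (1 + \<alpha>) a A u v"
    using ex[OF \<beta>(1) a assms(2)] by (elim exE)
  have "\<forall>n. \<exists>w y. global_solution (real N - 1) (1 + \<alpha>_seq n) A (a_seq n) w y"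
    by (intro allI ex \<beta>(2) assms(2) an)
  then obtain W Y where WY: "\<And>n. global_solution (real N - 1) (1 + \<alpha>_seq n) A (a_seq n) (W n) (Y n)"
    unfolding choice_iff by (elim exE) blast
  have "\<forall>n. \<exists>w y. global_solution (real N - 1) (1 + \<alpha>_seq n) (a_seq n) A w y"
    by (intro allI ex \<beta>(2) assms(2) an)
  then obtain U V where UV: "\<And>n. global_solution (real N - 1) (1 + \<alpha>_seq n) (a_seq n) A (U n) (V n)"
    unfolding choice_iff by (elim exE) blast
  show ?thesis
    unfolding mu_plus_eq[OF \<alpha> a assms(2,1) wy] mu_plus_eq[OF assms(5) an assms(2,1) WY]
      mu_minus_eq[OF \<alpha> a assms(2,1) uv] mu_minus_eq[OF assms(5) an assms(2,1) UV]
    by (intro conjI zeros[OF assms(2) a assms(2) an tendsto_const lima wy WY]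
        zeros[OF a assms(2) an assms(2) lima tendsto_const uv UV])
qed

end
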